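(* Assume the following. (1) $F$ is twice continuously differentiable and convex with $0\preceq \nabla^2F(\theta)\preceq L_f I_d$ for all $\theta\in\mathbb{R}^d$, and there exist $\delta_1,\lambda>0$ such that $\nabla^2F(\theta)\succeq\lambda I_d$ for all $\theta$ in the $\delta_1$-ball centered at $\theta^\star$. (2) $\mathbb{E}[\nabla f(\theta;\zeta)]=\nabla F(\theta)$ for all $\theta$, and for some $0<\delta\le 2$ there exists $M>0$ such that $\mathbb{E}\|\nabla f(\theta;\zeta)-\nabla F(\theta)\|^{2+\delta}\le M(\|\theta-\theta^\star\|^{2+\delta}+1)$ for all $\theta$. (3) There are $L_h,L_p>0$ such that for all $\theta,\theta'$, $\mathbb{E}\|\nabla^2f(\theta;\zeta)-\nabla^2f(\theta';\zeta)\|^2\le L_h\|\theta-\theta'\|^2$, and $\mathbb{E}\|[\nabla^2f(\theta^\star;\zeta)]^2-H^2\|\le L_p$, where $H=\nabla^2F(\theta^\star)$. (4) For a fixed integer $m\ge1$, the directions $v_i^{(j)}$, $i\ge1$, $1\le j\le m$, are i.i.d. from a distribution $\mathcal{P}_v$ with $\mathbb{E}[vv^\top]=I_d$ and finite $(6+3\delta)$-th moment. Let $\eta_n=\eta_0n^{-\alpha}$ with $\eta_0>0$, $\alpha\in(\tfrac12,1)$, and $h_n=h_0n^{-\gamma}$ with $h_0>0$, $\gamma\in(\tfrac12,1)$. Then the averaged $(m+1)$-query Kiefer-Wolfowitz estimator $\overline\theta_n^{(m)}$ satisfies, as $n\to\infty$, $$\sqrt n\,\big(\overline\theta_n^{(m)}-\theta^\star\big)\Longrightarrow\mathcal{N}\left(0,\;H^{-1}Q_mH^{-1}\right),\qquad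 Q_m=\frac1mQ+\frac{m-1}{m}S,$$ where $Q=\mathbb{E}[vv^\top Svv^\top]$ with $v\sim\mathcal{P}_v$, $S=\mathbb{E}[\nabla f(\theta^\star;\zeta)\nabla f(\theta^\star;\zeta)^\top]$, and $\Longrightarrow$ denotes convergence in distribution.
   Context: Setting: $\zeta\sim\mathcal{P}_\zeta$ is a random data point, $f(\theta;\zeta)$ is an individual loss, convex in $\theta\in\mathbb{R}^d$ ($d$ fixed), $F(\theta)=\mathbb{E}[f(\theta;\zeta)]$ and $\theta^\star=\mathrm{argmin}\,F$. Derivatives of $f$ are in $\theta$. $\zeta_1,\zeta_2,\dots$ are i.i.d. copies of $\zeta$. $\|\cdot\|$ is the Euclidean norm for vectors and the spectral norm for matrices. $(m+1)$-query Kiefer-Wolfowitz iterates: for $h>0$, $v\in\mathbb{R}^d$ put $\widehat g_{h,v}(\theta;\zeta)=\frac{f(\theta+hv;\zeta)-f(\theta;\zeta)}{h}\,v$. Given an arbitrary initial point $\theta_0^{(m)}=\theta_0\in\mathbb{R}^d$ and random directions independent of the data, $$\theta_i^{(m)}=\theta_{i-1}^{(m)}-\frac{\eta_i}{m}\sum_{j=1}^m\widehat g_{h_i,v_i^{(j)}}\big(\theta_{i-1}^{(m)};\zeta_i\big),\qquad \overline\theta_n^{(m)}=\frac1n\sum_{i=1}^n\theta_i^{(m)}.$$ *)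

theory Defs
  imports "HOL-Probability.Probability"
begin

section \<open>Derivatives and matrices\<close>

text \<open>Both are the usual objects only where the derivatives exist; otherwise their value
  is unspecified.\<close>

definition grad :: "('a::real_inner \<Rightarrow> real) \<Rightarrow> 'a \<Rightarrow> 'a" where
  "grad g x = (THE D. GDERIV g x :> D)"

definition hessian :: "(real^'n \<Rightarrow> real) \<Rightarrow> real^'n \<Rightarrow> real^'n^'n" where
  "hessian g x = jacobian (grad g) (at x)"

definition twice_differentiable :: "(real^'n \<Rightarrow> real) \<Rightarrow> bool" where
  "twice_differentiable g \<longleftrightarrow>
     (\<forall>x. g differentiable (at x)) \<and> (\<forall>x. grad g differentiable (at x))"

definition twice_cont_differentiable :: "(real^'n \<Rightarrow> real) \<Rightarrow> bool" where
  "twice_cont_differentiable g \<longleftrightarrow>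
     twice_differentiable g \<and> continuous_on UNIV (hessian g)"

definition outer :: "real^'n \<Rightarrow> real^'n \<Rightarrow> real^'n^'n" where
  "outer x y = (\<chi> i j. x $ i * y $ j)"

definition pos_semidef :: "real^'n^'n \<Rightarrow> bool" where
  "pos_semidef A \<longleftrightarrow> transpose A = A \<and> (\<forall>x. 0 \<le> x \<bullet> (A *v x))"

definition loewner_le :: "real^'n^'n \<Rightarrow> real^'n^'n \<Rightarrow> bool" where
  "loewner_le A B \<longleftrightarrow> pos_semidef (B - A)"

text \<open>\<^const>\<open>norm\<close> on \<^typ>\<open>real^'n^'n\<close> is the Frobenius norm, hence a separate constant.\<close>

definition spectral_norm :: "real^'n^'n \<Rightarrow> real" where
  "spectral_norm A = onorm ((*v) A)"


section \<open>Random vectors\<close>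

definition iid :: "'w measure \<Rightarrow> 'a measure \<Rightarrow> ('i \<Rightarrow> 'w \<Rightarrow> 'a) \<Rightarrow> 'i set \<Rightarrow> bool" where
  "iid M N X I \<longleftrightarrow>
     prob_space.indep_vars M (\<lambda>_. N) X I \<and> (\<forall>i\<in>I. distr M N (X i) = N)"

text \<open>Independence of the sigma-algebras generated by the two families. (The library's
  \<open>indep_var\<close> needs both variables to take values in the same type.)\<close>

definition indep_families ::
  "'w measure \<Rightarrow> 'a measure \<Rightarrow> ('i \<Rightarrow> 'w \<Rightarrow> 'a) \<Rightarrow> 'i set
     \<Rightarrow> 'b measure \<Rightarrow> ('j \<Rightarrow> 'w \<Rightarrow> 'b) \<Rightarrow> 'j set \<Rightarrow> bool" where
  "indep_families M N X I N' Y J \<longleftrightarrow>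
     prob_space.indep_set M
       (sets (vimage_algebra (space M) (\<lambda>\<omega>. \<lambda>i\<in>I. X i \<omega>) (Pi\<^sub>M I (\<lambda>_. N))))
       (sets (vimage_algebra (space M) (\<lambda>\<omega>. \<lambda>j\<in>J. Y j \<omega>) (Pi\<^sub>M J (\<lambda>_. N'))))"

definition converges_in_distribution ::
  "'w measure \<Rightarrow> (nat \<Rightarrow> 'w \<Rightarrow> 'a::euclidean_space) \<Rightarrow> 'a measure \<Rightarrow> bool" where
  "converges_in_distribution M X \<mu> \<longleftrightarrow>
     (\<forall>n. X n \<in> borel_measurable M) \<and>
     (\<forall>g::'a \<Rightarrow> real. continuous_on UNIV g \<longrightarrow> bounded (range g) \<longrightarrow>
        (\<lambda>n. \<integral>\<omega>. g (X n \<omega>) \<partial>M) \<longlonglongrightarrow> (\<integral>x. g x \<partial>\<mu>))"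

definition std_mv_normal :: "(real^'n) measure" where
  "std_mv_normal = density lborel (\<lambda>x. ennreal (\<Prod>i\<in>UNIV. std_normal_density (x $ i)))"

text \<open>The law of \<open>\<mu> + A Z\<close> with \<open>Z\<close> standard normal and \<open>A A\<^sup>T = \<Sigma>\<close>. Such an \<open>A\<close> exists iff
  \<open>\<Sigma>\<close> is positive semidefinite (possibly singular, so there need not be a density), and the
  law depends on \<open>A\<close> only through \<open>A A\<^sup>T\<close>.\<close>

definition mv_normal :: "real^'n \<Rightarrow> real^'n^'n \<Rightarrow> (real^'n) measure" where
  "mv_normal \<mu> \<Sigma> =
     distr std_mv_normal borel (\<lambda>x. \<mu> + (SOME A :: real^'n^'n. A ** transpose A = \<Sigma>) *v x)"


section \<open>Kiefer-Wolfowitz iterates\<close>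

definition kw_gradient ::
  "('a::real_vector \<Rightarrow> 'z \<Rightarrow> real) \<Rightarrow> real \<Rightarrow> 'a \<Rightarrow> 'a \<Rightarrow> 'z \<Rightarrow> 'a" where
  "kw_gradient f h v \<theta> z = ((f (\<theta> + h *\<^sub>R v) z - f \<theta> z) / h) *\<^sub>R v"

text \<open>Pathwise recursion: \<open>z i\<close> and \<open>v i j\<close> are the realised data and directions.\<close>

primrec kw_iterate ::
  "('a::real_vector \<Rightarrow> 'z \<Rightarrow> real) \<Rightarrow> nat \<Rightarrow> (nat \<Rightarrow> real) \<Rightarrow> (nat \<Rightarrow> real) \<Rightarrow> 'a
     \<Rightarrow> (nat \<Rightarrow> 'z) \<Rightarrow> (nat \<Rightarrow> nat \<Rightarrow> 'a) \<Rightarrow> nat \<Rightarrow> 'a" where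
  "kw_iterate f m \<eta> h \<theta>\<^sub>0 z v 0 = \<theta>\<^sub>0"
| "kw_iterate f m \<eta> h \<theta>\<^sub>0 z v (Suc i) =
     kw_iterate f m \<eta> h \<theta>\<^sub>0 z v i
       - (\<eta> (Suc i) / real m) *\<^sub>R
           (\<Sum>j=1..m. kw_gradient f (h (Suc i)) (v (Suc i) j)
                        (kw_iterate f m \<eta> h \<theta>\<^sub>0 z v i) (z (Suc i)))"

definition kw_average ::
  "('a::real_vector \<Rightarrow> 'z \<Rightarrow> real) \<Rightarrow> nat \<Rightarrow> (nat \<Rightarrow> real) \<Rightarrow> (nat \<Rightarrow> real) \<Rightarrow> 'a
     \<Rightarrow> (nat \<Rightarrow> 'z) \<Rightarrow> (nat \<Rightarrow> nat \<Rightarrow> 'a) \<Rightarrow> nat \<Rightarrow> 'a" where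
  "kw_average f m \<eta> h \<theta>\<^sub>0 z v n =
     (1 / real n) *\<^sub>R (\<Sum>i=1..n. kw_iterate f m \<eta> h \<theta>\<^sub>0 z v i)"

end

theory Submission
  imports Defs
begin

text \<open>The iterates are compared with an i.i.d. sum. Write \<open>D\<^sub>i = \<theta>\<^sub>i - \<theta>\<^sub>s\<close> and let \<open>G0\<close> be the
  search direction at \<open>\<theta>\<^sub>s\<close> with the difference quotients replaced by directional derivatives.
  By convexity the difference quotient along \<open>v\<close> lies between two directional derivatives, so the
  actual search direction differs from \<open>G0\<close> in mean square by \<open>O(\<parallel>D\<parallel>\<^sup>2 + h\<^sup>2)\<close>, and its mean
  differs from the gradient of the risk by \<open>O(h)\<close>. A global Lyapunov estimate shows that
  the iterates come close to \<open>\<theta>\<^sub>s\<close> at some late time with high probability; on the event that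
  they then never leave the region of strong convexity, \<open>E \<parallel>D\<^sub>n\<parallel>\<^sup>2 = O(n powr (-\<alpha>))\<close>, and the same
  recursion bounds the probability of leaving. Dividing the recursion by the step size and summing
  (Polyak--Juditsky) expresses \<open>H (\<Sum>\<^sub>i D\<^sub>i)\<close> as \<open>- \<Sum>\<^sub>i G0 (W\<^sub>i)\<close> plus terms that are \<open>o(sqrt n)\<close>
  in probability, so that only a central limit theorem for an i.i.d. sum is needed. It
  follows from the one-dimensional one via characteristic functions.\<close>

text \<open>Strong convexity is only local, so no rate for the second moment is derived on the whole
  space. Instead of conditioning on staying in the region, every quantity is multiplied by the
  indicator of having stayed so far. This is an event of the past, so expectations over the next
  observation factor as before and the residuals remain martingale differences. For each tolerance
  \<open>d\<close> such an event is fixed before \<open>n\<close> tends to infinity, and off it the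
  remainder is only known to be at most 1 after truncation. The exponents enter as follows.
  Quadratic linearisation errors sum to order \<open>n powr (1 - \<alpha>)\<close> and biases to
  order \<open>n powr (1 - \<gamma>)\<close>, both below \<open>sqrt n\<close> because the exponents
  exceed 1/2. The terms from summation by parts are of order \<open>n powr (\<alpha> / 2)\<close>,
  below \<open>sqrt n\<close> because \<alpha> < 1. The residuals are orthogonal, with variances
  summing to order \<open>n powr (1 - \<alpha>)\<close>.\<close>

section \<open>Multivariate normal laws\<close>

lemma pos_semidef_quadratic_form:
  "pos_semidef (A::real^'n^'n) \<Longrightarrow> 0 \<le> x \<bullet> (A *v x)"
  by (simp add: pos_semidef_def)

lemma symmetric_inner:
  fixes A :: "real^'n^'n"
  assumes "transpose A = A"
  shows "x \<bullet> (A *v y) = (A *v x) \<bullet> y"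
  by (metis assms dot_lmul_matrix vector_transpose_matrix)

lemma pos_semidef_symmetric: "pos_semidef A \<Longrightarrow> transpose A = A"
  by (simp add: pos_semidef_def)

lemma outer_vector_mult: "outer a b *v x = (b \<bullet> x) *\<^sub>R a" for a b x :: "real^'n"
  by (simp add: vec_eq_iff outer_def matrix_vector_mult_def inner_vec_def sum_distrib_left
      sum_distrib_right mult_ac)

text \<open>One Cholesky step: the form of the reduced matrix at \<open>x\<close> is the minimum of
  the form of \<open>A\<close> over the line \<open>x + s *\<^sub>R axis k 1\<close>, hence
  nonnegative.\<close>

lemma pos_semidef_rank_one_reduction:
  fixes A :: "real^'n^'n"
  assumes psd: "pos_semidef A" and pos: "A $ k $ k > 0"
  shows "pos_semidef (A - (1 / A $ k $ k) *\<^sub>R outer (A $ k) (A $ k))"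
proof -
  define d where "d = A $ k $ k"
  have dp: "d > 0" using pos by (simp add: d_def)
  have sym: "transpose A = A" using psd by (rule pos_semidef_symmetric)
  have symc: "A $ i $ j = A $ j $ i" for i j
    using sym by (metis transpose_def vec_lambda_beta)
  have ax: "A *v axis k 1 = A $ k"
    by (simp add: matrix_vector_mult_basis column_def vec_eq_iff symc)
  have quad: "0 \<le> x \<bullet> (A *v x) - (A $ k \<bullet> x)\<^sup>2 / d" for x
  proof -
    \<comment> \<open>The minimiser over \<open>s\<close> of the form along the k-th axis.\<close>
    define s where "s = - (A $ k \<bullet> x) / d"
    let ?y = "x + s *\<^sub>R axis k 1"
    have "0 \<le> ?y \<bullet> (A *v ?y)" using psd by (rule pos_semidef_quadratic_form)
    also have "A *v ?y = A *v x + s *\<^sub>R A $ k"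
      by (simp add: matrix_vector_right_distrib matrix_vector_mult_scaleR ax)
    also have "?y \<bullet> (A *v x + s *\<^sub>R A $ k) =
        x \<bullet> (A *v x) + s * (x \<bullet> A $ k) + s * (axis k 1 \<bullet> (A *v x)) + s * s * (axis k 1 \<bullet> A $ k)"
      by (simp add: inner_add_left inner_add_right algebra_simps)
    also have "axis k 1 \<bullet> (A *v x) = A $ k \<bullet> x"
      using symmetric_inner[OF sym, of "axis k 1" x] ax by simp
    also have "axis k 1 \<bullet> A $ k = d"
      by (simp add: d_def inner_axis' )
    also have "x \<bullet> A $ k = A $ k \<bullet> x" by (rule inner_commute)
    finally show ?thesis using dp
      by (simp add: s_def power2_eq_square field_simps)
  qed
  show ?thesis
    unfolding pos_semidef_def
  proof (intro conjI allI)
    show "transpose (A - (1 / A $ k $ k) *\<^sub>R outer (A $ k) (A $ k)) =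
        A - (1 / A $ k $ k) *\<^sub>R outer (A $ k) (A $ k)"
      by (simp add: vec_eq_iff transpose_def outer_def symc mult.commute)
    fix x
    have "(A - (1 / d) *\<^sub>R outer (A $ k) (A $ k)) *v x = A *v x - ((A $ k \<bullet> x) / d) *\<^sub>R A $ k"
      by (simp add: matrix_vector_mult_diff_rdistrib scaleR_matrix_vector_assoc[symmetric]
          outer_vector_mult)
    then have "x \<bullet> ((A - (1 / d) *\<^sub>R outer (A $ k) (A $ k)) *v x) =
        x \<bullet> (A *v x) - (A $ k \<bullet> x)\<^sup>2 / d"
      by (simp add: inner_diff_right power2_eq_square inner_commute)
    then show "0 \<le> x \<bullet> ((A - (1 / A $ k $ k) *\<^sub>R outer (A $ k) (A $ k)) *v x)"
      using quad[of x] by (simp add: d_def)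
  qed
qed

text \<open>On the line \<open>A $ k + s *\<^sub>R axis k 1\<close> the form is affine in
  \<open>s\<close>, with slope twice the squared norm of row \<open>k\<close>; an affine function
  that is bounded below has slope zero.\<close>

lemma pos_semidef_zero_row:
  fixes A :: "real^'n^'n"
  assumes psd: "pos_semidef A" and z: "A $ k $ k = 0"
  shows "A $ k = 0"
proof (rule ccontr)
  assume ne: "A $ k \<noteq> 0"
  have sym: "transpose A = A" using psd by (rule pos_semidef_symmetric)
  have symc: "A $ i $ j = A $ j $ i" for i j
    using sym by (metis transpose_def vec_lambda_beta)
  have ax: "A *v axis k 1 = A $ k"
    by (simp add: matrix_vector_mult_basis column_def vec_eq_iff symc)
  let ?x = "A $ k"
  have q: "0 \<le> ?x \<bullet> (A *v ?x) + 2 * s * (?x \<bullet> ?x)" for s :: real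
  proof -
    let ?y = "?x + s *\<^sub>R axis k 1"
    have "0 \<le> ?y \<bullet> (A *v ?y)" using psd by (rule pos_semidef_quadratic_form)
    also have "A *v ?y = A *v ?x + s *\<^sub>R A $ k"
      by (simp add: matrix_vector_right_distrib matrix_vector_mult_scaleR ax)
    also have "?y \<bullet> (A *v ?x + s *\<^sub>R A $ k) =
        ?x \<bullet> (A *v ?x) + s * (?x \<bullet> A $ k) + s * (axis k 1 \<bullet> (A *v ?x)) + s * s * (axis k 1 \<bullet> A $ k)"
      by (simp add: inner_add_left inner_add_right algebra_simps)
    also have "axis k 1 \<bullet> (A *v ?x) = A $ k \<bullet> ?x"
      using symmetric_inner[OF sym, of "axis k 1" ?x] ax by simp
    also have "axis k 1 \<bullet> A $ k = 0"
      by (simp add: inner_axis' z)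
    finally show ?thesis by simp
  qed
  have p: "?x \<bullet> ?x > 0" using ne by simp
  have "0 \<le> ?x \<bullet> (A *v ?x)" using psd by (rule pos_semidef_quadratic_form)
  \<comment> \<open>Chosen so that the affine function becomes minus the form at \<open>?x\<close>
    minus 2, which is negative.\<close>
  moreover define s where "s = - (?x \<bullet> (A *v ?x) + 1) / (?x \<bullet> ?x)"
  moreover have "s * (?x \<bullet> ?x) = - (?x \<bullet> (A *v ?x) + 1)"
    using p by (simp add: s_def)
  ultimately have "0 \<le> ?x \<bullet> (A *v ?x) + 2 * - (?x \<bullet> (A *v ?x) + 1)"
    using q[of s] by (simp only: mult.assoc)
  then show False using psd by (simp add: pos_semidef_quadratic_form) (smt (verit) pos_semidef_quadratic_form)
qed

text \<open>Cholesky factorisation by induction on a set containing all nonzero rows. A positive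
  pivot clears row \<open>k\<close> and contributes one rank-one term; a zero pivot means that row
  \<open>k\<close> is already zero.\<close>

lemma pos_semidef_sum_outer:
  fixes A :: "real^'n^'n"
  assumes "finite S" "pos_semidef A" "\<And>i. i \<notin> S \<Longrightarrow> A $ i = 0"
  shows "\<exists>c. A = (\<Sum>k\<in>S. outer (c k) (c k))"
  using assms
proof (induction S arbitrary: A rule: finite_induct)
  case empty
  then show ?case by (simp add: vec_eq_iff)
next
  case (insert k S)
  have symc: "A $ i $ j = A $ j $ i" for i j
    using pos_semidef_symmetric[OF insert.prems(1)] by (metis transpose_def vec_lambda_beta)
  have "0 \<le> axis k 1 \<bullet> (A *v axis k 1)"
    using insert.prems(1) by (rule pos_semidef_quadratic_form)
  then have nn: "0 \<le> A $ k $ k"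
    by (simp add: matrix_vector_mult_basis column_def inner_axis')
  show ?case
  proof (cases "A $ k $ k = 0")
    case True
    have "A $ k = 0" by (rule pos_semidef_zero_row[OF insert.prems(1) True])
    then have "\<exists>c. A = (\<Sum>k\<in>S. outer (c k) (c k))"
      using insert.prems by (intro insert.IH) (metis insert_iff)+
    then obtain c where c: "A = (\<Sum>k\<in>S. outer (c k) (c k))" by blast
    have "A = (\<Sum>l\<in>insert k S. outer ((c(k := 0)) l) ((c(k := 0)) l))"
      using insert.hyps by (subst c) (auto simp: outer_def vec_eq_iff intro!: sum.cong)
    then show ?thesis by blast
  next
    case False
    with nn have pos: "A $ k $ k > 0" by simp
    let ?B = "A - (1 / A $ k $ k) *\<^sub>R outer (A $ k) (A $ k)"
    have "?B $ i = 0" if "i \<notin> S" for i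
    proof (cases "i = k")
      case True
      then show ?thesis using pos by (simp add: vec_eq_iff outer_def)
    next
      case False
      then have "A $ i = 0" using that insert.prems by auto
      then show ?thesis using symc[of k i] by (simp add: vec_eq_iff outer_def)
    qed
    then have "\<exists>c. ?B = (\<Sum>k\<in>S. outer (c k) (c k))"
      using pos_semidef_rank_one_reduction[OF insert.prems(1) pos] by (intro insert.IH)
    then obtain c where c: "?B = (\<Sum>k\<in>S. outer (c k) (c k))" by blast
    define w where "w = (1 / sqrt (A $ k $ k)) *\<^sub>R A $ k"
    have w: "outer w w = (1 / A $ k $ k) *\<^sub>R outer (A $ k) (A $ k)"
      using pos by (simp add: vec_eq_iff outer_def w_def)
    have "(\<Sum>l\<in>insert k S. outer ((c(k := w)) l) ((c(k := w)) l)) = outer w w + (\<Sum>l\<in>S. outer (c l) (c l))"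
      using insert.hyps by (simp, intro sum.cong) auto
    also have "\<dots> = A" by (simp only: c[symmetric] w) simp
    finally show ?thesis by metis
  qed
qed

lemma pos_semidef_factorization:
  fixes A :: "real^'n^'n"
  assumes "pos_semidef A"
  shows "\<exists>B::real^'n^'n. B ** transpose B = A"
proof -
  obtain c :: "'n \<Rightarrow> real^'n" where c: "A = (\<Sum>k\<in>UNIV. outer (c k) (c k))"
    using pos_semidef_sum_outer[OF finite_class.finite_UNIV assms, simplified] by blast
  have "(\<chi> i k. c k $ i) ** transpose (\<chi> i k. c k $ i) = A"
    by (subst c) (simp add: vec_eq_iff matrix_matrix_mult_def transpose_def outer_def)
  then show ?thesis by blast
qed

section \<open>Characteristic functions of normal laws\<close>

lemma prod_UNIV_axis:
  "(\<Prod>i\<in>UNIV. g (x $ i)) = (\<Prod>b\<in>Basis. g (x \<bullet> b))" for x :: "real^'n"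
proof -
  have B: "(Basis :: (real^'n) set) = (\<lambda>i. axis i 1) ` UNIV"
    by (auto simp: Basis_vec_def)
  have inj: "inj (\<lambda>i::'n. axis i (1::real))"
    by (auto simp: inj_on_def axis_eq_axis)
  show ?thesis
    by (simp add: B prod.reindex[OF inj] inner_axis)
qed

text \<open>Density and exponential both factor over the coordinates, and Lebesgue measure is the
  image of a product measure, so the integral is a product of one-dimensional characteristic
  functions.\<close>

lemma std_mv_normal_char:
  fixes t :: "real^'n"
  shows "(\<integral>x. iexp (t \<bullet> x) \<partial>std_mv_normal) = of_real (exp (- (t \<bullet> t) / 2))"
proof -
  interpret P: product_sigma_finite "\<lambda>_::real^'n. lborel::real measure"
    by standard
  let ?k = "\<lambda>b y. std_normal_density y *\<^sub>R iexp ((t \<bullet> b) * y)"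
  have one: "(\<integral>y. std_normal_density y *\<^sub>R iexp (s * y) \<partial>lborel) = of_real (exp (- s\<^sup>2 / 2))" for s
    using fun_cong[OF char_std_normal_distribution, of s]
    unfolding char_def
    by (subst (asm) integral_density) (auto simp: normal_density_nonneg)
  have int: "integrable lborel (?k b)" for b
  proof (rule Bochner_Integration.integrable_bound)
    show "integrable lborel std_normal_density" by (rule integrable_normal_density) simp
    show "?k b \<in> borel_measurable lborel" by measurable
  qed (simp add: normal_density_nonneg)
  have e: "(\<Prod>i\<in>UNIV. std_normal_density (x $ i)) *\<^sub>R iexp (t \<bullet> x) = (\<Prod>b\<in>Basis. ?k b (x \<bullet> b))" for x
  proof -
    have "iexp (t \<bullet> x) = (\<Prod>b\<in>Basis. iexp ((t \<bullet> b) * (x \<bullet> b)))"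
      by (simp add: euclidean_inner[of t x] exp_sum[symmetric] sum_distrib_left)
    then show ?thesis
      by (simp add: prod_UNIV_axis scaleR_conv_of_real prod.distrib)
  qed
  have m: "(\<lambda>f. \<Sum>b\<in>Basis. f b *\<^sub>R b) \<in> borel_measurable (\<Pi>\<^sub>M b\<in>(Basis::(real^'n) set). (lborel::real measure))"
    by measurable
  have "(\<integral>x. iexp (t \<bullet> x) \<partial>std_mv_normal) =
      (\<integral>x. (\<Prod>i\<in>UNIV. std_normal_density (x $ i)) *\<^sub>R iexp (t \<bullet> x) \<partial>lborel)"
    unfolding std_mv_normal_def
    by (rule integral_density) (auto intro!: prod_nonneg normal_density_nonneg)
  also have "\<dots> = (\<integral>x. (\<Prod>b\<in>Basis. ?k b (x \<bullet> b)) \<partial>lborel)"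
    by (simp only: e)
  also have "\<dots> = (\<integral>f. (\<Prod>b\<in>Basis. ?k b ((\<Sum>c\<in>Basis. f c *\<^sub>R c) \<bullet> b)) \<partial>(\<Pi>\<^sub>M b\<in>(Basis::(real^'n) set). lborel))"
    by (subst lborel_eq, rule integral_distr[OF m]) measurable
  also have "\<dots> = (\<integral>f. (\<Prod>b\<in>Basis. ?k b (f b)) \<partial>(\<Pi>\<^sub>M b\<in>(Basis::(real^'n) set). lborel))"
    by (intro Bochner_Integration.integral_cong prod.cong refl) simp
  also have "\<dots> = (\<Prod>b\<in>Basis. of_real (exp (- (t \<bullet> b)\<^sup>2 / 2)))"
    by (subst P.product_integral_prod[OF finite_Basis int]) (simp only: one)
  also have "\<dots> = of_real (exp (- (t \<bullet> t) / 2))"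
    by (simp add: euclidean_inner[of t t] exp_sum[symmetric] of_real_prod[symmetric] sum_negf
        sum_divide_distrib power2_eq_square del: of_real_prod)
  finally show ?thesis .
qed

lemma sets_std_mv_normal [simp, measurable_cong]: "sets std_mv_normal = sets borel"
  by (simp add: std_mv_normal_def)

lemma prob_space_std_mv_normal: "prob_space (std_mv_normal :: (real^'n) measure)"
proof
  have "emeasure std_mv_normal (space (std_mv_normal :: (real^'n) measure)) =
      (\<integral>\<^sup>+x. ennreal (\<Prod>b\<in>Basis. std_normal_density (x \<bullet> b)) \<partial>(lborel :: (real^'n) measure))"
    by (simp add: std_mv_normal_def emeasure_density prod_UNIV_axis)
  also have "\<dots> = (\<integral>\<^sup>+x. (\<Prod>b\<in>Basis. ennreal (std_normal_density (x \<bullet> b))) \<partial>(lborel :: (real^'n) measure))"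
    by (simp add: prod_ennreal normal_density_nonneg)
  also have "\<dots> = (\<Prod>b\<in>(Basis::(real^'n) set). (\<integral>\<^sup>+x. ennreal (std_normal_density x) \<partial>lborel))"
    by (rule nn_integral_lborel_prod) auto
  also have "(\<integral>\<^sup>+x. ennreal (std_normal_density x) \<partial>lborel) = 1"
    using prob_space.emeasure_space_1[OF prob_space_normal_density[of 1 0]]
    by (simp add: emeasure_density)
  finally show "emeasure std_mv_normal (space (std_mv_normal :: (real^'n) measure)) = 1" by simp
qed

lemma prob_space_mv_normal: "prob_space (mv_normal \<mu> \<Sigma> :: (real^'n) measure)"
proof -
  have "(\<lambda>x. \<mu> + (SOME A :: real^'n^'n. A ** transpose A = \<Sigma>) *v x) \<in> borel_measurable borel"
    by (intro borel_measurable_continuous_onI continuous_intros matrix_vector_mult_linear_continuous_on)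
  then show ?thesis
    unfolding mv_normal_def
    by (intro prob_space.prob_space_distr[OF prob_space_std_mv_normal]) simp
qed

lemma sets_mv_normal [simp, measurable_cong]: "sets (mv_normal \<mu> \<Sigma>) = sets borel"
  by (simp add: mv_normal_def)

text \<open>The matrix picked by \<open>SOME\<close> is known only through
  \<open>A ** transpose A\<close>, but the characteristic function at \<open>t\<close> depends only
  on the norm of \<open>transpose A *v t\<close>. Positive semidefiniteness guarantees that there is
  something to pick.\<close>

lemma mv_normal_char:
  fixes t :: "real^'n"
  assumes "pos_semidef \<Sigma>"
  shows "(\<integral>x. iexp (t \<bullet> x) \<partial>mv_normal 0 \<Sigma>) = of_real (exp (- (t \<bullet> (\<Sigma> *v t)) / 2))"
proof -
  define A where "A = (SOME A :: real^'n^'n. A ** transpose A = \<Sigma>)"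
  have A: "A ** transpose A = \<Sigma>"
    unfolding A_def by (rule someI_ex) (rule pos_semidef_factorization[OF assms])
  have [measurable]: "(*v) A \<in> borel_measurable borel"
    by (simp add: borel_measurable_continuous_onI matrix_vector_mult_linear_continuous_on)
  have "(\<integral>x. iexp (t \<bullet> x) \<partial>mv_normal 0 \<Sigma>) = (\<integral>x. iexp (t \<bullet> (A *v x)) \<partial>std_mv_normal)"
    unfolding mv_normal_def A_def[symmetric] by (subst integral_distr) auto
  also have "\<dots> = (\<integral>x. iexp ((transpose A *v t) \<bullet> x) \<partial>std_mv_normal)"
    by (simp add: transpose_matrix_vector dot_lmul_matrix)
  also have "\<dots> = of_real (exp (- ((transpose A *v t) \<bullet> (transpose A *v t)) / 2))"
    by (rule std_mv_normal_char)
  also have "(transpose A *v t) \<bullet> (transpose A *v t) = t \<bullet> (\<Sigma> *v t)"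
    by (simp add: transpose_matrix_vector dot_lmul_matrix A[symmetric] matrix_vector_mul_assoc[symmetric])
  finally show ?thesis .
qed

section \<open>Convergence in distribution from characteristic functions\<close>

inductive trig_poly :: "('a::real_inner \<Rightarrow> complex) \<Rightarrow> bool" where
  mono: "trig_poly (\<lambda>x. c * iexp (t \<bullet> x))"
| add: "trig_poly p \<Longrightarrow> trig_poly q \<Longrightarrow> trig_poly (\<lambda>x. p x + q x)"

lemma trig_poly_const: "trig_poly (\<lambda>x. c)"
  using trig_poly.mono[of c 0] by simp

lemma trig_poly_mult:
  assumes "trig_poly p" "trig_poly q"
  shows "trig_poly (\<lambda>x. p x * q x)"
  using assms
proof (induction p)
  case (mono c t)
  from mono show ?case
  proof (induction q)
    case (mono d s)
    have "(\<lambda>x. (c * iexp (t \<bullet> x)) * (d * iexp (s \<bullet> x))) = (\<lambda>x. (c * d) * iexp ((t + s) \<bullet> x))"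
      by (simp add: fun_eq_iff inner_add_left distrib_left exp_add)
    then show ?case by (simp only: trig_poly.mono)
  next
    case (add p q)
    then show ?case by (simp add: distrib_left trig_poly.add)
  qed
next
  case (add p1 p2)
  then show ?case by (simp add: distrib_right trig_poly.add)
qed

lemma trig_poly_sum:
  "(\<And>i. i \<in> I \<Longrightarrow> trig_poly (p i)) \<Longrightarrow> trig_poly (\<lambda>x. \<Sum>i\<in>I. p i x)"
  by (induction I rule: infinite_finite_induct) (auto intro: trig_poly_const trig_poly.add)

lemma trig_poly_cos: "trig_poly (\<lambda>x. complex_of_real (c * cos (t \<bullet> x)))"
proof -
  have "(\<lambda>x. complex_of_real (c * cos (t \<bullet> x))) =
      (\<lambda>x. (of_real c / 2) * iexp (t \<bullet> x) + (of_real c / 2) * iexp ((- t) \<bullet> x))"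
    by (simp add: fun_eq_iff complex_eq_iff Re_exp Im_exp)
  then show ?thesis by (simp only: trig_poly.intros)
qed

lemma trig_poly_sin: "trig_poly (\<lambda>x. complex_of_real (c * sin (t \<bullet> x)))"
proof -
  have "(\<lambda>x. complex_of_real (c * sin (t \<bullet> x))) =
      (\<lambda>x. (- \<i> * of_real c / 2) * iexp (t \<bullet> x) + (\<i> * of_real c / 2) * iexp ((- t) \<bullet> x))"
    by (simp add: fun_eq_iff complex_eq_iff Re_exp Im_exp)
  then show ?thesis by (simp only: trig_poly.intros)
qed

text \<open>A function supported in a box extends periodically, hence factors through this map, whose image
  lies in a compact torus where polynomials are uniformly dense; composed with it, polynomials become
  trigonometric polynomials.\<close>

definition torus_map :: "real \<Rightarrow> 'a::euclidean_space \<Rightarrow> 'a \<times> 'a" where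
  "torus_map w x = ((\<Sum>b\<in>Basis. cos (w * (x \<bullet> b)) *\<^sub>R b), (\<Sum>b\<in>Basis. sin (w * (x \<bullet> b)) *\<^sub>R b))"

text \<open>A linear functional of the torus map is a combination of cosines and sines of linear
  forms, and sums and products stay within the trigonometric polynomials.\<close>

lemma trig_poly_real_polynomial_function:
  fixes P :: "'a::euclidean_space \<times> 'a \<Rightarrow> real"
  assumes "real_polynomial_function P"
  shows "trig_poly (\<lambda>x. complex_of_real (P (torus_map w x)))"
  using assms
proof induction
  case (linear f)
  then interpret f: bounded_linear f .
  have "f (torus_map w x) = (\<Sum>b\<in>Basis. f (b, 0) * cos ((w *\<^sub>R b) \<bullet> x)) + (\<Sum>b\<in>Basis. f (0, b) * sin ((w *\<^sub>R b) \<bullet> x))" for x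
  proof -
    have "torus_map w x = (\<Sum>b\<in>Basis. cos (w * (x \<bullet> b)) *\<^sub>R (b, 0)) + (\<Sum>b\<in>Basis. sin (w * (x \<bullet> b)) *\<^sub>R (0, b))"
      by (simp add: torus_map_def prod_eq_iff fst_sum snd_sum)
    then have "f (torus_map w x) = f (\<Sum>b\<in>Basis. cos (w * (x \<bullet> b)) *\<^sub>R (b, 0)) + f (\<Sum>b\<in>Basis. sin (w * (x \<bullet> b)) *\<^sub>R (0, b))"
      by (simp only: f.add)
    then show ?thesis
      by (simp only: f.sum f.scaleR) (simp add: inner_commute mult.commute)
  qed
  then have "(\<lambda>x. complex_of_real (f (torus_map w x))) =
     (\<lambda>x. (\<Sum>b\<in>Basis. complex_of_real (f (b, 0) * cos ((w *\<^sub>R b) \<bullet> x)))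
        + (\<Sum>b\<in>Basis. complex_of_real (f (0, b) * sin ((w *\<^sub>R b) \<bullet> x))))"
    by (simp add: fun_eq_iff)
  then show ?case
    by (simp only:) (intro trig_poly.add trig_poly_sum trig_poly_cos trig_poly_sin)
next
  case (mult f g)
  then show ?case by (simp add: trig_poly_mult)
next
  case (add f g)
  then show ?case by (simp add: trig_poly.add)
qed (simp add: trig_poly_const)

lemma (in prob_space) trig_poly_integrable:
  fixes X :: "'a \<Rightarrow> 'b::euclidean_space"
  assumes "trig_poly p" and [measurable]: "X \<in> borel_measurable M"
  shows "integrable M (\<lambda>x. p (X x))"
  using assms(1)
proof induction
  case (mono c t)
  have [measurable]: "(\<lambda>x. complex_of_real (t \<bullet> X x)) \<in> borel_measurable M" by measurable
  show ?case by (intro integrable_mult_right integrable_iexp) auto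
qed auto

text \<open>A function vanishing outside a box is carried to a product of circles and approximated
  there by Stone-Weierstrass. The resulting \<open>h\<close> agrees with \<open>g\<close> on the
  ball of radius \<open>K\<close>; farther out it is a periodic continuation, of which only the
  bound \<open>C\<close> is retained.\<close>

lemma periodic_extension:
  fixes g :: "'a::euclidean_space \<Rightarrow> real"
  assumes cont: "continuous_on UNIV g" and K: "K > 0"
    and vanish: "\<And>x b. b \<in> Basis \<Longrightarrow> \<bar>x \<bullet> b\<bar> \<ge> K \<Longrightarrow> g x = 0"
    and C: "\<And>x. \<bar>g x\<bar> \<le> C" and e: "e > 0"
  shows "\<exists>p. trig_poly p \<and> (\<exists>h. (\<forall>x. norm x \<le> K \<longrightarrow> h x = g x) \<and> (\<forall>x. \<bar>h x\<bar> \<le> C)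
           \<and> (\<forall>x. cmod (complex_of_real (h x) - p x) \<le> e))"
proof -
  \<comment> \<open>Scales the interval from \<open>- K\<close> to \<open>K\<close> onto that from
    \<open>- pi / 2\<close> to \<open>pi / 2\<close>, where the cosine is nonnegative and
    \<open>arcsin\<close> inverts the sine.\<close>
  define w where "w = pi / (2 * K)"
  have w: "w > 0" using K by (simp add: w_def)
  define S :: "('a \<times> 'a) set" where
    "S = {y. \<forall>b\<in>Basis. (fst y \<bullet> b)\<^sup>2 + (snd y \<bullet> b)\<^sup>2 = 1}"
  \<comment> \<open>\<open>P\<close> singles out the image of the box by its nonnegative cosines,
    \<open>u\<close> recovers a point of the box from its sines, and \<open>G\<close> is zero on the
    rest of the torus.\<close>
  define P where "P = (\<lambda>y::'a \<times> 'a. \<forall>b\<in>Basis. 0 \<le> fst y \<bullet> b)"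
  define u where "u = (\<lambda>y::'a \<times> 'a. \<Sum>b\<in>Basis. (arcsin (snd y \<bullet> b) / w) *\<^sub>R b)"
  define G where "G = (\<lambda>y. if P y then g (u y) else 0)"
  have S_eq: "S = (\<Inter>b\<in>Basis. {y. (fst y \<bullet> b)\<^sup>2 + (snd y \<bullet> b)\<^sup>2 = 1})"
    by (auto simp: S_def)
  have clS: "closed S"
    unfolding S_eq by (intro closed_INT ballI closed_Collect_eq continuous_intros)
  have le1: "\<bar>fst y \<bullet> b\<bar> \<le> 1" "\<bar>snd y \<bullet> b\<bar> \<le> 1" if "y \<in> S" "b \<in> Basis" for y b
  proof -
    have "(fst y \<bullet> b)\<^sup>2 + (snd y \<bullet> b)\<^sup>2 = 1" using that by (simp add: S_def)
    then have "(fst y \<bullet> b)\<^sup>2 \<le> 1" "(snd y \<bullet> b)\<^sup>2 \<le> 1"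
      using zero_le_power2[of "fst y \<bullet> b"] zero_le_power2[of "snd y \<bullet> b"] by linarith+
    then show "\<bar>fst y \<bullet> b\<bar> \<le> 1" "\<bar>snd y \<bullet> b\<bar> \<le> 1" by (simp_all add: abs_square_le_1)
  qed
  have "bounded S"
  proof (rule boundedI)
    fix y assume y: "y \<in> S"
    have "norm y \<le> norm (fst y) + norm (snd y)"
      using norm_Pair_le[of "fst y" "snd y"] by simp
    also have "\<dots> \<le> (\<Sum>b\<in>Basis. \<bar>fst y \<bullet> b\<bar>) + (\<Sum>b\<in>Basis. \<bar>snd y \<bullet> b\<bar>)"
      by (intro add_mono norm_le_l1)
    also have "\<dots> \<le> (\<Sum>b\<in>(Basis::'a set). 1) + (\<Sum>b\<in>(Basis::'a set). 1)"
      using le1[OF y] by (intro add_mono sum_mono) auto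
    finally show "norm y \<le> (\<Sum>b\<in>(Basis::'a set). 1) + (\<Sum>b\<in>(Basis::'a set). 1)" .
  qed
  with clS have compS: "compact S" by (simp add: compact_eq_bounded_closed)
  have uc: "continuous_on S u"
    unfolding u_def using le1 w by (intro continuous_intros) (auto simp: abs_le_iff)
  have GS: "continuous_on S G"
  proof -
    let ?S1 = "S \<inter> (\<Inter>b\<in>Basis. {y. 0 \<le> fst y \<bullet> b})"
    let ?S2 = "S \<inter> (\<Union>b\<in>Basis. {y. fst y \<bullet> b \<le> 0})"
    have "continuous_on (?S1 \<union> ?S2) (\<lambda>y. if P y then g (u y) else 0)"
    proof (rule continuous_on_cases)
      show "closed ?S1"
        using clS by (intro closed_Int closed_INT ballI closed_Collect_le continuous_intros)
      show "closed ?S2"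
        using clS by (intro closed_Int closed_UN ballI closed_Collect_le continuous_intros) auto
      show "continuous_on ?S1 (\<lambda>y. g (u y))"
        using continuous_on_compose2[OF cont uc] by (auto intro: continuous_on_subset)
      show "\<forall>y. y \<in> ?S1 \<and> \<not> P y \<or> y \<in> ?S2 \<and> P y \<longrightarrow> g (u y) = 0"
      proof (intro allI impI)
        fix y assume "y \<in> ?S1 \<and> \<not> P y \<or> y \<in> ?S2 \<and> P y"
        \<comment> \<open>Where the two pieces overlap some cosine vanishes. The sine is then 1 or
          -1, the corresponding coordinate of \<open>u y\<close> has modulus \<open>K\<close>, and
          \<open>g\<close> is zero there.\<close>
        then obtain b where b: "b \<in> Basis" "fst y \<bullet> b = 0" "y \<in> S"
          by (force simp: P_def)
        then have "(snd y \<bullet> b)\<^sup>2 = 1" by (auto simp: S_def)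
        then have "snd y \<bullet> b = 1 \<or> snd y \<bullet> b = -1" by (simp add: power2_eq_1_iff)
        then have "\<bar>arcsin (snd y \<bullet> b) / w\<bar> = K" using K by (auto simp: w_def)
        moreover have "u y \<bullet> b = arcsin (snd y \<bullet> b) / w" using b by (simp add: u_def)
        ultimately show "g (u y) = 0" using vanish[OF b(1), of "u y"] by simp
      qed
    qed auto
    also have "?S1 \<union> ?S2 = S" using linear by fastforce
    finally show ?thesis by (simp add: G_def[abs_def])
  qed
  obtain q where q: "real_polynomial_function q" "\<And>y. y \<in> S \<Longrightarrow> \<bar>G y - q y\<bar> < e"
    using Stone_Weierstrass_real_polynomial_function[OF compS GS e] by blast
  have TS: "torus_map w x \<in> S" for x
    by (simp add: S_def torus_map_def)
  have C0: "0 \<le> C" using C[of 0] by linarith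
  have "G (torus_map w x) = g x" if x: "norm x \<le> K" for x
  proof -
    have xb: "\<bar>x \<bullet> b\<bar> \<le> K" if "b \<in> Basis" for b
      using Basis_le_norm[OF that, of x] x by linarith
    have wx: "- (pi / 2) \<le> w * (x \<bullet> b)" "w * (x \<bullet> b) \<le> pi / 2" if "b \<in> Basis" for b
    proof -
      have "\<bar>w * (x \<bullet> b)\<bar> \<le> w * K" using w xb[OF that] by (simp add: abs_mult)
      also have "w * K = pi / 2" using K by (simp add: w_def)
      finally show "- (pi / 2) \<le> w * (x \<bullet> b)" "w * (x \<bullet> b) \<le> pi / 2" by (auto simp: abs_le_iff)
    qed
    have "P (torus_map w x)"
      unfolding P_def
    proof
      fix b :: 'a assume b: "b \<in> Basis"
      have "fst (torus_map w x) \<bullet> b = cos (w * (x \<bullet> b))" using b by (simp add: torus_map_def)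
      then show "0 \<le> fst (torus_map w x) \<bullet> b" using cos_ge_zero[OF wx[OF b]] by simp
    qed
    moreover have "u (torus_map w x) = x"
    proof (rule euclidean_eqI)
      fix b :: 'a assume b: "b \<in> Basis"
      have "u (torus_map w x) \<bullet> b = arcsin (sin (w * (x \<bullet> b))) / w"
        using b by (simp add: u_def torus_map_def)
      also have "\<dots> = x \<bullet> b"
        using w by (simp only: arcsin_sin[OF wx[OF b]]) simp
      finally show "u (torus_map w x) \<bullet> b = x \<bullet> b" .
    qed
    ultimately show ?thesis by (simp add: G_def)
  qed
  moreover have "\<bar>G y\<bar> \<le> C" for y
    using C C0 by (simp add: G_def)
  moreover have "cmod (complex_of_real (G (torus_map w x)) - complex_of_real (q (torus_map w x))) \<le> e" for x
    using q(2)[OF TS[of x]] by (simp flip: of_real_diff)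
  ultimately show ?thesis
    using trig_poly_real_polynomial_function[OF q(1), of w]
    by (intro exI[of _ "\<lambda>x. complex_of_real (q (torus_map w x))"] conjI
        exI[of _ "\<lambda>x. G (torus_map w x)"]) auto
qed

text \<open>Split at radius \<open>K\<close>: inside, \<open>h\<close> is \<open>g\<close>; outside,
  both are bounded by \<open>C\<close>, whence the factor \<open>2 * C\<close>. The error of
  \<open>p\<close> against \<open>h\<close> is uniform.\<close>

lemma (in prob_space) expectation_trig_approx:
  fixes X :: "'a \<Rightarrow> 'b::euclidean_space" and g h :: "'b \<Rightarrow> real"
  assumes [measurable]: "X \<in> borel_measurable M"
    and g: "continuous_on UNIV g" "\<And>x. \<bar>g x\<bar> \<le> C"
    and p: "trig_poly p"
    and h: "\<And>x. norm x \<le> K \<Longrightarrow> h x = g x" "\<And>x. \<bar>h x\<bar> \<le> C"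
    and hp: "\<And>x. cmod (complex_of_real (h x) - p x) \<le> e"
  shows "cmod (complex_of_real (expectation (\<lambda>x. g (X x))) - expectation (\<lambda>x. p (X x)))
    \<le> 2 * C * prob {x \<in> space M. norm (X x) > K} + e"
proof -
  have [measurable]: "g \<in> borel_measurable borel"
    using g(1) by (rule borel_measurable_continuous_onI)
  have ig: "integrable M (\<lambda>x. g (X x))"
    by (rule integrable_const_bound[of _ C]) (use g in auto)
  have ip: "integrable M (\<lambda>x. p (X x))" by (rule trig_poly_integrable[OF p]) simp
  have ind: "integrable M (indicator {x \<in> space M. norm (X x) > K} :: 'a \<Rightarrow> real)"
    by (rule integrable_const_bound[of _ 1]) auto
  have "complex_of_real (expectation (\<lambda>x. g (X x))) - expectation (\<lambda>x. p (X x)) =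
      expectation (\<lambda>x. complex_of_real (g (X x)) - p (X x))"
    using ig ip by simp
  also have "cmod \<dots> \<le> expectation (\<lambda>x. cmod (complex_of_real (g (X x)) - p (X x)))"
    by (rule integral_norm_bound)
  also have "\<dots> \<le> expectation (\<lambda>x. 2 * C * indicator {x \<in> space M. norm (X x) > K} x + e)"
  proof (rule integral_mono)
    show "integrable M (\<lambda>x. cmod (complex_of_real (g (X x)) - p (X x)))"
      using ig ip by simp
    show "integrable M (\<lambda>x. 2 * C * indicator {x \<in> space M. norm (X x) > K} x + e)"
      using ind by (intro Bochner_Integration.integrable_add integrable_mult_right integrable_const)
    fix x assume x: "x \<in> space M"
    have "cmod (complex_of_real (g (X x)) - p (X x)) \<le>
       cmod (complex_of_real (g (X x)) - complex_of_real (h (X x))) + cmod (complex_of_real (h (X x)) - p (X x))"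
      using norm_triangle_ineq[of "complex_of_real (g (X x)) - complex_of_real (h (X x))" "complex_of_real (h (X x)) - p (X x)"]
      by simp
    also have "\<dots> \<le> \<bar>g (X x) - h (X x)\<bar> + e"
      using hp[of "X x"] by (simp flip: of_real_diff)
    also have "\<bar>g (X x) - h (X x)\<bar> \<le> 2 * C * indicator {x \<in> space M. norm (X x) > K} x"
      using x h(1)[of "X x"] h(2)[of "X x"] g(2)[of "X x"] by (auto simp: indicator_def)
    finally show "cmod (complex_of_real (g (X x)) - p (X x)) \<le> 2 * C * indicator {x \<in> space M. norm (X x) > K} x + e"
      by simp
  qed
  also have "\<dots> = 2 * C * prob {x \<in> space M. norm (X x) > K} + e"
    using ind by (subst Bochner_Integration.integral_add) (auto simp: prob_space Int_def conj_commute)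
  finally show ?thesis .
qed

lemma (in prob_space) tight_single:
  fixes X :: "'a \<Rightarrow> 'b::euclidean_space"
  assumes [measurable]: "X \<in> borel_measurable M" and "e > 0"
  shows "\<exists>K0. \<forall>K\<ge>K0. prob {x \<in> space M. norm (X x) > K} \<le> e"
proof -
  let ?A = "\<lambda>n::nat. {x \<in> space M. norm (X x) > real n}"
  have "(\<lambda>n. prob (?A n)) \<longlonglongrightarrow> prob (\<Inter>n. ?A n)"
    by (rule finite_Lim_measure_decseq) (auto simp: decseq_def)
  moreover have "(\<Inter>n. ?A n) = {}"
    using real_arch_simple by (auto simp: set_eq_iff not_less)
  ultimately have "eventually (\<lambda>n. prob (?A n) < e) sequentially"
    using \<open>e > 0\<close> by (intro order_tendstoD) auto
  then obtain n where n: "prob (?A n) < e" by (auto simp: eventually_sequentially)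
  have "prob {x \<in> space M. norm (X x) > K} \<le> e" if "K \<ge> real n" for K
    using n finite_measure_mono[of "{x \<in> space M. norm (X x) > K}" "?A n"] that by fastforce
  then show ?thesis by blast
qed

text \<open>Tightness, assumed separately, allows the test function to be cut off; the cutoff is
  approximated by a trigonometric polynomial, whose expectations converge term by term.\<close>

lemma (in prob_space) multivariate_levy:
  fixes X :: "nat \<Rightarrow> 'a \<Rightarrow> 'b::euclidean_space"
  assumes X[measurable]: "\<And>n. X n \<in> borel_measurable M"
    and N: "prob_space N" "sets N = sets borel"
    and char: "\<And>t. (\<lambda>n. expectation (\<lambda>x. iexp (t \<bullet> X n x))) \<longlonglongrightarrow> (\<integral>x. iexp (t \<bullet> x) \<partial>N)"
    and tight: "\<And>e. e > 0 \<Longrightarrow> \<exists>K. eventually (\<lambda>n. prob {x \<in> space M. norm (X n x) > K} \<le> e) sequentially"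
  shows "converges_in_distribution M X N"
  unfolding converges_in_distribution_def
proof (intro conjI allI impI X)
  fix g :: "'b \<Rightarrow> real"
  assume cont: "continuous_on UNIV g" and bdd: "bounded (range g)"
  interpret N: prob_space N by (rule N(1))
  note [measurable_cong] = N(2)
  have idN: "(\<lambda>x. x) \<in> borel_measurable N" using N(2) by simp
  obtain C where C: "C > 0" "\<And>x. \<bar>g x\<bar> \<le> C"
    using bdd unfolding bounded_pos by auto
  show "(\<lambda>n. \<integral>\<omega>. g (X n \<omega>) \<partial>M) \<longlonglongrightarrow> (\<integral>x. g x \<partial>N)"
  proof (rule LIMSEQ_I)
    fix e0 :: real assume "e0 > 0"
    \<comment> \<open>Each of the two replacements of \<open>g\<close> by \<open>p\<close> costs at
      most \<open>2 * C * e + e\<close>, and the convergence of the expectations of \<open>p\<close>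
      costs \<open>e\<close>; together this is at most \<open>(4 * C + 4) * e\<close>.\<close>
    define e where "e = e0 / (4 * C + 4)"
    have e: "e > 0" using \<open>e0 > 0\<close> C by (simp add: e_def)
    obtain K1 where K1: "eventually (\<lambda>n. prob {x \<in> space M. norm (X n x) > K1} \<le> e) sequentially"
      using tight[OF e] by blast
    obtain K2 where K2: "\<And>K. K \<ge> K2 \<Longrightarrow> N.prob {x \<in> space N. norm x > K} \<le> e"
      using N.tight_single[OF idN e] by blast
    define K where "K = max 1 (max K1 K2)"
    \<comment> \<open>The cutoff of \<open>g\<close>: unchanged on the ball of radius
      \<open>K\<close>, zero beyond radius \<open>K + 1\<close>, and so eligible for
      \<open>periodic_extension\<close> with \<open>K + 1\<close>.\<close>
    define k where "k = (\<lambda>x. g x * max 0 (min 1 (K + 1 - norm x)))"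
    have kc: "continuous_on UNIV k"
      unfolding k_def using cont by (intro continuous_intros)
    have kC: "\<bar>k x\<bar> \<le> C" for x
    proof -
      have "\<bar>k x\<bar> \<le> \<bar>g x\<bar> * 1" unfolding k_def abs_mult by (rule mult_left_mono) auto
      then show ?thesis using C(2)[of x] by linarith
    qed
    have k0: "k x = 0" if "b \<in> Basis" "\<bar>x \<bullet> b\<bar> \<ge> K + 1" for x b
      using Basis_le_norm[OF that(1), of x] that(2) by (simp add: k_def)
    obtain p h where p: "trig_poly p" and h: "\<And>x. norm x \<le> K + 1 \<Longrightarrow> h x = k x" "\<And>x. \<bar>h x\<bar> \<le> C"
      and hp: "\<And>x. cmod (complex_of_real (h x) - p x) \<le> e"
    proof -
      have "K + 1 > 0" by (simp add: K_def)
      from periodic_extension[of k, OF kc this _ kC e] k0 that show thesis by blast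
    qed
    have hg: "h x = g x" if "norm x \<le> K" for x
      using h(1)[of x] that by (simp add: k_def)
    have lim: "(\<lambda>n. expectation (\<lambda>x. p (X n x))) \<longlonglongrightarrow> (\<integral>x. p x \<partial>N)"
      using p
    proof induction
      case (mono c t)
      then show ?case by (simp add: char tendsto_mult_left)
    next
      case (add p q)
      then show ?case
        using trig_poly_integrable[OF _ X] N.trig_poly_integrable[OF _ idN] by (simp add: tendsto_add)
    qed
    have N1: "cmod (complex_of_real (\<integral>x. g x \<partial>N) - (\<integral>x. p x \<partial>N)) \<le> 2 * C * e + e"
    proof -
      have "cmod (complex_of_real (\<integral>x. g x \<partial>N) - (\<integral>x. p x \<partial>N)) \<le>
         2 * C * N.prob {x \<in> space N. norm x > K} + e"
        by (rule N.expectation_trig_approx[OF idN cont C(2) p hg h(2) hp])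
      also have "\<dots> \<le> 2 * C * e + e"
        using K2[of K] C(1) by (intro add_right_mono mult_left_mono) (auto simp: K_def)
      finally show ?thesis .
    qed
    have "eventually (\<lambda>n. cmod (expectation (\<lambda>x. p (X n x)) - (\<integral>x. p x \<partial>N)) < e) sequentially"
      using tendstoD[OF lim e] by (simp add: dist_norm)
    with K1 have "eventually (\<lambda>n. norm ((\<integral>\<omega>. g (X n \<omega>) \<partial>M) - (\<integral>x. g x \<partial>N)) < e0) sequentially"
    proof eventually_elim
      case (elim n)
      have "cmod (complex_of_real (expectation (\<lambda>x. g (X n x))) - expectation (\<lambda>x. p (X n x))) \<le>
         2 * C * prob {x \<in> space M. norm (X n x) > K} + e"
        by (rule expectation_trig_approx[OF X cont C(2) p hg h(2) hp])
      also have "prob {x \<in> space M. norm (X n x) > K} \<le> prob {x \<in> space M. norm (X n x) > K1}"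
        by (rule finite_measure_mono) (auto simp: K_def)
      also have "\<dots> \<le> e" by (rule elim)
      finally have "cmod (complex_of_real (expectation (\<lambda>x. g (X n x))) - expectation (\<lambda>x. p (X n x))) \<le> 2 * C * e + e"
        using C(1) by simp
      with N1 elim(2) have "cmod (complex_of_real (expectation (\<lambda>x. g (X n x))) - complex_of_real (\<integral>x. g x \<partial>N))
         < (2 * C * e + e) + (2 * C * e + e) + e"
        using norm_triangle_ineq[of "complex_of_real (expectation (\<lambda>x. g (X n x))) - expectation (\<lambda>x. p (X n x))"
            "expectation (\<lambda>x. p (X n x)) - (\<integral>x. p x \<partial>N)"]
          norm_triangle_ineq4[of "complex_of_real (expectation (\<lambda>x. g (X n x))) - (\<integral>x. p x \<partial>N)"
            "complex_of_real (\<integral>x. g x \<partial>N) - (\<integral>x. p x \<partial>N)"]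
        by simp
      also have "\<dots> \<le> e * (4 * C + 4)" using e by (simp add: algebra_simps)
      also have "\<dots> = e0" using C by (simp add: e_def)
      finally show ?case by (simp flip: of_real_diff)
    qed
    then show "\<exists>no. \<forall>n\<ge>no. norm ((\<integral>\<omega>. g (X n \<omega>) \<partial>M) - (\<integral>x. g x \<partial>N)) < e0"
      by (simp add: eventually_sequentially)
  qed
qed

text \<open>The classical theorem normalises by the standard deviation; evaluating its limit at
  \<sigma> undoes this. Zero variance is excluded there, but then every variable vanishes almost
  surely.\<close>

lemma (in prob_space) iid_char_limit:
  fixes X :: "nat \<Rightarrow> 'a \<Rightarrow> real"
  assumes indep: "indep_vars (\<lambda>_. borel) X UNIV"
    and distr: "\<And>n. distr M borel (X n) = N"
    and sq: "\<And>n. integrable M (\<lambda>x. (X n x)\<^sup>2)"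
    and mean: "\<And>n. expectation (X n) = 0"
    and var: "\<And>n. expectation (\<lambda>x. (X n x)\<^sup>2) = s"
  shows "(\<lambda>n. expectation (\<lambda>x. iexp ((\<Sum>i<n. X i x) / sqrt (real n)))) \<longlonglongrightarrow> of_real (exp (- s / 2))"
proof -
  have [measurable]: "X n \<in> borel_measurable M" for n
    using indep unfolding indep_vars_def2 by simp
  have "0 \<le> expectation (\<lambda>x. (X 0 x)\<^sup>2)" by simp
  then have s0: "0 \<le> s" by (simp only: var)
  show ?thesis
  proof (cases "s = 0")
    case True
    have "AE x in M. X n x = 0" for n
      using integral_nonneg_eq_0_iff_AE[OF sq, of n] var[of n] True by simp
    then have "AE x in M. \<forall>n. X n x = 0" by (simp add: AE_all_countable)
    then have "expectation (\<lambda>x. iexp ((\<Sum>i<n. X i x) / sqrt (real n))) = expectation (\<lambda>x. 1)" for n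
      by (intro integral_cong_AE) auto
    then show ?thesis using True by (simp add: prob_space)
  next
    case False
    define \<sigma> where "\<sigma> = sqrt s"
    have \<sigma>: "\<sigma> > 0" "\<sigma>\<^sup>2 = s" using False s0 by (auto simp: \<sigma>_def)
    have "weak_conv_m (\<lambda>n. distr M borel (\<lambda>x. (\<Sum>i<n. X i x) / sqrt (n * \<sigma>\<^sup>2))) std_normal_distribution"
      by (rule central_limit_theorem_zero_mean[OF indep mean \<sigma>(1) sq])
         (auto simp: var mean \<sigma> distr)
    then have "(\<lambda>n. char (distr M borel (\<lambda>x. (\<Sum>i<n. X i x) / sqrt (n * \<sigma>\<^sup>2))) \<sigma>)
        \<longlonglongrightarrow> char std_normal_distribution \<sigma>"
      by (rule levy_continuity1[rotated 2]) (auto intro: real_distribution_distr real_dist_normal_dist)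
    also have "char std_normal_distribution \<sigma> = of_real (exp (- s / 2))"
      by (simp add: char_std_normal_distribution \<sigma>)
    also have "(\<lambda>n. char (distr M borel (\<lambda>x. (\<Sum>i<n. X i x) / sqrt (n * \<sigma>\<^sup>2))) \<sigma>) =
       (\<lambda>n. expectation (\<lambda>x. iexp ((\<Sum>i<n. X i x) / sqrt (real n))))"
    proof
      fix n
      have "\<sigma> * (y / sqrt (real n * \<sigma>\<^sup>2)) = y / sqrt (real n)" for y
        using \<sigma>(1) by (simp add: real_sqrt_mult)
      then show "char (distr M borel (\<lambda>x. (\<Sum>i<n. X i x) / sqrt (n * \<sigma>\<^sup>2))) \<sigma> =
          expectation (\<lambda>x. iexp ((\<Sum>i<n. X i x) / sqrt (real n)))"
        unfolding char_def
        by (subst integral_distr) (simp_all only: of_real_mult[symmetric], measurable)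
    qed
    finally show ?thesis .
  qed
qed

section \<open>Deterministic recursions\<close>

text \<open>A deterministic form of the Robbins-Siegmund lemma. As \<open>e k\<close> is both
  relative and additive error, \<open>1 + a k\<close> obeys a purely multiplicative recursion and
  stays below \<open>exp (suminf e) * (1 + a 0)\<close>; with this bound the decrements
  \<open>b\<close> can be summed.\<close>

lemma perturbed_descent_sequence:
  fixes a b e :: "nat \<Rightarrow> real"
  assumes nn: "\<And>k. 0 \<le> a k" "\<And>k. 0 \<le> b k" "\<And>k. 0 \<le> e k"
    and rec: "\<And>k. a (Suc k) + b k \<le> (1 + e k) * a k + e k"
    and summ: "summable e"
  shows "\<exists>A. \<forall>k. a k \<le> A" and "summable b"
proof -
  define A where "A = exp (suminf e) * (1 + a 0)"
  have ae: "1 + a k \<le> exp (\<Sum>i<k. e i) * (1 + a 0)" for k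
  proof (induction k)
    case (Suc k)
    have "1 + a (Suc k) \<le> (1 + e k) * (1 + a k)"
      using rec[of k] nn(2)[of k] by (simp add: algebra_simps)
    also have "\<dots> \<le> exp (e k) * (exp (\<Sum>i<k. e i) * (1 + a 0))"
      using Suc.IH nn by (intro mult_mono) (auto simp: add_nonneg_nonneg)
    finally show ?case by (simp add: exp_add mult_ac)
  qed simp
  have A: "1 + a k \<le> A" for k
  proof -
    have "exp (\<Sum>i<k. e i) * (1 + a 0) \<le> A"
      unfolding A_def using nn summ by (intro mult_right_mono) (auto intro: sum_le_suminf)
    then show ?thesis using ae[of k] by linarith
  qed
  then have "a k \<le> A" for k using A[of k] by linarith
  then show "\<exists>A. \<forall>k. a k \<le> A" by blast
  have bs: "(\<Sum>i<n. b i) + a n \<le> a 0 + A * (\<Sum>i<n. e i)" for n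
  proof (induction n)
    case (Suc n)
    have "(1 + a n) * e n \<le> A * e n" using A[of n] nn by (intro mult_right_mono)
    then have "b n + a (Suc n) \<le> a n + A * e n" using rec[of n] by (simp add: algebra_simps)
    then show ?case using Suc by (simp add: algebra_simps)
  qed simp
  have A0: "0 \<le> A" using A[of 0] nn(1)[of 0] by linarith
  show "summable b"
  proof (rule bounded_imp_summable)
    show "0 \<le> b i" for i by (rule nn)
    fix n
    have "(\<Sum>i\<le>n. b i) \<le> a 0 + A * (\<Sum>i<Suc n. e i)"
      using bs[of "Suc n"] nn(1)[of "Suc n"] by (simp add: lessThan_Suc_atMost)
    also have "\<dots> \<le> a 0 + A * suminf e"
      using A0 nn summ by (intro add_left_mono mult_left_mono sum_le_suminf) auto
    finally show "(\<Sum>i\<le>n. b i) \<le> a 0 + A * suminf e" .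
  qed
qed

text \<open>Consecutive steps agree up to a relative error \<open>1 / k\<close>, since raising
  \<open>1 + 1 / k\<close> to a power below 1 does not increase it.\<close>

lemma powr_minus_ratio:
  assumes "0 < \<alpha>" "\<alpha> < 1" "k \<ge> (1::nat)"
  shows "real k powr (- \<alpha>) \<le> (1 + 1 / real k) * real (Suc k) powr (- \<alpha>)"
proof -
  have k: "real k > 0" using assms by simp
  have "(real (Suc k) / real k) powr \<alpha> \<le> (real (Suc k) / real k) powr 1"
    using assms k by (intro powr_mono) (auto simp: field_simps)
  then have "(real (Suc k) / real k) powr \<alpha> \<le> 1 + 1 / real k"
    using k by (simp add: field_simps)
  moreover have "(real (Suc k) / real k) powr \<alpha> * real (Suc k) powr (- \<alpha>) = real k powr (- \<alpha>)"
    using k by (simp add: powr_divide powr_minus field_simps)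
  ultimately show ?thesis
    by (metis mult_right_mono powr_ge_zero)
qed

text \<open>A Chung-type rate. In the induction for \<open>K * s k\<close>, replacing
  \<open>s k\<close> by \<open>s (Suc k)\<close> costs a relative error \<open>1 / k\<close>, which
  is eventually below half of the contraction \<open>a * s (Suc k)\<close> because \<alpha> < 1; the
  other half absorbs the forcing term.\<close>

lemma contraction_rate:
  fixes u :: "nat \<Rightarrow> real"
  assumes \<alpha>: "0 < \<alpha>" "\<alpha> < 1" and pos: "0 < a" "0 \<le> c"
    and bdd: "\<And>k. u k \<le> U" and U: "0 \<le> U"
    and rec: "\<And>k. k \<ge> n0 \<Longrightarrow>
       u (Suc k) \<le> (1 - a * real (Suc k) powr (- \<alpha>)) * u k + c * (real (Suc k) powr (- \<alpha>))\<^sup>2"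
  shows "\<exists>K\<ge>0. \<forall>k. u k \<le> K * real (Suc k) powr (- \<alpha>)"
proof -
  define s where "s = (\<lambda>k. real k powr (- \<alpha>))"
  have spos: "s k > 0" if "k \<ge> 1" for k using that by (simp add: s_def)
  have santi: "s k \<le> s j" if "j \<le> k" "j \<ge> 1" for j k
    unfolding s_def using that \<alpha> by (intro powr_mono2') auto
  have s1: "(\<lambda>k. a * s (Suc k)) \<longlonglongrightarrow> 0"
  proof -
    have "(\<lambda>k. a * s (Suc k)) \<longlonglongrightarrow> a * 0"
      unfolding s_def using \<alpha>
      by (intro tendsto_mult_left LIMSEQ_Suc tendsto_neg_powr filterlim_real_sequentially) auto
    then show ?thesis by simp
  qed
  have e1: "eventually (\<lambda>k. a * s (Suc k) < 1) sequentially"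
    using order_tendstoD(2)[OF s1] by simp
  have s2: "(\<lambda>k. real (Suc k) powr (\<alpha> - 1)) \<longlonglongrightarrow> 0"
    using \<alpha> by (intro LIMSEQ_Suc) (rule tendsto_neg_powr[OF _ filterlim_real_sequentially], simp)
  have e2: "eventually (\<lambda>k. real (Suc k) powr (\<alpha> - 1) < a / 4) sequentially"
    using order_tendstoD(2)[OF s2, of "a / 4"] pos by simp
  obtain k1 where k1: "\<And>k. k \<ge> k1 \<Longrightarrow> a * s (Suc k) < 1" "\<And>k. k \<ge> k1 \<Longrightarrow> real (Suc k) powr (\<alpha> - 1) < a / 4"
    using e1 e2 unfolding eventually_sequentially by (metis nle_le order.trans)
  define k0 where "k0 = max 1 (max k1 n0)"
  have k0: "k0 \<ge> 1" "k0 \<ge> k1" "k0 \<ge> n0" by (auto simp: k0_def)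
  have half: "1 / real k \<le> a / 2 * s (Suc k)" if "k \<ge> k0" for k
  proof -
    have k: "k \<ge> 1" using that k0 by simp
    have "1 / real k \<le> 2 * (1 / real (Suc k))" using k by (simp add: field_simps)
    also have "1 / real (Suc k) = real (Suc k) powr (\<alpha> - 1) * s (Suc k)"
      unfolding s_def powr_add[symmetric] by (simp add: powr_minus_divide)
    also have "2 * \<dots> \<le> 2 * (a / 4 * s (Suc k))"
      using k1(2)[of k] that k0 spos[of "Suc k"] by (intro mult_left_mono mult_right_mono) auto
    finally show ?thesis by simp
  qed
  \<comment> \<open>The first entry makes half of the contraction dominate the forcing term; the
    second starts the induction at \<open>k0\<close>.\<close>
  define K where "K = max (2 * c / a) (U / s k0)"
  have K: "K \<ge> 0" "2 * c / a \<le> K" "U / s k0 \<le> K"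
    using pos U spos[OF k0(1)] by (auto simp: K_def le_max_iff_disj)
  have main: "u k \<le> K * s k" if "k \<ge> k0" for k
    using that
  proof (induction k rule: nat_induct_at_least)
    case base
    have "U \<le> K * s k0" using K(3) spos[OF k0(1)] by (simp add: field_simps)
    then show ?case using bdd[of k0] by linarith
  next
    case (Suc k)
    let ?t = "s (Suc k)"
    have k: "k \<ge> 1" "k \<ge> k1" "k \<ge> n0" using Suc k0 by auto
    have t: "?t > 0" by (rule spos) simp
    have "u (Suc k) \<le> (1 - a * ?t) * u k + c * ?t\<^sup>2"
      using rec[OF k(3)] by (simp add: s_def)
    also have "(1 - a * ?t) * u k \<le> (1 - a * ?t) * (K * s k)"
      using Suc k1(1)[OF k(2)] by (intro mult_left_mono) auto
    also have "\<dots> \<le> (1 - a * ?t) * (K * ((1 + 1 / real k) * ?t))"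
      using k1(1)[OF k(2)] K(1) powr_minus_ratio[OF \<alpha> k(1)]
      by (intro mult_left_mono) (auto simp: s_def)
    also have "\<dots> = K * ?t * ((1 - a * ?t) * (1 + 1 / real k))" by (simp add: mult_ac)
    also have "\<dots> \<le> K * ?t * (1 - a / 2 * ?t)"
    proof (intro mult_left_mono)
      have "(1 - a * ?t) * (1 + 1 / real k) \<le> (1 - a * ?t) + 1 / real k"
        using pos t by (simp add: algebra_simps)
      then show "(1 - a * ?t) * (1 + 1 / real k) \<le> 1 - a / 2 * ?t"
        using half[OF Suc.hyps(1)] by simp
      show "0 \<le> K * ?t" using K t by simp
    qed
    also have "K * ?t * (1 - a / 2 * ?t) + c * ?t\<^sup>2 = K * ?t - (K * a / 2 - c) * ?t\<^sup>2"
      by (simp add: power2_eq_square algebra_simps)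
    also have "\<dots> \<le> K * ?t"
    proof -
      have "0 \<le> K * a / 2 - c" using K(2) pos by (simp add: field_simps)
      then show ?thesis by simp
    qed
    finally show ?case by simp
  qed
  have all: "u k \<le> K * s k" if "k \<ge> 1" for k
  proof (cases "k \<ge> k0")
    case False
    have "U \<le> K * s k0" using K(3) spos[OF k0(1)] by (simp add: field_simps)
    also have "\<dots> \<le> K * s k" using False that K by (intro mult_left_mono santi) auto
    finally show ?thesis using bdd[of k] by linarith
  qed (rule main)
  \<comment> \<open>The rate is stated at \<open>Suc k\<close> because \<open>0 powr\<close> any
    exponent is 0, so a bound by \<open>s 0\<close> would force \<open>u 0 \<le> 0\<close>. The
    shift costs a factor 2.\<close>
  have "u k \<le> max (2 * K) U * s (Suc k)" for k
  proof (cases "k = 0")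
    case True
    then show ?thesis using bdd[of 0] by (simp add: s_def)
  next
    case False
    then have k: "k \<ge> 1" by simp
    have "s k \<le> (1 + 1 / real k) * s (Suc k)"
      using powr_minus_ratio[OF \<alpha> k] by (simp add: s_def)
    also have "\<dots> \<le> 2 * s (Suc k)"
      using k spos[of "Suc k"] by (intro mult_right_mono) auto
    finally have "K * s k \<le> K * (2 * s (Suc k))" using K by (intro mult_left_mono)
    also have "\<dots> \<le> max (2 * K) U * s (Suc k)"
      using spos[of "Suc k"] by (subst mult.assoc[symmetric]) (intro mult_right_mono, auto)
    finally show ?thesis using all[OF k] by linarith
  qed
  then show ?thesis using U unfolding s_def by (intro exI[of _ "max (2 * K) U"]) auto
qed

text \<open>By the mean value theorem the sum is at most \<open>real n powr q / q\<close> with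
  \<open>q = 1 - p\<close>, which is below 1/2.\<close>

lemma sum_powr_over_sqrt:
  assumes p: "1/2 < p" "p < 1"
  shows "(\<lambda>n. (\<Sum>i=1..n. real i powr (- p)) / sqrt (real n)) \<longlonglongrightarrow> 0"
proof -
  define q where "q = 1 - p"
  have q: "0 < q" "q < 1/2" using p by (auto simp: q_def)
  have step: "real (Suc i) powr (- p) \<le> (real (Suc i) powr q - real i powr q) / q" for i
  proof (cases "i = 0")
    case True then show ?thesis using q by (simp add: field_simps)
  next
    case False
    then have i: "real i > 0" by simp
    have "\<exists>z. real i < z \<and> z < real (Suc i) \<and> real (Suc i) powr q - real i powr q = (real (Suc i) - real i) * (q * z powr (q - 1))"
      using i by (intro MVT2) (auto intro!: derivative_eq_intros)
    then obtain z where z: "real i < z" "z < real (Suc i)" "real (Suc i) powr q - real i powr q = q * z powr (q - 1)"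
      by auto
    have "real (Suc i) powr (- p) \<le> z powr (q - 1)"
      using z i p by (subst q_def) (simp, intro powr_mono2', auto)
    then show ?thesis using z(3) q by simp
  qed
  have bound: "(\<Sum>i=1..n. real i powr (- p)) \<le> real n powr q / q" for n
  proof (induction n)
    case (Suc n)
    then show ?case using step[of n] by (simp add: diff_divide_distrib)
  qed simp
  have lim: "(\<lambda>n. real n powr (q - 1/2) / q) \<longlonglongrightarrow> 0 / q"
    using q by (intro tendsto_divide tendsto_const) (auto intro!: tendsto_neg_powr filterlim_real_sequentially)
  show ?thesis
  proof (rule tendsto_sandwich[of "\<lambda>_. 0"])
    show "\<forall>\<^sub>F n in sequentially. 0 \<le> (\<Sum>i=1..n. real i powr (- p)) / sqrt (real n)"
      by (auto intro!: always_eventually divide_nonneg_nonneg sum_nonneg)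
    have "(\<Sum>i=1..n. real i powr (- p)) / sqrt (real n) \<le> real n powr (q - 1/2) / q" for n
    proof -
      have "(\<Sum>i=1..n. real i powr (- p)) / sqrt (real n) \<le> real n powr q / q / sqrt (real n)"
        by (intro divide_right_mono bound) auto
      also have "\<dots> = real n powr (q - 1/2) / q"
        by (simp add: powr_diff powr_half_sqrt)
      finally show ?thesis .
    qed
    then show "\<forall>\<^sub>F n in sequentially. (\<Sum>i=1..n. real i powr (- p)) / sqrt (real n) \<le> real n powr (q - 1/2) / q"
      by simp
  qed (use lim in auto)
qed

lemma summable_powr_minus:
  "p > 1 \<Longrightarrow> summable (\<lambda>k. real (Suc k) powr (- p))"
  using summable_real_powr_iff[of "- p"] by (subst summable_Suc_iff) simp

lemma not_summable_powr_minus: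
  "p \<le> 1 \<Longrightarrow> \<not> summable (\<lambda>k. real (Suc k) powr (- p))"
  using summable_real_powr_iff[of "- p"] summable_Suc_iff[of "\<lambda>k. real k powr (- p)"] by simp

lemma abel_summation:
  fixes x :: "nat \<Rightarrow> 'a::real_vector" and c :: "nat \<Rightarrow> real"
  shows "(\<Sum>i<n. c i *\<^sub>R (x i - x (Suc i))) =
    c 0 *\<^sub>R x 0 - c n *\<^sub>R x n + (\<Sum>i<n. (c (Suc i) - c i) *\<^sub>R x (Suc i))"
  by (induction n) (simp_all add: algebra_simps)

text \<open>The summands are increments of the reciprocal step times the root-mean-square rate of
  the iterates. With \<open>a\<close> and \<open>b\<close> the roots of the two powers,
  \<open>(b * b - a * a) / b \<le> 2 * (b - a)\<close>, and the right-hand side telescopes.\<close>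

lemma sum_sqrt_increment:
  assumes "0 < \<alpha>"
  shows "(\<Sum>i<n. (real (Suc (Suc i)) powr \<alpha> - real (Suc i) powr \<alpha>) * real (Suc (Suc i)) powr (- \<alpha> / 2))
    \<le> 2 * real (Suc n) powr (\<alpha> / 2)"
proof -
  have "(real (Suc (Suc i)) powr \<alpha> - real (Suc i) powr \<alpha>) * real (Suc (Suc i)) powr (- \<alpha> / 2)
     \<le> 2 * (real (Suc (Suc i)) powr (\<alpha> / 2) - real (Suc i) powr (\<alpha> / 2))" for i
  proof -
    define a where "a = real (Suc i) powr (\<alpha> / 2)"
    define b where "b = real (Suc (Suc i)) powr (\<alpha> / 2)"
    have ab: "0 < a" "a \<le> b" using assms by (auto simp: a_def b_def intro!: powr_mono2)
    have "real (Suc i) powr \<alpha> = a * a" "real (Suc (Suc i)) powr \<alpha> = b * b"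
      by (simp_all add: a_def b_def powr_add[symmetric])
    moreover have "real (Suc (Suc i)) powr (- \<alpha> / 2) = 1 / b"
      by (simp add: b_def powr_minus_divide)
    moreover have "(b * b - a * a) * (1 / b) \<le> 2 * (b - a)"
    proof -
      have "(b - a) * (b + a) \<le> (b - a) * (2 * b)" using ab by (intro mult_left_mono) auto
      then show ?thesis using ab by (simp add: field_simps)
    qed
    ultimately show ?thesis unfolding a_def[symmetric] b_def[symmetric] by (simp only:)
  qed
  then have "(\<Sum>i<n. (real (Suc (Suc i)) powr \<alpha> - real (Suc i) powr \<alpha>) * real (Suc (Suc i)) powr (- \<alpha> / 2))
     \<le> (\<Sum>i<n. 2 * (real (Suc (Suc i)) powr (\<alpha> / 2) - real (Suc i) powr (\<alpha> / 2)))"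
    by (intro sum_mono)
  also have "\<dots> = 2 * (real (Suc n) powr (\<alpha> / 2) - 1)"
    unfolding sum_distrib_left[symmetric]
    by (subst sum_lessThan_telescope[of "\<lambda>i. real (Suc i) powr (\<alpha> / 2)"]) simp
  finally show ?thesis by simp
qed

section \<open>Stochastic approximation with i.i.d. noise\<close>

lemma norm_add_square_le: "(norm (a + b))\<^sup>2 \<le> 2 * (norm a)\<^sup>2 + 2 * (norm b)\<^sup>2"
  for a b :: "'a::real_inner"
proof -
  have "(norm (a + b))\<^sup>2 + (norm (a - b))\<^sup>2 = 2 * (norm a)\<^sup>2 + 2 * (norm b)\<^sup>2"
    by (simp add: power2_norm_eq_inner algebra_simps inner_commute)
  then show ?thesis using zero_le_power2[of "norm (a - b)"] by linarith
qed

lemma integrable_norm_squareD: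
  fixes Y :: "'a \<Rightarrow> 'b::{banach, second_countable_topology}"
  assumes "finite_measure M" "Y \<in> borel_measurable M" "integrable M (\<lambda>x. (norm (Y x))\<^sup>2)"
  shows "integrable M Y"
proof (rule Bochner_Integration.integrable_bound)
  interpret finite_measure M by fact
  show "integrable M (\<lambda>x. 1 + (norm (Y x))\<^sup>2)" using assms(3) by simp
  have "t \<le> 1 + t\<^sup>2" for t :: real using zero_le_power2[of "t - 1/2"] by (simp add: power2_eq_square algebra_simps)
  then show "AE x in M. norm (Y x) \<le> norm (1 + (norm (Y x))\<^sup>2)"
    by (auto intro!: AE_I2 order_trans[OF _ abs_ge_self])
qed fact

lemma integrable_norm_square_add:
  fixes Y Z :: "'a \<Rightarrow> 'b::euclidean_space"
  assumes [measurable]: "Y \<in> borel_measurable M" "Z \<in> borel_measurable M"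
    and "integrable M (\<lambda>x. (norm (Y x))\<^sup>2)" "integrable M (\<lambda>x. (norm (Z x))\<^sup>2)"
  shows "integrable M (\<lambda>x. (norm (Y x + Z x))\<^sup>2)"
  by (rule Bochner_Integration.integrable_bound[of _ "\<lambda>x. 2 * (norm (Y x))\<^sup>2 + 2 * (norm (Z x))\<^sup>2"])
     (use assms norm_add_square_le in auto)

lemma integrable_inner_square:
  fixes Y Z :: "'a \<Rightarrow> 'b::euclidean_space"
  assumes [measurable]: "Y \<in> borel_measurable M" "Z \<in> borel_measurable M"
    and "integrable M (\<lambda>x. (norm (Y x))\<^sup>2)" "integrable M (\<lambda>x. (norm (Z x))\<^sup>2)"
  shows "integrable M (\<lambda>x. Y x \<bullet> Z x)"
proof (rule Bochner_Integration.integrable_bound[of _ "\<lambda>x. (norm (Y x))\<^sup>2 + (norm (Z x))\<^sup>2"])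
  show "AE x in M. norm (Y x \<bullet> Z x) \<le> norm ((norm (Y x))\<^sup>2 + (norm (Z x))\<^sup>2)"
  proof (intro AE_I2)
    fix x
    have "\<bar>Y x \<bullet> Z x\<bar> \<le> norm (Y x) * norm (Z x)" by (rule Cauchy_Schwarz_ineq2)
    also have "\<dots> \<le> (norm (Y x))\<^sup>2 + (norm (Z x))\<^sup>2"
      using sum_squares_bound[of "norm (Y x)" "norm (Z x)"]
        mult_nonneg_nonneg[OF norm_ge_zero norm_ge_zero, of "Y x" "Z x"] by linarith
    finally show "norm (Y x \<bullet> Z x) \<le> norm ((norm (Y x))\<^sup>2 + (norm (Z x))\<^sup>2)" by simp
  qed
qed (use assms in auto)

lemma (in prob_space) norm_expectation_square_le:
  fixes Y :: "'a \<Rightarrow> 'b::euclidean_space"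
  assumes [measurable]: "Y \<in> borel_measurable M" and "integrable M (\<lambda>x. (norm (Y x))\<^sup>2)"
  shows "expectation (\<lambda>x. (norm (Y x - expectation Y))\<^sup>2) = expectation (\<lambda>x. (norm (Y x))\<^sup>2) - (norm (expectation Y))\<^sup>2"
    and "(norm (expectation Y))\<^sup>2 \<le> expectation (\<lambda>x. (norm (Y x))\<^sup>2)"
proof -
  have i: "integrable M Y"
    by (rule integrable_norm_squareD) (use assms finite_measure_axioms in auto)
  have "expectation (\<lambda>x. (norm (Y x - expectation Y))\<^sup>2) =
     expectation (\<lambda>x. (norm (Y x))\<^sup>2 - 2 * (expectation Y \<bullet> Y x) + (norm (expectation Y))\<^sup>2)"
    by (simp add: power2_norm_eq_inner inner_diff_left inner_diff_right inner_commute algebra_simps)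
  also have "\<dots> = expectation (\<lambda>x. (norm (Y x))\<^sup>2) - 2 * (expectation Y \<bullet> expectation Y) + (norm (expectation Y))\<^sup>2"
    using assms i by (simp add: prob_space)
  finally show eq: "expectation (\<lambda>x. (norm (Y x - expectation Y))\<^sup>2) = expectation (\<lambda>x. (norm (Y x))\<^sup>2) - (norm (expectation Y))\<^sup>2"
    by (simp add: power2_norm_eq_inner)
  have "0 \<le> expectation (\<lambda>x. (norm (Y x - expectation Y))\<^sup>2)" by simp
  then show "(norm (expectation Y))\<^sup>2 \<le> expectation (\<lambda>x. (norm (Y x))\<^sup>2)" using eq by linarith
qed

text \<open>Coordinates are centred, so the target is 0. \<open>G0\<close> is the noise at the
  target and does not depend on the step index; \<open>noise\<close> controls the mean-square
  distance of the actual direction from it, \<open>bias\<close> the distance of the mean direction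
  from \<open>g\<close>. \<open>g_away\<close> keeps the drift bounded below outside every small
  ball although the curvature bound \<open>g_local\<close> holds only near 0.\<close>

locale stochastic_approximation = prob_space M for M :: "'a measure" +
  fixes N :: "'x measure" and W :: "nat \<Rightarrow> 'a \<Rightarrow> 'x"
    and G :: "nat \<Rightarrow> 'e::euclidean_space \<Rightarrow> 'x \<Rightarrow> 'e" and G0 :: "'x \<Rightarrow> 'e"
    and g H :: "'e \<Rightarrow> 'e" and x0 :: 'e
    and C r \<mu> \<alpha> \<gamma> \<eta>0 h0 :: real
  assumes W_indep: "indep_vars (\<lambda>_. N) W {1..}"
    and W_distr: "\<And>i. i \<ge> 1 \<Longrightarrow> distr M N (W i) = N"
    and G_measurable: "\<And>i. i \<ge> 1 \<Longrightarrow> (\<lambda>(x, w). G i x w) \<in> borel_measurable (borel \<Otimes>\<^sub>M N)"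
    and G0_measurable: "G0 \<in> borel_measurable N"
    and G0_square: "integrable N (\<lambda>w. (norm (G0 w))\<^sup>2)"
    and G0_mean: "(\<integral>w. G0 w \<partial>N) = 0"
    and noise: "\<And>i x. i \<ge> 1 \<Longrightarrow> (\<integral>\<^sup>+w. ennreal ((norm (G i x w - G0 w))\<^sup>2) \<partial>N)
        \<le> ennreal (C * ((norm x)\<^sup>2 + (h0 * real i powr (- \<gamma>))\<^sup>2))"
    and bias: "\<And>i x. i \<ge> 1 \<Longrightarrow> norm ((\<integral>w. G i x w \<partial>N) - g x) \<le> C * (h0 * real i powr (- \<gamma>))"
    and g_measurable: "g \<in> borel_measurable borel"
    and g_linearization: "\<And>x. norm (g x - H x) \<le> C * (norm x)\<^sup>2"
    and H_linear: "bounded_linear H"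
    and g_nonneg: "\<And>x. 0 \<le> x \<bullet> g x"
    and g_local: "\<And>x. norm x \<le> r \<Longrightarrow> \<mu> * (norm x)\<^sup>2 \<le> x \<bullet> g x"
    and g_away: "\<And>e x. 0 < e \<Longrightarrow> e \<le> r \<Longrightarrow> e \<le> norm x \<Longrightarrow> \<mu> * e\<^sup>2 \<le> x \<bullet> g x"
    and r_pos: "r > 0" and \<mu>_pos: "\<mu> > 0" and C_nonneg: "C \<ge> 0"
    and \<eta>0_pos: "\<eta>0 > 0" and h0_pos: "h0 > 0"
    and \<alpha>: "1/2 < \<alpha>" "\<alpha> < 1" and \<gamma>: "1/2 < \<gamma>" "\<gamma> < 1"
begin

definition step :: "nat \<Rightarrow> real" where "step i = \<eta>0 * real i powr (- \<alpha>)"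
definition incr :: "nat \<Rightarrow> real" where "incr i = h0 * real i powr (- \<gamma>)"

primrec D :: "nat \<Rightarrow> 'a \<Rightarrow> 'e" where
  "D 0 \<omega> = x0"
| "D (Suc i) \<omega> = D i \<omega> - step (Suc i) *\<^sub>R G (Suc i) (D i \<omega>) (W (Suc i) \<omega>)"

section \<open>The history of the noise and the law of the next observation\<close>

definition hist :: "nat \<Rightarrow> 'a measure" where
  "hist k = vimage_algebra (space M) (\<lambda>\<omega>. \<lambda>i\<in>{1..k}. W i \<omega>) (PiM {1..k} (\<lambda>_. N))"

lemma step_nonneg: "0 \<le> step i" and incr_nonneg: "0 \<le> incr i"
  using \<eta>0_pos h0_pos by (auto simp: step_def incr_def)

lemma incr_le: "i \<ge> 1 \<Longrightarrow> incr i \<le> h0"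
  using h0_pos \<gamma> powr_mono[of "- \<gamma>" 0 "real i"] by (simp add: incr_def)

lemma W_measurable: "i \<ge> 1 \<Longrightarrow> W i \<in> measurable M N"
  using W_indep by (auto simp: indep_vars_def)

lemma space_hist [simp]: "space (hist k) = space M"
  by (simp add: hist_def)

lemma history_measurable: "(\<lambda>\<omega>. \<lambda>i\<in>{1..k}. W i \<omega>) \<in> measurable M (PiM {1..k} (\<lambda>_. N))"
  by (intro measurable_restrict W_measurable) simp

lemma hist_subalgebra: "subalgebra M (hist k)"
  unfolding subalgebra_def hist_def
  using sets_image_in_sets[OF refl history_measurable] by simp

lemma history_space: "(\<lambda>\<omega>. \<lambda>i\<in>{1..k}. W i \<omega>) \<in> space M \<rightarrow> space (PiM {1..k} (\<lambda>_. N))"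
  using history_measurable by (rule measurable_space[THEN funcsetI]) 

lemma W_hist: "i \<ge> 1 \<Longrightarrow> i \<le> k \<Longrightarrow> W i \<in> measurable (hist k) N"
proof -
  assume i: "i \<ge> 1" "i \<le> k"
  have "(\<lambda>\<omega>. (\<lambda>i\<in>{1..k}. W i \<omega>) i) \<in> measurable (hist k) N"
    unfolding hist_def
    by (rule measurable_compose[OF measurable_vimage_algebra1[OF history_space]])
       (rule measurable_component_singleton, use i in simp)
  then show ?thesis using i by simp
qed

lemma hist_mono: "k \<le> l \<Longrightarrow> subalgebra (hist l) (hist k)"
  unfolding subalgebra_def
proof (intro conjI)
  assume kl: "k \<le> l"
  show "sets (hist k) \<subseteq> sets (hist l)"
    unfolding hist_def[of k]
    by (rule sets_image_in_sets) (use kl in \<open>auto intro!: measurable_restrict W_hist\<close>)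
qed simp

lemma D_hist: "D k \<in> borel_measurable (hist k)"
proof (induction k)
  case (Suc k)
  have [measurable]: "D k \<in> borel_measurable (hist (Suc k))"
    using measurable_from_subalg[OF hist_mono Suc] by simp
  have [measurable]: "W (Suc k) \<in> measurable (hist (Suc k)) N" by (rule W_hist) auto
  note [measurable] = G_measurable[of "Suc k", simplified]
  have "(\<lambda>\<omega>. G (Suc k) (D k \<omega>) (W (Suc k) \<omega>)) \<in> borel_measurable (hist (Suc k))"
    by measurable
  then show ?case by (simp add: D.simps[abs_def])
next
  case 0
  then show ?case by (simp add: D.simps[abs_def])
qed

lemma D_measurable [measurable]: "D k \<in> borel_measurable M"
  by (rule measurable_from_subalg[OF hist_subalgebra D_hist])

lemma N_prob: "prob_space N"
  using prob_space_distr[OF W_measurable[of 1]] W_distr[of 1] by simp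

sublocale N: prob_space N by (rule N_prob)

text \<open>Mutual independence passes to restrictions to the disjoint index blocks
  \<open>{1..k}\<close> and \<open>{Suc k}\<close>; for this reason the next observation is treated
  as a family with one coordinate.\<close>

lemma hist_indep:
  assumes A: "A \<in> sets (hist k)" and B: "B \<in> sets N"
  shows "prob (A \<inter> (W (Suc k) -` B \<inter> space M)) = prob A * measure N B"
proof -
  let ?X = "\<lambda>\<omega>. \<lambda>i\<in>{1..k}. W i \<omega>" and ?Y = "\<lambda>\<omega>. \<lambda>i\<in>{Suc k}. W i \<omega>"
  obtain A' where A': "A = ?X -` A' \<inter> space M" "A' \<in> sets (PiM {1..k} (\<lambda>_. N))"
    using A unfolding hist_def sets_vimage_algebra2[OF history_space] by blast
  let ?B = "{f \<in> space (PiM {Suc k} (\<lambda>_. N)). f (Suc k) \<in> B}"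
  have B': "?B \<in> sets (PiM {Suc k} (\<lambda>_. N))"
    using B by measurable
  have iv: "indep_var (PiM {1..k} (\<lambda>_. N)) ?X (PiM {Suc k} (\<lambda>_. N)) ?Y"
    by (rule indep_var_restrict[OF W_indep]) auto
  have Yeq: "?Y -` ?B \<inter> space M = W (Suc k) -` B \<inter> space M"
    using measurable_space[OF W_measurable[of "Suc k"]] by (auto simp: space_PiM)
  have "prob (A \<inter> (W (Suc k) -` B \<inter> space M)) = prob ((\<lambda>x. (?X x, ?Y x)) -` (A' \<times> ?B) \<inter> space M)"
    using Yeq unfolding A' by (intro arg_cong[where f=prob]) auto
  also have "\<dots> = prob (?X -` A' \<inter> space M) * prob (?Y -` ?B \<inter> space M)"
    by (rule indep_varD[OF iv A'(2) B'])
  also have "prob (?Y -` ?B \<inter> space M) = measure (distr M N (W (Suc k))) B"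
    unfolding Yeq using B by (simp add: measure_distr W_measurable)
  also have "\<dots> = measure N B" by (simp add: W_distr)
  finally show ?thesis by (simp only: A')
qed

lemma id_hist: "(\<lambda>\<omega>. \<omega>) \<in> measurable M (hist k)"
  using hist_subalgebra[of k] by (auto simp: subalgebra_def measurable_def sets.sets_into_space
      intro: sets.Int_space_eq2[THEN ssubst])

text \<open>The past is kept as the sample point itself, under the measure restricted to
  \<open>hist k\<close>, rather than as the tuple of past observations. Conditional expectation
  given the past then becomes integration over the second factor by Fubini.\<close>

lemma distr_history_next:
  "distr M (hist k) (\<lambda>\<omega>. \<omega>) \<Otimes>\<^sub>M N = distr M (hist k \<Otimes>\<^sub>M N) (\<lambda>\<omega>. (\<omega>, W (Suc k) \<omega>))"
proof (rule pair_measure_eqI)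
  note [measurable] = id_hist W_measurable[of "Suc k", simplified]
  show "sigma_finite_measure (distr M (hist k) (\<lambda>\<omega>. \<omega>))"
    by (intro prob_space_imp_sigma_finite prob_space_distr id_hist)
  show "sigma_finite_measure N" by unfold_locales
  show "sets (distr M (hist k) (\<lambda>\<omega>. \<omega>) \<Otimes>\<^sub>M N) = sets (distr M (hist k \<Otimes>\<^sub>M N) (\<lambda>\<omega>. (\<omega>, W (Suc k) \<omega>)))"
    by (simp cong: sets_pair_measure_cong)
  fix A B assume "A \<in> sets (distr M (hist k) (\<lambda>\<omega>. \<omega>))" and B: "B \<in> sets N"
  then have A: "A \<in> sets (hist k)" by simp
  have Asp: "A \<inter> space M = A" using sets.sets_into_space[OF A] by auto
  have "emeasure (distr M (hist k \<Otimes>\<^sub>M N) (\<lambda>\<omega>. (\<omega>, W (Suc k) \<omega>))) (A \<times> B) =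
      emeasure M ((\<lambda>\<omega>. (\<omega>, W (Suc k) \<omega>)) -` (A \<times> B) \<inter> space M)"
    using A B by (intro emeasure_distr) auto
  also have "(\<lambda>\<omega>. (\<omega>, W (Suc k) \<omega>)) -` (A \<times> B) \<inter> space M = A \<inter> (W (Suc k) -` B \<inter> space M)"
    by auto
  also have "emeasure M \<dots> = ennreal (prob A * measure N B)"
    by (simp add: emeasure_eq_measure hist_indep[OF A B])
  also have "\<dots> = emeasure (distr M (hist k) (\<lambda>\<omega>. \<omega>)) A * emeasure N B"
    using A by (simp add: emeasure_distr[OF id_hist A] Asp emeasure_eq_measure N.emeasure_eq_measure ennreal_mult)
  finally show "emeasure (distr M (hist k) (\<lambda>\<omega>. \<omega>)) A * emeasure N B =
    emeasure (distr M (hist k \<Otimes>\<^sub>M N) (\<lambda>\<omega>. (\<omega>, W (Suc k) \<omega>))) (A \<times> B)" by simp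
qed

lemma nn_integral_next:
  assumes [measurable]: "(\<lambda>(\<omega>, w). f \<omega> w) \<in> borel_measurable (hist k \<Otimes>\<^sub>M N)"
  shows "(\<integral>\<^sup>+\<omega>. f \<omega> (W (Suc k) \<omega>) \<partial>M) = (\<integral>\<^sup>+\<omega>. (\<integral>\<^sup>+w. f \<omega> w \<partial>N) \<partial>M)"
proof -
  note [measurable] = id_hist W_measurable[of "Suc k", simplified]
  let ?R = "distr M (hist k) (\<lambda>\<omega>. \<omega>)"
  have "(\<integral>\<^sup>+\<omega>. f \<omega> (W (Suc k) \<omega>) \<partial>M) = (\<integral>\<^sup>+p. (\<lambda>(\<omega>, w). f \<omega> w) p \<partial>distr M (hist k \<Otimes>\<^sub>M N) (\<lambda>\<omega>. (\<omega>, W (Suc k) \<omega>)))"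
    by (subst nn_integral_distr) auto
  also have "\<dots> = (\<integral>\<^sup>+p. (\<lambda>(\<omega>, w). f \<omega> w) p \<partial>(?R \<Otimes>\<^sub>M N))"
    by (simp only: distr_history_next)
  also have "\<dots> = (\<integral>\<^sup>+\<omega>. (\<integral>\<^sup>+w. f \<omega> w \<partial>N) \<partial>?R)"
    by (subst N.nn_integral_fst[symmetric]) (auto cong: measurable_cong_sets)
  also have "\<dots> = (\<integral>\<^sup>+\<omega>. (\<integral>\<^sup>+w. f \<omega> w \<partial>N) \<partial>M)"
    by (subst nn_integral_distr[OF id_hist]) (auto cong: measurable_cong_sets)
  finally show ?thesis .
qed

lemma integral_next:
  fixes f :: "'a \<Rightarrow> 'x \<Rightarrow> real"
  assumes [measurable]: "(\<lambda>(\<omega>, w). f \<omega> w) \<in> borel_measurable (hist k \<Otimes>\<^sub>M N)"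
    and int: "integrable M (\<lambda>\<omega>. f \<omega> (W (Suc k) \<omega>))"
  shows "integrable M (\<lambda>\<omega>. \<integral>w. f \<omega> w \<partial>N)"
    and "(\<integral>\<omega>. f \<omega> (W (Suc k) \<omega>) \<partial>M) = (\<integral>\<omega>. (\<integral>w. f \<omega> w \<partial>N) \<partial>M)"
proof -
  note [measurable] = id_hist W_measurable[of "Suc k", simplified]
  let ?R = "distr M (hist k) (\<lambda>\<omega>. \<omega>)"
  interpret R: prob_space ?R by (rule prob_space_distr[OF id_hist])
  interpret P: pair_sigma_finite ?R N ..
  have m: "(\<lambda>\<omega>. \<integral>w. f \<omega> w \<partial>N) \<in> borel_measurable (hist k)" by measurable
  have i: "integrable (?R \<Otimes>\<^sub>M N) (\<lambda>(\<omega>, w). f \<omega> w)"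
    unfolding distr_history_next using int by (subst integrable_distr_eq) auto
  have "integrable ?R (\<lambda>\<omega>. \<integral>w. f \<omega> w \<partial>N)"
    using P.integrable_fst'[OF i] by simp
  then show "integrable M (\<lambda>\<omega>. \<integral>w. f \<omega> w \<partial>N)"
    using m by (subst (asm) integrable_distr_eq[OF id_hist]) auto
  have "(\<integral>\<omega>. f \<omega> (W (Suc k) \<omega>) \<partial>M) = (\<integral>p. (\<lambda>(\<omega>, w). f \<omega> w) p \<partial>distr M (hist k \<Otimes>\<^sub>M N) (\<lambda>\<omega>. (\<omega>, W (Suc k) \<omega>)))"
    by (subst integral_distr) auto
  also have "\<dots> = (\<integral>p. (\<lambda>(\<omega>, w). f \<omega> w) p \<partial>(?R \<Otimes>\<^sub>M N))"
    by (simp only: distr_history_next)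
  also have "\<dots> = (\<integral>\<omega>. (\<integral>w. f \<omega> w \<partial>N) \<partial>?R)"
    using P.integral_fst'[OF i] by simp
  also have "\<dots> = (\<integral>\<omega>. (\<integral>w. f \<omega> w \<partial>N) \<partial>M)"
    using m by (subst integral_distr[OF id_hist]) auto
  finally show "(\<integral>\<omega>. f \<omega> (W (Suc k) \<omega>) \<partial>M) = (\<integral>\<omega>. (\<integral>w. f \<omega> w \<partial>N) \<partial>M)" .
qed

section \<open>One-step moment estimates\<close>

definition mean_dir :: "nat \<Rightarrow> 'e \<Rightarrow> 'e" where "mean_dir i x = (\<integral>w. G i x w \<partial>N)"

text \<open>Growth constant for the second moment of the direction: twice the noise bound, with
  increments at most \<open>h0\<close>, plus twice the second moment of \<open>G0\<close>.\<close>

definition c2 :: real where "c2 = 2 * C * (1 + h0\<^sup>2) + 2 * (\<integral>w. (norm (G0 w))\<^sup>2 \<partial>N)"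

lemma c2_nonneg: "0 \<le> c2"
  using C_nonneg by (auto simp: c2_def)

lemma G_section [measurable]: "i \<ge> 1 \<Longrightarrow> G i x \<in> borel_measurable N"
  using measurable_Pair2[OF G_measurable[of i], of x] by simp

lemma noise_integral:
  assumes i: "i \<ge> 1"
  shows "integrable N (\<lambda>w. (norm (G i x w - G0 w))\<^sup>2)"
    and "(\<integral>w. (norm (G i x w - G0 w))\<^sup>2 \<partial>N) \<le> C * ((norm x)\<^sup>2 + (incr i)\<^sup>2)"
proof -
  note [measurable] = G0_measurable G_section[OF i]
  let ?f = "\<lambda>w. (norm (G i x w - G0 w))\<^sup>2"
  have b: "(\<integral>\<^sup>+w. ennreal (?f w) \<partial>N) \<le> ennreal (C * ((norm x)\<^sup>2 + (incr i)\<^sup>2))"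
    using noise[OF i, of x] by (simp add: incr_def)
  show int: "integrable N ?f"
    by (rule integrableI_nonneg) (use b in \<open>auto intro: le_less_trans\<close>)
  show "integral\<^sup>L N ?f \<le> C * ((norm x)\<^sup>2 + (incr i)\<^sup>2)"
    using b C_nonneg by (subst (asm) nn_integral_eq_integral[OF int]) (auto simp: ennreal_le_iff)
qed

lemma G_square:
  assumes i: "i \<ge> 1"
  shows "integrable N (\<lambda>w. (norm (G i x w))\<^sup>2)"
    and "(\<integral>w. (norm (G i x w))\<^sup>2 \<partial>N) \<le> c2 * (1 + (norm x)\<^sup>2)"
    and "integrable N (G i x)"
proof -
  note [measurable] = G0_measurable G_section[OF i]
  have le: "(norm (G i x w))\<^sup>2 \<le> 2 * (norm (G i x w - G0 w))\<^sup>2 + 2 * (norm (G0 w))\<^sup>2" for w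
    using norm_add_square_le[of "G i x w - G0 w" "G0 w"] by simp
  show int: "integrable N (\<lambda>w. (norm (G i x w))\<^sup>2)"
    using integrable_norm_square_add[OF _ _ noise_integral(1)[OF i, of x] G0_square] by simp
  have "(\<integral>w. (norm (G i x w))\<^sup>2 \<partial>N) \<le> (\<integral>w. 2 * (norm (G i x w - G0 w))\<^sup>2 + 2 * (norm (G0 w))\<^sup>2 \<partial>N)"
    using int noise_integral(1)[OF i, of x] G0_square le by (intro integral_mono) auto
  also have "\<dots> = 2 * (\<integral>w. (norm (G i x w - G0 w))\<^sup>2 \<partial>N) + 2 * (\<integral>w. (norm (G0 w))\<^sup>2 \<partial>N)"
    using noise_integral(1)[OF i, of x] G0_square by simp
  also have "\<dots> \<le> 2 * (C * ((norm x)\<^sup>2 + h0\<^sup>2)) + 2 * (\<integral>w. (norm (G0 w))\<^sup>2 \<partial>N)"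
  proof -
    have "(incr i)\<^sup>2 \<le> h0\<^sup>2" using incr_le[OF i] incr_nonneg by (intro power_mono)
    then have "C * ((norm x)\<^sup>2 + (incr i)\<^sup>2) \<le> C * ((norm x)\<^sup>2 + h0\<^sup>2)"
      using C_nonneg by (intro mult_left_mono) auto
    then show ?thesis using noise_integral(2)[OF i, of x] by linarith
  qed
  also have "\<dots> \<le> c2 * (1 + (norm x)\<^sup>2)"
  proof -
    have "0 \<le> (\<integral>w. (norm (G0 w))\<^sup>2 \<partial>N) * (norm x)\<^sup>2" "0 \<le> C * h0\<^sup>2 * (norm x)\<^sup>2" "0 \<le> C"
      using C_nonneg by auto
    then show ?thesis by (simp add: c2_def algebra_simps)
  qed
  finally show "(\<integral>w. (norm (G i x w))\<^sup>2 \<partial>N) \<le> c2 * (1 + (norm x)\<^sup>2)" .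
  show "integrable N (G i x)"
    by (rule integrable_norm_squareD[OF N.finite_measure_axioms _ int]) simp
qed

lemma mean_dir_bias: "i \<ge> 1 \<Longrightarrow> norm (mean_dir i x - g x) \<le> C * incr i"
  using bias[of i x] by (simp add: mean_dir_def incr_def)

lemma mean_dir_square: "i \<ge> 1 \<Longrightarrow> (norm (mean_dir i x))\<^sup>2 \<le> c2 * (1 + (norm x)\<^sup>2)"
  using N.norm_expectation_square_le(2)[of "G i x"] G_section[of i x] G_square(1)[of i x] G_square(2)[of i x]
  by (simp add: mean_dir_def)

text \<open>The growth of \<open>g\<close> is derived: \<open>g\<close> is within a constant of the
  mean direction of the first step, which is controlled by the second moment of that
  direction.\<close>

lemma g_square: "(norm (g x))\<^sup>2 \<le> (2 * c2 + 2 * (C * h0)\<^sup>2) * (1 + (norm x)\<^sup>2)"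
proof -
  have "(norm (g x))\<^sup>2 \<le> 2 * (norm (g x - mean_dir 1 x))\<^sup>2 + 2 * (norm (mean_dir 1 x))\<^sup>2"
    using norm_add_square_le[of "g x - mean_dir 1 x" "mean_dir 1 x"] by simp
  also have "(norm (g x - mean_dir 1 x))\<^sup>2 \<le> (C * h0)\<^sup>2"
  proof (rule power_mono)
    have "norm (g x - mean_dir 1 x) \<le> C * incr 1" using mean_dir_bias[of 1 x] by (simp add: norm_minus_commute)
    also have "\<dots> \<le> C * h0" using incr_le[of 1] C_nonneg by (intro mult_left_mono) auto
    finally show "norm (g x - mean_dir 1 x) \<le> C * h0" .
  qed simp
  also have "(norm (mean_dir 1 x))\<^sup>2 \<le> c2 * (1 + (norm x)\<^sup>2)" by (rule mean_dir_square) simp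
  finally have "(norm (g x))\<^sup>2 \<le> 2 * (C * h0)\<^sup>2 + 2 * (c2 * (1 + (norm x)\<^sup>2))" by simp
  moreover have "0 \<le> (C * h0)\<^sup>2 * (norm x)\<^sup>2" by simp
  moreover have "(2 * c2 + 2 * q) * (1 + y) = 2 * q + 2 * (c2 * (1 + y)) + 2 * (q * y)" for q y
    by (simp add: algebra_simps)
  ultimately show ?thesis by (simp only:)
qed

text \<open>The expected squared distance after a step from \<open>x\<close>, expanded: the drift,
  the bias bounded by Cauchy-Schwarz, and the second moment of the direction.\<close>

definition step_bound :: "nat \<Rightarrow> 'e \<Rightarrow> real" where
  "step_bound i x = (norm x)\<^sup>2 - 2 * step i * (x \<bullet> g x) + 2 * step i * (C * incr i * norm x)
     + (step i)\<^sup>2 * (c2 * (1 + (norm x)\<^sup>2))"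

lemma step_integral:
  assumes i: "i \<ge> 1"
  shows "integrable N (\<lambda>w. (norm (x - step i *\<^sub>R G i x w))\<^sup>2)"
    and "(\<integral>w. (norm (x - step i *\<^sub>R G i x w))\<^sup>2 \<partial>N) \<le> step_bound i x"
proof -
  have e: "(norm (x - step i *\<^sub>R G i x w))\<^sup>2 =
      (norm x)\<^sup>2 - 2 * step i * (x \<bullet> G i x w) + (step i)\<^sup>2 * (norm (G i x w))\<^sup>2" for w
    by (simp add: power2_norm_eq_inner inner_diff_left inner_diff_right inner_commute[of "G i x w" x] algebra_simps)
       (simp add: power2_eq_square)
  show "integrable N (\<lambda>w. (norm (x - step i *\<^sub>R G i x w))\<^sup>2)"
    unfolding e using G_square[OF i, of x] by auto
  have "(\<integral>w. (norm (x - step i *\<^sub>R G i x w))\<^sup>2 \<partial>N) =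
     (norm x)\<^sup>2 - 2 * step i * (x \<bullet> mean_dir i x) + (step i)\<^sup>2 * (\<integral>w. (norm (G i x w))\<^sup>2 \<partial>N)"
    unfolding e mean_dir_def using G_square[OF i, of x] by (simp add: N.prob_space)
  also have "- (x \<bullet> mean_dir i x) \<le> - (x \<bullet> g x) + C * incr i * norm x"
  proof -
    have "- (x \<bullet> (mean_dir i x - g x)) \<le> norm x * norm (mean_dir i x - g x)"
      using Cauchy_Schwarz_ineq2[of x "mean_dir i x - g x"] by linarith
    also have "\<dots> \<le> norm x * (C * incr i)" by (intro mult_left_mono mean_dir_bias i) simp
    finally show ?thesis by (simp add: inner_diff_right mult_ac)
  qed
  then have "2 * step i * - (x \<bullet> mean_dir i x) \<le> 2 * step i * (- (x \<bullet> g x) + C * incr i * norm x)"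
    using step_nonneg by (intro mult_left_mono) auto
  moreover have "(step i)\<^sup>2 * (\<integral>w. (norm (G i x w))\<^sup>2 \<partial>N) \<le> (step i)\<^sup>2 * (c2 * (1 + (norm x)\<^sup>2))"
    using G_square(2)[OF i, of x] by (intro mult_left_mono) auto
  ultimately show "(\<integral>w. (norm (x - step i *\<^sub>R G i x w))\<^sup>2 \<partial>N) \<le> step_bound i x"
    by (simp add: step_bound_def algebra_simps)
qed

text \<open>The bias term is linear in \<open>norm x\<close>;
  \<open>norm x \<le> 1 + (norm x)\<^sup>2\<close> brings it into the form that
  \<open>perturbed_descent_sequence\<close> accepts.\<close>

lemma step_bound_le: "step_bound i x \<le> (1 + 2 * step i * C * incr i + (step i)\<^sup>2 * c2) * (norm x)\<^sup>2
     + (2 * step i * C * incr i + (step i)\<^sup>2 * c2) - 2 * step i * (x \<bullet> g x)"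
proof -
  have "norm x \<le> 1 + (norm x)\<^sup>2"
    using zero_le_power2[of "norm x - 1/2"] by (simp add: power2_eq_square algebra_simps)
  then have "2 * step i * C * incr i * norm x \<le> 2 * step i * C * incr i * (1 + (norm x)\<^sup>2)"
    using step_nonneg incr_nonneg C_nonneg by (intro mult_left_mono) auto
  then show ?thesis by (simp add: step_bound_def algebra_simps)
qed

text \<open>Finiteness propagates along the recursion. Nonnegative integrals are used because
  integrability is the claim itself.\<close>

lemma D_square: "integrable M (\<lambda>\<omega>. (norm (D k \<omega>))\<^sup>2)"
proof (induction k)
  case (Suc k)
  note [measurable] = D_hist[of k] G_measurable[of "Suc k", simplified] g_measurable
  let ?c = "1 + 2 * step (Suc k) * C * incr (Suc k) + (step (Suc k))\<^sup>2 * c2"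
  have "(\<integral>\<^sup>+\<omega>. ennreal ((norm (D (Suc k) \<omega>))\<^sup>2) \<partial>M) =
    (\<integral>\<^sup>+\<omega>. (\<integral>\<^sup>+w. ennreal ((norm (D k \<omega> - step (Suc k) *\<^sub>R G (Suc k) (D k \<omega>) w))\<^sup>2) \<partial>N) \<partial>M)"
    by (simp, rule nn_integral_next) measurable
  also have "\<dots> \<le> (\<integral>\<^sup>+\<omega>. ennreal (?c * (norm (D k \<omega>))\<^sup>2 + ?c) \<partial>M)"
  proof (rule nn_integral_mono)
    fix \<omega>
    have "step_bound (Suc k) (D k \<omega>) \<le> ?c * (norm (D k \<omega>))\<^sup>2 + ?c"
      using step_bound_le[of "Suc k" "D k \<omega>"] step_nonneg[of "Suc k"] g_nonneg[of "D k \<omega>"]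
        mult_nonneg_nonneg[of "step (Suc k)" "D k \<omega> \<bullet> g (D k \<omega>)"] by linarith
    then show "(\<integral>\<^sup>+w. ennreal ((norm (D k \<omega> - step (Suc k) *\<^sub>R G (Suc k) (D k \<omega>) w))\<^sup>2) \<partial>N) \<le> ennreal (?c * (norm (D k \<omega>))\<^sup>2 + ?c)"
      using step_integral[of "Suc k" "D k \<omega>"]
      by (subst nn_integral_eq_integral) (auto intro!: ennreal_leI)
  qed
  also have "\<dots> < \<infinity>"
    using Suc step_nonneg incr_nonneg C_nonneg c2_nonneg
    by (subst nn_integral_eq_integral) (auto intro!: AE_I2 add_nonneg_nonneg mult_nonneg_nonneg)
  finally show ?case by (intro integrableI_nonneg AE_I2 zero_le_power2) measurable
qed simp

lemma g_D_integrable: "integrable M (\<lambda>\<omega>. D k \<omega> \<bullet> g (D k \<omega>))"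
proof -
  note [measurable] = g_measurable
  have "integrable M (\<lambda>\<omega>. (norm (g (D k \<omega>)))\<^sup>2)"
    by (rule Bochner_Integration.integrable_bound[of _ "\<lambda>\<omega>. (2 * c2 + 2 * (C * h0)\<^sup>2) * (1 + (norm (D k \<omega>))\<^sup>2)"])
       (use D_square in \<open>auto intro!: AE_I2 order_trans[OF g_square] abs_ge_self\<close>)
  then show ?thesis by (intro integrable_inner_square D_square) auto
qed

lemma step_bound_D_integrable: "integrable M (\<lambda>\<omega>. step_bound i (D k \<omega>))"
proof -
  have "integrable M (\<lambda>\<omega>. norm (D k \<omega>))"
    by (rule integrable_norm[OF integrable_norm_squareD[OF finite_measure_axioms _ D_square]]) simp
  moreover have "step_bound i x = (1 + (step i)\<^sup>2 * c2) * (norm x)\<^sup>2 + (- 2 * step i) * (x \<bullet> g x)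
      + (2 * step i * C * incr i) * norm x + (step i)\<^sup>2 * c2" for x
    by (simp add: step_bound_def algebra_simps)
  ultimately show ?thesis
    using D_square[of k] g_D_integrable[of k] by simp
qed

text \<open>The next observation is integrated out with the past frozen. An event of the past may be
  kept as an indicator, so the same estimate serves the global bound, with the whole space, and the
  localised one, with the event \<open>good\<close>.\<close>

lemma one_step:
  assumes A: "A \<in> sets (hist k)"
  shows "(\<integral>\<omega>. indicator A \<omega> * (norm (D (Suc k) \<omega>))\<^sup>2 \<partial>M) \<le> (\<integral>\<omega>. indicator A \<omega> * step_bound (Suc k) (D k \<omega>) \<partial>M)"
proof -
  note [measurable] = D_hist[of k] G_measurable[of "Suc k", simplified] A
  have AM: "A \<in> sets M" using A hist_subalgebra[of k] by (auto simp: subalgebra_def)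
  let ?f = "\<lambda>\<omega> w. indicator A \<omega> * (norm (D k \<omega> - step (Suc k) *\<^sub>R G (Suc k) (D k \<omega>) w))\<^sup>2"
  have f: "(\<lambda>(\<omega>, w). ?f \<omega> w) \<in> borel_measurable (hist k \<Otimes>\<^sub>M N)" by measurable
  have e: "?f \<omega> (W (Suc k) \<omega>) = indicator A \<omega> * (norm (D (Suc k) \<omega>))\<^sup>2" for \<omega> by simp
  have int: "integrable M (\<lambda>\<omega>. ?f \<omega> (W (Suc k) \<omega>))"
    unfolding e using integrable_real_mult_indicator[OF AM D_square[of "Suc k"]] by (simp only: mult.commute)
  have "(\<integral>\<omega>. indicator A \<omega> * (norm (D (Suc k) \<omega>))\<^sup>2 \<partial>M) = (\<integral>\<omega>. ?f \<omega> (W (Suc k) \<omega>) \<partial>M)"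
    by (simp only: e)
  also have "\<dots> = (\<integral>\<omega>. (\<integral>w. ?f \<omega> w \<partial>N) \<partial>M)" by (rule integral_next(2)[OF f int])
  also have "\<dots> \<le> (\<integral>\<omega>. indicator A \<omega> * step_bound (Suc k) (D k \<omega>) \<partial>M)"
  proof (rule integral_mono)
    show "integrable M (\<lambda>\<omega>. \<integral>w. ?f \<omega> w \<partial>N)" by (rule integral_next(1)[OF f int])
    show "integrable M (\<lambda>\<omega>. indicator A \<omega> * step_bound (Suc k) (D k \<omega>))"
      using integrable_real_mult_indicator[OF AM step_bound_D_integrable[of "Suc k" k]] by (simp add: mult.commute)
    show "(\<integral>w. ?f \<omega> w \<partial>N) \<le> indicator A \<omega> * step_bound (Suc k) (D k \<omega>)" for \<omega>
      using step_integral(2)[of "Suc k" "D k \<omega>"] by (simp add: mult_left_mono)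
  qed
  finally show ?thesis .
qed

section \<open>The global Lyapunov estimate\<close>

definition err :: "nat \<Rightarrow> real" where
  "err i = 2 * step i * C * incr i + (step i)\<^sup>2 * c2"

lemma err_nonneg: "0 \<le> err i"
  using step_nonneg incr_nonneg C_nonneg c2_nonneg by (simp add: err_def)

lemma step_square: "(step i)\<^sup>2 = \<eta>0\<^sup>2 * real i powr (- (2 * \<alpha>))"
  by (simp add: step_def power_mult_distrib power2_eq_square powr_add[symmetric])

lemma step_square_summable: "summable (\<lambda>k. (step (Suc k))\<^sup>2)"
  unfolding step_square using \<alpha> by (intro summable_mult summable_powr_minus) simp

text \<open>The two exponents are \<alpha> + \<gamma> and 2 * \<alpha>, both above 1.\<close>

lemma err_summable: "summable (\<lambda>k. err (Suc k))"
proof -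
  have "step i * incr i = \<eta>0 * h0 * real i powr (- (\<alpha> + \<gamma>))" for i
    by (simp add: step_def incr_def powr_add[symmetric])
  then have e: "err i = 2 * C * \<eta>0 * h0 * real i powr (- (\<alpha> + \<gamma>)) + c2 * (step i)\<^sup>2" for i
    by (simp add: err_def mult_ac)
  show ?thesis
    unfolding e using \<alpha> \<gamma>
    by (intro summable_add summable_mult summable_powr_minus step_square_summable) simp
qed

text \<open>Since 2 * \<gamma> > 1 > \<alpha>, squared increments are dominated by the steps and can
  be merged with them.\<close>

lemma incr_square_le: "(incr i)\<^sup>2 \<le> h0\<^sup>2 * real i powr (- \<alpha>)"
proof (cases "i = 0")
  case False
  have "(incr i)\<^sup>2 = h0\<^sup>2 * real i powr (- (2 * \<gamma>))"
    by (simp add: incr_def power_mult_distrib power2_eq_square powr_add[symmetric])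
  also have "\<dots> \<le> h0\<^sup>2 * real i powr (- \<alpha>)"
    using False \<alpha> \<gamma> by (intro mult_left_mono powr_mono) auto
  finally show ?thesis .
qed (simp add: incr_def)

text \<open>Besides the bound, the sum of the drifts is retained: it is what later forces the
  iterates towards the target.\<close>

lemma second_moment_bounded: "\<exists>A. \<forall>k. expectation (\<lambda>\<omega>. (norm (D k \<omega>))\<^sup>2) \<le> A"
  and drift_summable: "summable (\<lambda>k. 2 * step (Suc k) * expectation (\<lambda>\<omega>. D k \<omega> \<bullet> g (D k \<omega>)))"
proof -
  let ?a = "\<lambda>k. expectation (\<lambda>\<omega>. (norm (D k \<omega>))\<^sup>2)"
  let ?b = "\<lambda>k. 2 * step (Suc k) * expectation (\<lambda>\<omega>. D k \<omega> \<bullet> g (D k \<omega>))"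
  have rec: "?a (Suc k) + ?b k \<le> (1 + err (Suc k)) * ?a k + err (Suc k)" for k
  proof -
    have "space M \<in> sets (hist k)" using sets.top[of "hist k"] by simp
    then have "(\<integral>\<omega>. indicator (space M) \<omega> * (norm (D (Suc k) \<omega>))\<^sup>2 \<partial>M) \<le> (\<integral>\<omega>. indicator (space M) \<omega> * step_bound (Suc k) (D k \<omega>) \<partial>M)"
      by (rule one_step)
    moreover have "(\<integral>\<omega>. indicator (space M) \<omega> * (norm (D (Suc k) \<omega>))\<^sup>2 \<partial>M) = ?a (Suc k)"
      by (intro Bochner_Integration.integral_cong) auto
    moreover have "(\<integral>\<omega>. indicator (space M) \<omega> * step_bound (Suc k) (D k \<omega>) \<partial>M) = expectation (\<lambda>\<omega>. step_bound (Suc k) (D k \<omega>))"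
      by (intro Bochner_Integration.integral_cong) auto
    moreover have "expectation (\<lambda>\<omega>. step_bound (Suc k) (D k \<omega>)) \<le>
        expectation (\<lambda>\<omega>. (1 + err (Suc k)) * (norm (D k \<omega>))\<^sup>2 + err (Suc k) - 2 * step (Suc k) * (D k \<omega> \<bullet> g (D k \<omega>)))"
    proof (rule integral_mono)
      show "step_bound (Suc k) (D k \<omega>) \<le> (1 + err (Suc k)) * (norm (D k \<omega>))\<^sup>2 + err (Suc k) - 2 * step (Suc k) * (D k \<omega> \<bullet> g (D k \<omega>))" for \<omega>
        using step_bound_le[of "Suc k" "D k \<omega>"] by (simp add: err_def algebra_simps)
    qed (use D_square g_D_integrable step_bound_D_integrable in auto)
    moreover have "\<dots> = (1 + err (Suc k)) * ?a k + err (Suc k) - ?b k"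
      using D_square[of k] g_D_integrable[of k] by (simp add: prob_space)
    ultimately show ?thesis by linarith
  qed
  have b0: "0 \<le> ?b k" for k
    using step_nonneg g_nonneg by (intro mult_nonneg_nonneg Bochner_Integration.integral_nonneg) auto
  have a0: "0 \<le> ?a k" for k by (intro Bochner_Integration.integral_nonneg) auto
  show "\<exists>A. \<forall>k. ?a k \<le> A"
    by (rule perturbed_descent_sequence(1)[OF a0 b0 err_nonneg rec err_summable])
  show "summable ?b"
    by (rule perturbed_descent_sequence(2)[OF a0 b0 err_nonneg rec err_summable])
qed

text \<open>If the iterates were at distance at least \<open>e\<close> with probability above
  \<open>d\<close> at all late times, every expected drift would be at least
  \<open>\<mu> * e\<^sup>2 * d\<close>; summability of the weighted drifts would then make the steps
  summable, contrary to \<alpha> < 1.\<close>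

lemma close_at_some_time:
  assumes e: "0 < e" "e \<le> r" and d: "0 < d"
  shows "\<exists>n\<ge>n0. prob {\<omega> \<in> space M. e \<le> norm (D n \<omega>)} \<le> d"
proof (rule ccontr)
  assume "\<not> ?thesis"
  then have far: "d < prob {\<omega> \<in> space M. e \<le> norm (D n \<omega>)}" if "n \<ge> n0" for n
    using that by (meson not_le)
  have low: "\<mu> * e\<^sup>2 * d \<le> expectation (\<lambda>\<omega>. D n \<omega> \<bullet> g (D n \<omega>))" if n: "n \<ge> n0" for n
  proof -
    have [measurable]: "{\<omega> \<in> space M. e \<le> norm (D n \<omega>)} \<in> sets M" by measurable
    have "\<mu> * e\<^sup>2 * d \<le> \<mu> * e\<^sup>2 * prob {\<omega> \<in> space M. e \<le> norm (D n \<omega>)}"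
      using far[OF n] \<mu>_pos by (intro mult_left_mono) auto
    also have "\<dots> = expectation (\<lambda>\<omega>. \<mu> * e\<^sup>2 * indicator {\<omega> \<in> space M. e \<le> norm (D n \<omega>)} \<omega>)"
      by simp
    also have "\<dots> \<le> expectation (\<lambda>\<omega>. D n \<omega> \<bullet> g (D n \<omega>))"
    proof (rule integral_mono)
      show "integrable M (\<lambda>\<omega>. \<mu> * e\<^sup>2 * indicator {\<omega> \<in> space M. e \<le> norm (D n \<omega>)} \<omega>)"
        by (intro integrable_mult_right integrable_const_bound[of _ 1]) auto
      show "\<mu> * e\<^sup>2 * indicator {\<omega> \<in> space M. e \<le> norm (D n \<omega>)} \<omega> \<le> D n \<omega> \<bullet> g (D n \<omega>)" for \<omega>
        using g_away[OF e, of "D n \<omega>"] g_nonneg[of "D n \<omega>"] by (auto simp: indicator_def)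
    qed (rule g_D_integrable)
    finally show ?thesis .
  qed
  have "summable (\<lambda>k. 2 * (\<mu> * e\<^sup>2 * d) * step (Suc k))"
  proof (rule summable_comparison_test[OF _ drift_summable], intro exI allI impI)
    fix n assume "n0 \<le> n"
    have "2 * step (Suc n) * (\<mu> * e\<^sup>2 * d) \<le> 2 * step (Suc n) * expectation (\<lambda>\<omega>. D n \<omega> \<bullet> g (D n \<omega>))"
      using low[OF \<open>n0 \<le> n\<close>] step_nonneg by (intro mult_left_mono) auto
    then show "norm (2 * (\<mu> * e\<^sup>2 * d) * step (Suc n)) \<le> 2 * step (Suc n) * expectation (\<lambda>\<omega>. D n \<omega> \<bullet> g (D n \<omega>))"
      using step_nonneg[of "Suc n"] \<mu>_pos d by (simp add: mult_ac abs_mult)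
  qed
  then have "summable (\<lambda>k. real (Suc k) powr (- \<alpha>))"
    unfolding step_def using \<mu>_pos e d \<eta>0_pos by (subst (asm) summable_cmult_iff, subst (asm) summable_cmult_iff) auto
  then show False using not_summable_powr_minus[of \<alpha>] \<alpha> by simp
qed

text \<open>On \<open>good n0 e k\<close> the iterate was within \<open>e\<close> of the optimum at time \<open>n0\<close> and has stayed in the
  region of strong convexity up to time \<open>k\<close>; there is no constraint before time \<open>n0\<close>.\<close>

definition good :: "nat \<Rightarrow> real \<Rightarrow> nat \<Rightarrow> 'a set" where
  "good n0 e k = {\<omega> \<in> space M. n0 \<le> k \<longrightarrow> norm (D n0 \<omega>) < e \<and> (\<forall>j\<in>{n0..k}. norm (D j \<omega>) \<le> r)}"

lemma good_hist: "good n0 e k \<in> sets (hist k)"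
proof (cases "n0 \<le> k")
  case True
  have m: "D j \<in> borel_measurable (hist k)" if "j \<le> k" for j
    by (rule measurable_from_subalg[OF hist_mono[OF that] D_hist])
  have [measurable]: "D n0 \<in> borel_measurable (hist k)" using m True by simp
  have "{\<omega> \<in> space (hist k). norm (D n0 \<omega>) < e} \<in> sets (hist k)" by measurable
  moreover have "{\<omega> \<in> space (hist k). \<forall>j\<in>{n0..k}. norm (D j \<omega>) \<le> r} \<in> sets (hist k)"
  proof (intro sets.sets_Collect_finite_All)
    fix j assume "j \<in> {n0..k}"
    then have [measurable]: "D j \<in> borel_measurable (hist k)" using m by simp
    show "{\<omega> \<in> space (hist k). norm (D j \<omega>) \<le> r} \<in> sets (hist k)" by measurable
  qed simp
  ultimately have "{\<omega> \<in> space (hist k). norm (D n0 \<omega>) < e} \<inter> {\<omega> \<in> space (hist k). \<forall>j\<in>{n0..k}. norm (D j \<omega>) \<le> r} \<in> sets (hist k)"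
    by (rule sets.Int)
  also have "{\<omega> \<in> space (hist k). norm (D n0 \<omega>) < e} \<inter> {\<omega> \<in> space (hist k). \<forall>j\<in>{n0..k}. norm (D j \<omega>) \<le> r} = good n0 e k"
    using True by (auto simp: good_def)
  finally show ?thesis .
next
  case False
  then have "good n0 e k = space (hist k)" by (auto simp: good_def)
  then show ?thesis by (simp only: sets.top)
qed

lemma good_sets [measurable]: "good n0 e k \<in> sets M"
  using good_hist[of n0 e k] hist_subalgebra[of k] by (auto simp: subalgebra_def)

lemma good_antimono: "k \<le> l \<Longrightarrow> good n0 e l \<subseteq> good n0 e k"
  by (auto simp: good_def)

section \<open>Second moments on the good event\<close>

definition V :: "nat \<Rightarrow> real \<Rightarrow> nat \<Rightarrow> real" where
  "V n0 e k = expectation (\<lambda>\<omega>. indicator (good n0 e k) \<omega> * (norm (D k \<omega>))\<^sup>2)"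

lemma good_D_integrable: "integrable M (\<lambda>\<omega>. indicator (good n0 e k) \<omega> * (norm (D l \<omega>))\<^sup>2)"
  using integrable_real_mult_indicator[OF good_sets D_square[of l]] by (simp add: mult.commute)

lemma V_nonneg: "0 \<le> V n0 e k"
  unfolding V_def by (intro Bochner_Integration.integral_nonneg) auto

text \<open>The first term is the bias after Young's inequality with weight \<mu>, the squared
  increment being at most \<open>h0\<^sup>2 / \<eta>0\<close> times the step; the second is the
  second-moment term for \<open>norm x \<le> r\<close>.\<close>

definition c3 :: real where "c3 = (C * h0)\<^sup>2 / (\<mu> * \<eta>0) + c2 * (1 + r\<^sup>2)"

lemma c3_nonneg: "0 \<le> c3"
  using \<mu>_pos \<eta>0_pos c2_nonneg by (simp add: c3_def)

lemma step_bound_local: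
  assumes "norm x \<le> r"
  shows "step_bound i x \<le> (1 - \<mu> * step i) * (norm x)\<^sup>2 + c3 * (step i)\<^sup>2"
proof -
  have 1: "2 * step i * (\<mu> * (norm x)\<^sup>2) \<le> 2 * step i * (x \<bullet> g x)"
    using g_local[OF assms] step_nonneg by (intro mult_left_mono) auto
  \<comment> \<open>Half of the drift coefficient \<open>2 * \<mu>\<close> is spent on the bias, so
    that \<mu> remains as contraction rate.\<close>
  have "2 * (C * incr i * norm x) \<le> \<mu> * (norm x)\<^sup>2 + (C * incr i)\<^sup>2 / \<mu>"
  proof -
    have "0 \<le> (\<mu> * norm x - C * incr i)\<^sup>2 / \<mu>" using \<mu>_pos by simp
    then show ?thesis using \<mu>_pos by (simp add: power2_eq_square field_simps)
  qed
  also have "(C * incr i)\<^sup>2 / \<mu> \<le> (C * h0)\<^sup>2 / (\<mu> * \<eta>0) * step i"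
  proof -
    have "C\<^sup>2 * (incr i)\<^sup>2 \<le> C\<^sup>2 * (h0\<^sup>2 * real i powr (- \<alpha>))"
      using incr_square_le[of i] by (intro mult_left_mono) auto
    then have "(C * incr i)\<^sup>2 \<le> (C * h0)\<^sup>2 * real i powr (- \<alpha>)"
      by (simp add: power_mult_distrib)
    then show ?thesis using \<mu>_pos \<eta>0_pos by (simp add: step_def field_simps)
  qed
  finally have "step i * (2 * (C * incr i * norm x)) \<le> step i * (\<mu> * (norm x)\<^sup>2 + (C * h0)\<^sup>2 / (\<mu> * \<eta>0) * step i)"
    using step_nonneg by (intro mult_left_mono) auto
  moreover have "(step i)\<^sup>2 * (c2 * (1 + (norm x)\<^sup>2)) \<le> (step i)\<^sup>2 * (c2 * (1 + r\<^sup>2))"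
    using assms c2_nonneg by (intro mult_left_mono add_left_mono power_mono) auto
  ultimately show ?thesis
    using 1 by (simp add: step_bound_def c3_def algebra_simps power2_eq_square)
qed

text \<open>The paths that drop out of the event at time \<open>Suc k\<close> have distance above
  \<open>r\<close> there. Their share of the second moment is at least \<open>r\<^sup>2\<close>
  times their probability and is kept on the left.\<close>

lemma V_step:
  assumes k: "n0 \<le> k"
  shows "V n0 e (Suc k) + r\<^sup>2 * (prob (good n0 e k) - prob (good n0 e (Suc k)))
    \<le> (1 - \<mu> * step (Suc k)) * V n0 e k + c3 * (step (Suc k))\<^sup>2"
proof -
  let ?A = "good n0 e k" and ?B = "good n0 e (Suc k)"
  have BA: "?B \<subseteq> ?A" by (rule good_antimono) simp
  have iA: "integrable M (indicator ?A :: 'a \<Rightarrow> real)" and iB: "integrable M (indicator ?B :: 'a \<Rightarrow> real)"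
    by (auto intro!: integrable_const_bound[of _ 1])
  have "V n0 e (Suc k) + r\<^sup>2 * (prob ?A - prob ?B) =
      expectation (\<lambda>\<omega>. indicator ?B \<omega> * (norm (D (Suc k) \<omega>))\<^sup>2 + r\<^sup>2 * (indicator ?A \<omega> - indicator ?B \<omega>))"
    unfolding V_def using iA iB good_D_integrable[of n0 e "Suc k" "Suc k"]
    by (simp del: D.simps)
  also have "\<dots> \<le> expectation (\<lambda>\<omega>. indicator ?A \<omega> * (norm (D (Suc k) \<omega>))\<^sup>2)"
  proof (rule integral_mono)
    fix \<omega> assume \<omega>: "\<omega> \<in> space M"
    show "indicator ?B \<omega> * (norm (D (Suc k) \<omega>))\<^sup>2 + r\<^sup>2 * (indicator ?A \<omega> - indicator ?B \<omega>) \<le> indicator ?A \<omega> * (norm (D (Suc k) \<omega>))\<^sup>2"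
    proof (cases "\<omega> \<in> ?B")
      case True
      then show ?thesis using BA by (auto simp: indicator_def)
    next
      case False
      show ?thesis
      proof (cases "\<omega> \<in> ?A")
        case True
        with False k have "r < norm (D (Suc k) \<omega>)"
          by (auto simp: good_def le_Suc_eq simp del: D.simps)
        then have "r\<^sup>2 \<le> (norm (D (Suc k) \<omega>))\<^sup>2" using r_pos by (intro power_mono) auto
        then show ?thesis using True False by (simp del: D.simps)
      qed (use False in \<open>simp del: D.simps\<close>)
    qed
  qed (use iA iB good_D_integrable[of n0 e _ "Suc k"] in \<open>auto simp del: D.simps\<close>)
  also have "\<dots> \<le> expectation (\<lambda>\<omega>. indicator ?A \<omega> * step_bound (Suc k) (D k \<omega>))"
    by (rule one_step[OF good_hist])
  also have "\<dots> \<le> expectation (\<lambda>\<omega>. (1 - \<mu> * step (Suc k)) * (indicator ?A \<omega> * (norm (D k \<omega>))\<^sup>2) + c3 * (step (Suc k))\<^sup>2)"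
  proof (rule integral_mono)
    show "integrable M (\<lambda>\<omega>. indicator ?A \<omega> * step_bound (Suc k) (D k \<omega>))"
      using integrable_real_mult_indicator[OF good_sets step_bound_D_integrable[of "Suc k" k]] by (simp add: mult.commute)
    show "integrable M (\<lambda>\<omega>. (1 - \<mu> * step (Suc k)) * (indicator ?A \<omega> * (norm (D k \<omega>))\<^sup>2) + c3 * (step (Suc k))\<^sup>2)"
      using good_D_integrable[of n0 e k k] by simp
    fix \<omega>
    show "indicator ?A \<omega> * step_bound (Suc k) (D k \<omega>) \<le> (1 - \<mu> * step (Suc k)) * (indicator ?A \<omega> * (norm (D k \<omega>))\<^sup>2) + c3 * (step (Suc k))\<^sup>2"
    proof (cases "\<omega> \<in> ?A")
      case True
      then have "norm (D k \<omega>) \<le> r" using k by (auto simp: good_def)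
      from step_bound_local[OF this] True show ?thesis by simp
    qed (use c3_nonneg in simp)
  qed
  also have "\<dots> = (1 - \<mu> * step (Suc k)) * V n0 e k + c3 * (step (Suc k))\<^sup>2"
    unfolding V_def using good_D_integrable[of n0 e k k] by (simp add: prob_space)
  finally show ?thesis .
qed

text \<open>Leaving the region costs at least \<open>r\<^sup>2\<close> of second moment, which bounds the probability of
  ever leaving.\<close>

lemma escape_bound:
  assumes e: "0 < e" "e \<le> r" and k: "n0 \<le> k"
  shows "V n0 e k + r\<^sup>2 * (prob (good n0 e n0) - prob (good n0 e k))
     \<le> e\<^sup>2 + c3 * (\<Sum>j=n0..<k. (step (Suc j))\<^sup>2)"
  using k
proof (induction k rule: nat_induct_at_least)
  case base
  have "V n0 e n0 \<le> expectation (\<lambda>\<omega>. e\<^sup>2)"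
    unfolding V_def
  proof (rule integral_mono)
    fix \<omega>
    show "indicator (good n0 e n0) \<omega> * (norm (D n0 \<omega>))\<^sup>2 \<le> e\<^sup>2"
      using e by (auto simp: good_def indicator_def intro!: power_mono)
  qed (auto intro: good_D_integrable)
  then show ?case by (simp add: prob_space)
next
  case (Suc k)
  have "(1 - \<mu> * step (Suc k)) * V n0 e k \<le> 1 * V n0 e k"
    using V_nonneg \<mu>_pos step_nonneg by (intro mult_right_mono) auto
  with V_step[OF Suc.hyps(1), of e] Suc.IH Suc.hyps show ?case
    by (simp add: algebra_simps)
qed

text \<open>Three sources of failure get \<open>d / 3\<close> each: not being within
  \<open>e\<close> at time \<open>n0\<close>, the initial energy
  \<open>e\<^sup>2 / r\<^sup>2\<close>, and the tail of the squared steps. Hence \<open>e\<close> is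
  fixed first, then the start of the tail, and finally \<open>n0\<close> beyond it by
  \<open>close_at_some_time\<close>.\<close>

lemma good_exists:
  assumes d: "d > 0"
  shows "\<exists>n0 e. 0 < e \<and> e \<le> r \<and> (\<forall>k. prob (space M - good n0 e k) \<le> d)"
proof -
  define e where "e = min r (r * sqrt (d / 3))"
  have e: "0 < e" "e \<le> r" using d r_pos by (auto simp: e_def)
  have e2: "e\<^sup>2 / r\<^sup>2 \<le> d / 3"
  proof -
    have "e\<^sup>2 \<le> (r * sqrt (d / 3))\<^sup>2" using e by (intro power_mono) (auto simp: e_def)
    then show ?thesis using r_pos d by (simp add: power_mult_distrib field_simps)
  qed
  let ?s = "\<lambda>k. (step (Suc k))\<^sup>2"
  have "(\<lambda>n. c3 * (\<Sum>k. ?s (k + n)) / r\<^sup>2) \<longlonglongrightarrow> c3 * 0 / r\<^sup>2"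
    by (intro tendsto_intros suminf_exist_split2 step_square_summable) (use r_pos in auto)
  then have "eventually (\<lambda>n. c3 * (\<Sum>k. ?s (k + n)) / r\<^sup>2 < d / 3) sequentially"
    using d by (intro order_tendstoD(2)) auto
  then obtain n1 where n1: "\<And>n. n \<ge> n1 \<Longrightarrow> c3 * (\<Sum>k. ?s (k + n)) / r\<^sup>2 < d / 3"
    by (auto simp: eventually_sequentially)
  obtain n0 where n0: "n0 \<ge> n1" "prob {\<omega> \<in> space M. e \<le> norm (D n0 \<omega>)} \<le> d / 3"
    using close_at_some_time[OF e, of "d / 3" n1] d by auto
  have "prob (space M - good n0 e k) \<le> d" for k
  proof (cases "n0 \<le> k")
    case True
    have "(\<Sum>j=n0..<k. ?s j) = (\<Sum>j<k - n0. ?s (j + n0))"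
      using sum.shift_bounds_nat_ivl[of ?s 0 n0 "k - n0"] True by (simp add: atLeast0LessThan)
    also have "\<dots> \<le> (\<Sum>j. ?s (j + n0))"
      using summable_ignore_initial_segment[OF step_square_summable, of n0] by (intro sum_le_suminf) auto
    finally have "c3 * (\<Sum>j=n0..<k. ?s j) \<le> c3 * (\<Sum>j. ?s (j + n0))"
      using c3_nonneg by (intro mult_left_mono)
    with escape_bound[OF e True] V_nonneg[of n0 e k]
    have "r\<^sup>2 * (prob (good n0 e n0) - prob (good n0 e k)) \<le> e\<^sup>2 + c3 * (\<Sum>j. ?s (j + n0))" by linarith
    then have "prob (good n0 e n0) - prob (good n0 e k) \<le> e\<^sup>2 / r\<^sup>2 + c3 * (\<Sum>j. ?s (j + n0)) / r\<^sup>2"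
      using r_pos by (simp add: field_simps)
    also have "\<dots> \<le> d / 3 + d / 3" using e2 n1[OF n0(1)] by linarith
    finally have 1: "prob (good n0 e n0) - prob (good n0 e k) \<le> d / 3 + d / 3" .
    have "good n0 e n0 = space M - {\<omega> \<in> space M. e \<le> norm (D n0 \<omega>)}"
      using e by (auto simp: good_def)
    then have "prob (good n0 e n0) = 1 - prob {\<omega> \<in> space M. e \<le> norm (D n0 \<omega>)}"
      by (simp add: prob_compl)
    moreover have "prob (space M - good n0 e k) = 1 - prob (good n0 e k)" by (simp add: prob_compl)
    ultimately show ?thesis using 1 n0(2) by linarith
  next
    case False
    then have "good n0 e k = space M" by (auto simp: good_def)
    then show ?thesis using d by simp
  qed
  with e show ?thesis by blast
qed

text \<open>The escape term of \<open>V_step\<close> is nonnegative and is dropped. The localised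
  recursion starts only at \<open>n0\<close>; the global second-moment bound takes care of the
  earlier indices.\<close>

lemma V_rate: "\<exists>K\<ge>0. \<forall>k. V n0 e k \<le> K * real (Suc k) powr (- \<alpha>)"
proof -
  obtain A where A: "\<And>k. expectation (\<lambda>\<omega>. (norm (D k \<omega>))\<^sup>2) \<le> A" using second_moment_bounded by blast
  have VA: "V n0 e k \<le> A" for k
  proof -
    have "V n0 e k \<le> expectation (\<lambda>\<omega>. (norm (D k \<omega>))\<^sup>2)"
      unfolding V_def by (intro integral_mono good_D_integrable D_square) (auto simp: indicator_def)
    then show ?thesis using A[of k] by linarith
  qed
  have A0: "0 \<le> A" using VA[of 0] V_nonneg[of n0 e 0] by linarith
  show ?thesis
  proof (rule contraction_rate[of \<alpha> "\<mu> * \<eta>0" "c3 * \<eta>0\<^sup>2" _ A n0])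
    fix k assume k: "n0 \<le> k"
    have "prob (good n0 e (Suc k)) \<le> prob (good n0 e k)"
      by (intro finite_measure_mono good_antimono good_sets) simp
    then have "0 \<le> r\<^sup>2 * (prob (good n0 e k) - prob (good n0 e (Suc k)))" by simp
    with V_step[OF k, of e]
    have "V n0 e (Suc k) \<le> (1 - \<mu> * step (Suc k)) * V n0 e k + c3 * (step (Suc k))\<^sup>2" by linarith
    then show "V n0 e (Suc k) \<le> (1 - \<mu> * \<eta>0 * real (Suc k) powr (- \<alpha>)) * V n0 e k + c3 * \<eta>0\<^sup>2 * (real (Suc k) powr (- \<alpha>))\<^sup>2"
      by (simp add: step_def power_mult_distrib mult_ac)
  qed (use \<alpha> \<mu>_pos \<eta>0_pos c3_nonneg VA A0 in auto)
qed

declare D.simps(2) [simp del]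

section \<open>Martingale residuals\<close>

definition resid :: "nat \<Rightarrow> 'e \<Rightarrow> 'x \<Rightarrow> 'e" where
  "resid i x w = G i x w - mean_dir i x - G0 w"

lemma resid_integral:
  assumes i: "i \<ge> 1"
  shows "integrable N (\<lambda>w. (norm (resid i x w))\<^sup>2)"
    and "(\<integral>w. (norm (resid i x w))\<^sup>2 \<partial>N) \<le> C * ((norm x)\<^sup>2 + (incr i)\<^sup>2)"
    and "integrable N (resid i x)" and "(\<integral>w. resid i x w \<partial>N) = 0"
proof -
  note [measurable] = G0_measurable G_section[OF i]
  let ?Y = "\<lambda>w. G i x w - G0 w"
  have iG0: "integrable N G0"
    by (rule integrable_norm_squareD[OF N.finite_measure_axioms _ G0_square]) simp
  have EY: "(\<integral>w. ?Y w \<partial>N) = mean_dir i x"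
    using G_square(3)[OF i, of x] iG0 by (simp add: mean_dir_def G0_mean)
  have e: "resid i x w = ?Y w - (\<integral>w. ?Y w \<partial>N)" for w
    by (simp add: resid_def EY algebra_simps)
  show "(\<integral>w. (norm (resid i x w))\<^sup>2 \<partial>N) \<le> C * ((norm x)\<^sup>2 + (incr i)\<^sup>2)"
    unfolding e
    using N.norm_expectation_square_le(1)[of ?Y] noise_integral[OF i, of x]
    by simp (smt (verit) zero_le_power2)
  show "integrable N (\<lambda>w. (norm (resid i x w))\<^sup>2)"
    unfolding e using integrable_norm_square_add[of ?Y N "\<lambda>_. - (\<integral>w. ?Y w \<partial>N)"] noise_integral(1)[OF i, of x]
    by simp
  show "integrable N (resid i x)" "(\<integral>w. resid i x w \<partial>N) = 0"
    using G_square(3)[OF i, of x] iG0 by (simp_all add: resid_def[abs_def] mean_dir_def G0_mean N.prob_space)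
qed

lemma mean_dir_measurable [measurable]: "i \<ge> 1 \<Longrightarrow> mean_dir i \<in> borel_measurable borel"
  unfolding mean_dir_def[abs_def] using G_measurable[of i] by measurable

lemma resid_measurable: "i \<ge> 1 \<Longrightarrow> (\<lambda>(x, w). resid i x w) \<in> borel_measurable (borel \<Otimes>\<^sub>M N)"
  unfolding resid_def using G_measurable[of i] G0_measurable mean_dir_measurable[of i] by measurable

text \<open>The event depends only on the past up to \<open>i\<close>, and the residual is centred
  given that past, so the truncation preserves orthogonality.\<close>

definition R :: "nat \<Rightarrow> real \<Rightarrow> nat \<Rightarrow> 'a \<Rightarrow> 'e" where
  "R n0 e i \<omega> = indicator (good n0 e i) \<omega> *\<^sub>R resid (Suc i) (D i \<omega>) (W (Suc i) \<omega>)"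

lemma R_hist: "R n0 e i \<in> borel_measurable (hist (Suc i))"
proof -
  have [measurable]: "D i \<in> borel_measurable (hist (Suc i))"
    by (rule measurable_from_subalg[OF hist_mono D_hist]) simp
  have [measurable]: "W (Suc i) \<in> measurable (hist (Suc i)) N" by (rule W_hist) auto
  have [measurable]: "good n0 e i \<in> sets (hist (Suc i))"
    using good_hist[of n0 e i] hist_mono[of i "Suc i"] by (auto simp: subalgebra_def)
  note [measurable] = resid_measurable[of "Suc i", simplified]
  show ?thesis unfolding R_def[abs_def] by measurable
qed

lemma R_measurable [measurable]: "R n0 e i \<in> borel_measurable M"
  by (rule measurable_from_subalg[OF hist_subalgebra R_hist])

lemma R_square:
  shows "integrable M (\<lambda>\<omega>. (norm (R n0 e i \<omega>))\<^sup>2)"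
    and "expectation (\<lambda>\<omega>. (norm (R n0 e i \<omega>))\<^sup>2) \<le> C * (V n0 e i + (incr (Suc i))\<^sup>2)"
proof -
  note [measurable] = D_hist[of i] good_hist[of n0 e i] resid_measurable[of "Suc i", simplified]
  let ?I = "\<lambda>\<omega>. indicator (good n0 e i) \<omega> :: real"
  have i1: "integrable M (\<lambda>\<omega>. C * (?I \<omega> * (norm (D i \<omega>))\<^sup>2 + (incr (Suc i))\<^sup>2))"
    using good_D_integrable[of n0 e i i] by simp
  have "(\<integral>\<^sup>+\<omega>. ennreal ((norm (R n0 e i \<omega>))\<^sup>2) \<partial>M) =
     (\<integral>\<^sup>+\<omega>. (\<integral>\<^sup>+w. ennreal ((norm (?I \<omega> *\<^sub>R resid (Suc i) (D i \<omega>) w))\<^sup>2) \<partial>N) \<partial>M)"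
    unfolding R_def by (rule nn_integral_next) measurable
  also have "\<dots> \<le> (\<integral>\<^sup>+\<omega>. ennreal (C * (?I \<omega> * (norm (D i \<omega>))\<^sup>2 + (incr (Suc i))\<^sup>2)) \<partial>M)"
  proof (rule nn_integral_mono)
    fix \<omega>
    show "(\<integral>\<^sup>+w. ennreal ((norm (?I \<omega> *\<^sub>R resid (Suc i) (D i \<omega>) w))\<^sup>2) \<partial>N) \<le>
       ennreal (C * (?I \<omega> * (norm (D i \<omega>))\<^sup>2 + (incr (Suc i))\<^sup>2))"
      using resid_integral(1,2)[of "Suc i" "D i \<omega>"]
      by (cases "\<omega> \<in> good n0 e i") (auto simp: nn_integral_eq_integral intro!: ennreal_leI)
  qed
  also have "\<dots> = ennreal (C * (V n0 e i + (incr (Suc i))\<^sup>2))"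
    using i1 good_D_integrable[of n0 e i i] C_nonneg
    by (subst nn_integral_eq_integral) (auto simp: V_def prob_space)
  finally have b: "(\<integral>\<^sup>+\<omega>. ennreal ((norm (R n0 e i \<omega>))\<^sup>2) \<partial>M) \<le> ennreal (C * (V n0 e i + (incr (Suc i))\<^sup>2))" .
  show int: "integrable M (\<lambda>\<omega>. (norm (R n0 e i \<omega>))\<^sup>2)"
    by (rule integrableI_nonneg) (use b in \<open>auto intro: le_less_trans\<close>)
  show "expectation (\<lambda>\<omega>. (norm (R n0 e i \<omega>))\<^sup>2) \<le> C * (V n0 e i + (incr (Suc i))\<^sup>2)"
    using b C_nonneg V_nonneg[of n0 e i] by (subst (asm) nn_integral_eq_integral[OF int]) (auto simp: ennreal_le_iff)
qed

lemma R_sum_hist: "(\<lambda>\<omega>. \<Sum>i<n. R n0 e i \<omega>) \<in> borel_measurable (hist n)"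
proof (intro borel_measurable_sum)
  fix i assume "i \<in> {..<n}"
  then show "R n0 e i \<in> borel_measurable (hist n)"
    by (intro measurable_from_subalg[OF hist_mono R_hist]) simp
qed

text \<open>Integrating out the next observation makes each term orthogonal to the sum of its
  predecessors, so the variances add.\<close>

lemma R_sum_square:
  shows "integrable M (\<lambda>\<omega>. (norm (\<Sum>i<n. R n0 e i \<omega>))\<^sup>2)"
    and "expectation (\<lambda>\<omega>. (norm (\<Sum>i<n. R n0 e i \<omega>))\<^sup>2) \<le> (\<Sum>i<n. C * (V n0 e i + (incr (Suc i))\<^sup>2))"
proof (induction n)
  case (Suc n)
  let ?S = "\<lambda>\<omega>. \<Sum>i<n. R n0 e i \<omega>"
  have [measurable]: "?S \<in> borel_measurable M" by measurable
  have iI: "integrable M (\<lambda>\<omega>. ?S \<omega> \<bullet> R n0 e n \<omega>)"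
    by (intro integrable_inner_square Suc.IH R_square) auto
  have zero: "expectation (\<lambda>\<omega>. ?S \<omega> \<bullet> R n0 e n \<omega>) = 0"
  proof -
    note [measurable] = D_hist[of n] good_hist[of n0 e n] resid_measurable[of "Suc n", simplified] R_sum_hist[of n0 e n]
    let ?f = "\<lambda>\<omega> w. ?S \<omega> \<bullet> (indicator (good n0 e n) \<omega> *\<^sub>R resid (Suc n) (D n \<omega>) w)"
    have f: "(\<lambda>(\<omega>, w). ?f \<omega> w) \<in> borel_measurable (hist n \<Otimes>\<^sub>M N)" by measurable
    have "expectation (\<lambda>\<omega>. ?S \<omega> \<bullet> R n0 e n \<omega>) = (\<integral>\<omega>. (\<integral>w. ?f \<omega> w \<partial>N) \<partial>M)"
      using integral_next(2)[OF f] iI by (simp add: R_def)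
    also have "\<dots> = 0"
      using resid_integral(3,4)[of "Suc n"] by simp
    finally show ?thesis .
  qed
  have e: "(norm (\<Sum>i<Suc n. R n0 e i \<omega>))\<^sup>2 = (norm (?S \<omega>))\<^sup>2 + 2 * (?S \<omega> \<bullet> R n0 e n \<omega>) + (norm (R n0 e n \<omega>))\<^sup>2" for \<omega>
    by (simp add: power2_norm_eq_inner inner_add_left inner_add_right inner_commute)
  {
    case 1 show ?case unfolding e using Suc.IH(1) iI R_square(1)[of n0 e n] by simp
  next
    case 2
    have "expectation (\<lambda>\<omega>. (norm (\<Sum>i<Suc n. R n0 e i \<omega>))\<^sup>2) =
       expectation (\<lambda>\<omega>. (norm (?S \<omega>))\<^sup>2) + expectation (\<lambda>\<omega>. (norm (R n0 e n \<omega>))\<^sup>2)"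
      unfolding e using Suc.IH(1) iI R_square(1)[of n0 e n] zero by simp
    also have "\<dots> \<le> (\<Sum>i<n. C * (V n0 e i + (incr (Suc i))\<^sup>2)) + C * (V n0 e n + (incr (Suc n))\<^sup>2)"
      by (intro add_mono Suc.IH R_square)
    finally show ?case by simp
  }
qed simp_all

section \<open>The averaged recursion and its remainder\<close>

definition Y :: "nat \<Rightarrow> real \<Rightarrow> nat \<Rightarrow> 'a \<Rightarrow> real" where
  "Y n0 e k \<omega> = indicator (good n0 e k) \<omega> * norm (D k \<omega>)"

lemma Y_measurable [measurable]: "Y n0 e k \<in> borel_measurable M"
  unfolding Y_def[abs_def] by measurable

lemma Y_moments:
  shows "integrable M (\<lambda>\<omega>. (Y n0 e k \<omega>)\<^sup>2)" "expectation (\<lambda>\<omega>. (Y n0 e k \<omega>)\<^sup>2) = V n0 e k"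
    "integrable M (Y n0 e k)" "expectation (Y n0 e k) \<le> sqrt (V n0 e k)"
proof -
  have e: "(Y n0 e k \<omega>)\<^sup>2 = indicator (good n0 e k) \<omega> * (norm (D k \<omega>))\<^sup>2" for \<omega>
    by (simp add: Y_def indicator_def)
  show i: "integrable M (\<lambda>\<omega>. (Y n0 e k \<omega>)\<^sup>2)" and v: "expectation (\<lambda>\<omega>. (Y n0 e k \<omega>)\<^sup>2) = V n0 e k"
    unfolding e V_def by (auto intro: good_D_integrable)
  show "integrable M (Y n0 e k)"
    by (rule integrable_norm_squareD[OF finite_measure_axioms]) (use i in auto)
  have "(expectation (Y n0 e k))\<^sup>2 \<le> V n0 e k"
    using norm_expectation_square_le(2)[of "Y n0 e k"] i v by simp
  then show "expectation (Y n0 e k) \<le> sqrt (V n0 e k)" by (rule real_le_rsqrt)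
qed

text \<open>In order: the boundary and interior terms of a summation by parts, the bias and
  linearisation errors, the residuals, and the correction for summing from 1 to \<open>n\<close>
  instead of from 0 to \<open>n - 1\<close>.\<close>

definition rest :: "nat \<Rightarrow> 'a \<Rightarrow> 'e" where
  "rest n \<omega> = (1 / step 1) *\<^sub>R x0 - (1 / step (Suc n)) *\<^sub>R D n \<omega>
     + (\<Sum>i<n. (1 / step (Suc (Suc i)) - 1 / step (Suc i)) *\<^sub>R D (Suc i) \<omega>)
     - (\<Sum>i<n. mean_dir (Suc i) (D i \<omega>) - H (D i \<omega>))
     - (\<Sum>i<n. resid (Suc i) (D i \<omega>) (W (Suc i) \<omega>))
     + H (D n \<omega>) - H x0"

lemma step_pos: "i \<ge> 1 \<Longrightarrow> 0 < step i"
  using \<eta>0_pos by (simp add: step_def)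

text \<open>Dividing a step by its size returns the direction, which is the sum of
  \<open>H (D i \<omega>)\<close>, the error of its mean, the residual and \<open>G0\<close>.
  Summation by parts on the other side gives an identity that holds on every path.\<close>

lemma averaging_identity:
  "H (\<Sum>i=1..n. D i \<omega>) = rest n \<omega> - (\<Sum>i=1..n. G0 (W i \<omega>))"
proof -
  interpret H: bounded_linear H by (rule H_linear)
  have "(\<Sum>i<n. (1 / step (Suc i)) *\<^sub>R (D i \<omega> - D (Suc i) \<omega>)) = (\<Sum>i<n. G (Suc i) (D i \<omega>) (W (Suc i) \<omega>))"
    using step_pos by (intro sum.cong) (auto simp: less_imp_neq[THEN not_sym] D.simps(2))
  also have "\<dots> = (\<Sum>i<n. H (D i \<omega>)) + (\<Sum>i<n. mean_dir (Suc i) (D i \<omega>) - H (D i \<omega>))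
      + (\<Sum>i<n. resid (Suc i) (D i \<omega>) (W (Suc i) \<omega>)) + (\<Sum>i<n. G0 (W (Suc i) \<omega>))"
    by (simp add: sum.distrib[symmetric] resid_def)
  finally have 1: "(\<Sum>i<n. (1 / step (Suc i)) *\<^sub>R (D i \<omega> - D (Suc i) \<omega>)) = \<dots>" .
  have 2: "(\<Sum>i<n. (1 / step (Suc i)) *\<^sub>R (D i \<omega> - D (Suc i) \<omega>)) =
      (1 / step 1) *\<^sub>R x0 - (1 / step (Suc n)) *\<^sub>R D n \<omega>
     + (\<Sum>i<n. (1 / step (Suc (Suc i)) - 1 / step (Suc i)) *\<^sub>R D (Suc i) \<omega>)"
    using abel_summation[of "\<lambda>i. 1 / step (Suc i)" "\<lambda>i. D i \<omega>" n] by (simp del: D.simps add: D.simps(1))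
  have s: "(\<Sum>i=1..n. f i) = (\<Sum>i<n. f (Suc i))" for f :: "nat \<Rightarrow> 'e"
    by (simp add: sum.shift_bounds_cl_Suc_ivl[symmetric] sum.atLeast1_atMost_eq)
  have "(\<Sum>i<n. D (Suc i) \<omega>) = (\<Sum>i<n. D i \<omega>) + D n \<omega> - x0"
    by (induction n) (simp_all del: D.simps(2))
  then have "H (\<Sum>i=1..n. D i \<omega>) = (\<Sum>i<n. H (D i \<omega>)) + H (D n \<omega>) - H x0"
    unfolding s[of "\<lambda>i. D i \<omega>"] by (simp only: H.add H.diff H.sum)
  note 3 = this
  \<comment> \<open>The bare vector identity behind the claim, with every sum replaced by a
    variable.\<close>
  have 4: "Hs = (u - \<rho> - m + hd - hx) - z"
    if "l = sh + \<rho> + m + z" "l = u" "Hs = sh + hd - hx" for Hs l u sh \<rho> m z hd hx :: 'e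
    using that by simp
  show ?thesis
    unfolding rest_def s[of "\<lambda>i. G0 (W i \<omega>)"] by (rule 4[OF 1 2 3])
qed

lemma rest_measurable [measurable]: "rest n \<in> borel_measurable M"
proof -
  have [measurable]: "H \<in> borel_measurable borel"
    by (intro borel_measurable_continuous_onI linear_continuous_on H_linear)
  note [measurable] = resid_measurable[of "Suc _", simplified]
  have [measurable]: "W (Suc i) \<in> measurable M N" for i by (rule W_measurable) simp
  have [measurable]: "mean_dir (Suc i) \<in> borel_measurable borel" for i by (rule mean_dir_measurable) simp
  show ?thesis unfolding rest_def[abs_def] by measurable
qed

text \<open>This majorizes \<open>rest\<close> only on the good event, but its expectation is
  controlled on the whole space because the iterates and residuals enter through their truncations
  \<open>Y\<close> and \<open>R\<close>.\<close>

definition rest_bound :: "nat \<Rightarrow> real \<Rightarrow> nat \<Rightarrow> 'a \<Rightarrow> real" where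
  "rest_bound n0 e n \<omega> = norm x0 / step 1 + Y n0 e n \<omega> / step (Suc n)
     + (\<Sum>i<n. (1 / step (Suc (Suc i)) - 1 / step (Suc i)) * Y n0 e (Suc i) \<omega>)
     + (\<Sum>i<n. C * incr (Suc i) + C * (Y n0 e i \<omega>)\<^sup>2)
     + norm (\<Sum>i<n. R n0 e i \<omega>)
     + onorm H * Y n0 e n \<omega> + onorm H * norm x0"

lemma step_antimono: "1 / step (Suc i) \<le> 1 / step (Suc (Suc i))"
  using \<eta>0_pos \<alpha> by (auto simp: step_def divide_simps powr_minus intro!: powr_mono2)

lemma rest_le:
  assumes \<omega>: "\<omega> \<in> good n0 e n"
  shows "norm (rest n \<omega>) \<le> rest_bound n0 e n \<omega>"
proof -
  have g: "\<omega> \<in> good n0 e i" if "i \<le> n" for i using good_antimono[OF that] \<omega> by blast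
  have Y: "Y n0 e i \<omega> = norm (D i \<omega>)" if "i \<le> n" for i using g[OF that] by (simp add: Y_def)
  have R: "R n0 e i \<omega> = resid (Suc i) (D i \<omega>) (W (Suc i) \<omega>)" if "i < n" for i
    using g[of i] that by (simp add: R_def)
  have tri: "norm (a - b + c - d - f + p - q) \<le> norm a + norm b + norm c + norm d + norm f + norm p + norm q"
    for a b c d f p q :: 'e
    by norm
  have 1: "norm (\<Sum>i<n. (1 / step (Suc (Suc i)) - 1 / step (Suc i)) *\<^sub>R D (Suc i) \<omega>)
     \<le> (\<Sum>i<n. (1 / step (Suc (Suc i)) - 1 / step (Suc i)) * Y n0 e (Suc i) \<omega>)"
    using step_antimono by (intro sum_norm_le) (auto simp: Y simp del: D.simps)
  have 2: "norm (\<Sum>i<n. mean_dir (Suc i) (D i \<omega>) - H (D i \<omega>)) \<le> (\<Sum>i<n. C * incr (Suc i) + C * (Y n0 e i \<omega>)\<^sup>2)"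
  proof (intro sum_norm_le)
    fix i assume "i \<in> {..<n}"
    then have y: "Y n0 e i \<omega> = norm (D i \<omega>)" by (intro Y) simp
    have "norm (mean_dir (Suc i) (D i \<omega>) - H (D i \<omega>)) \<le> norm (mean_dir (Suc i) (D i \<omega>) - g (D i \<omega>)) + norm (g (D i \<omega>) - H (D i \<omega>))"
      using norm_triangle_ineq[of "mean_dir (Suc i) (D i \<omega>) - g (D i \<omega>)" "g (D i \<omega>) - H (D i \<omega>)"] by simp
    also have "\<dots> \<le> C * incr (Suc i) + C * (norm (D i \<omega>))\<^sup>2"
      by (intro add_mono mean_dir_bias g_linearization) simp
    finally show "norm (mean_dir (Suc i) (D i \<omega>) - H (D i \<omega>)) \<le> C * incr (Suc i) + C * (Y n0 e i \<omega>)\<^sup>2"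
      by (simp add: y)
  qed
  have 3: "(\<Sum>i<n. resid (Suc i) (D i \<omega>) (W (Suc i) \<omega>)) = (\<Sum>i<n. R n0 e i \<omega>)"
    by (intro sum.cong) (auto simp: R)
  have 4: "norm (H (D n \<omega>)) \<le> onorm H * Y n0 e n \<omega>" "norm (H x0) \<le> onorm H * norm x0"
    using onorm[OF H_linear] by (auto simp: Y)
  have 5: "norm ((1 / step 1) *\<^sub>R x0) = norm x0 / step 1" "norm ((1 / step (Suc n)) *\<^sub>R D n \<omega>) = Y n0 e n \<omega> / step (Suc n)"
    using step_nonneg by (auto simp: Y)
  show ?thesis
    unfolding rest_def rest_bound_def
    by (rule order_trans[OF tri]) (intro add_mono 1 2 4 eq_refl 5, simp only: 3)
qed

text \<open>First moments are bounded by roots of second moments; for the residual sum the second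
  moment is additive by orthogonality.\<close>

lemma rest_bound_expectation:
  shows "integrable M (rest_bound n0 e n)"
    and "expectation (rest_bound n0 e n) \<le> norm x0 / step 1 + sqrt (V n0 e n) / step (Suc n)
     + (\<Sum>i<n. (1 / step (Suc (Suc i)) - 1 / step (Suc i)) * sqrt (V n0 e (Suc i)))
     + (\<Sum>i<n. C * incr (Suc i) + C * V n0 e i)
     + sqrt (\<Sum>i<n. C * (V n0 e i + (incr (Suc i))\<^sup>2))
     + onorm H * sqrt (V n0 e n) + onorm H * norm x0"
proof -
  let ?S = "\<lambda>\<omega>. norm (\<Sum>i<n. R n0 e i \<omega>)"
  have iS: "integrable M ?S"
    by (rule integrable_norm[OF integrable_norm_squareD[OF finite_measure_axioms _ R_sum_square(1)]]) simp
  show "integrable M (rest_bound n0 e n)"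
    unfolding rest_bound_def[abs_def] using iS Y_moments(1,3) by simp
  have "(expectation ?S)\<^sup>2 \<le> expectation (\<lambda>\<omega>. (?S \<omega>)\<^sup>2)"
    using norm_expectation_square_le(2)[of ?S] R_sum_square(1)[of n0 e n] by simp
  also have "\<dots> \<le> (\<Sum>i<n. C * (V n0 e i + (incr (Suc i))\<^sup>2))" by (rule R_sum_square)
  finally have S: "expectation ?S \<le> sqrt (\<Sum>i<n. C * (V n0 e i + (incr (Suc i))\<^sup>2))" by (rule real_le_rsqrt)
  have "expectation (rest_bound n0 e n) = norm x0 / step 1 + expectation (Y n0 e n) / step (Suc n)
     + (\<Sum>i<n. (1 / step (Suc (Suc i)) - 1 / step (Suc i)) * expectation (Y n0 e (Suc i)))
     + (\<Sum>i<n. C * incr (Suc i) + C * V n0 e i)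
     + expectation ?S
     + onorm H * expectation (Y n0 e n) + onorm H * norm x0"
    unfolding rest_bound_def[abs_def] using iS Y_moments(1,3) by (simp add: Y_moments(2) prob_space)
  also have "\<dots> \<le> norm x0 / step 1 + sqrt (V n0 e n) / step (Suc n)
     + (\<Sum>i<n. (1 / step (Suc (Suc i)) - 1 / step (Suc i)) * sqrt (V n0 e (Suc i)))
     + (\<Sum>i<n. C * incr (Suc i) + C * V n0 e i)
     + sqrt (\<Sum>i<n. C * (V n0 e i + (incr (Suc i))\<^sup>2))
     + onorm H * sqrt (V n0 e n) + onorm H * norm x0"
    using S Y_moments(4) step_nonneg step_antimono onorm_pos_le[OF H_linear]
    by (intro add_mono order_refl divide_right_mono sum_mono mult_left_mono) auto
  finally show "expectation (rest_bound n0 e n) \<le> norm x0 / step 1 + sqrt (V n0 e n) / step (Suc n)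
     + (\<Sum>i<n. (1 / step (Suc (Suc i)) - 1 / step (Suc i)) * sqrt (V n0 e (Suc i)))
     + (\<Sum>i<n. C * incr (Suc i) + C * V n0 e i)
     + sqrt (\<Sum>i<n. C * (V n0 e i + (incr (Suc i))\<^sup>2))
     + onorm H * sqrt (V n0 e n) + onorm H * norm x0" .
qed

end

text \<open>The factor \<open>sqrt 2\<close> in the proof pays for comparing \<open>Suc n\<close>
  with \<open>n\<close>.\<close>

lemma shifted_power_over_sqrt:
  assumes "0 < \<alpha>" "\<alpha> < 1"
  shows "(\<lambda>n. real (Suc n) powr (\<alpha> / 2) / sqrt (real n)) \<longlonglongrightarrow> 0"
proof (rule tendsto_sandwich[of "\<lambda>_. 0"])
  have "(\<lambda>n. sqrt 2 * real (Suc n) powr ((\<alpha> - 1) / 2)) \<longlonglongrightarrow> sqrt 2 * 0"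
    using assms by (intro tendsto_mult_left LIMSEQ_Suc tendsto_neg_powr filterlim_real_sequentially) auto
  then show "(\<lambda>n. sqrt 2 * real (Suc n) powr ((\<alpha> - 1) / 2)) \<longlonglongrightarrow> 0" by simp
  have "real (Suc n) powr (\<alpha> / 2) / sqrt (real n) \<le> sqrt 2 * real (Suc n) powr ((\<alpha> - 1) / 2)" if "n \<ge> 1" for n
  proof -
    have "sqrt (real (Suc n)) \<le> sqrt (2 * real n)" using that by (intro real_sqrt_le_mono) auto
    then have "sqrt (real (Suc n)) \<le> sqrt 2 * sqrt (real n)" by (simp add: real_sqrt_mult)
    moreover have "real (Suc n) powr (\<alpha> / 2) = sqrt (real (Suc n)) * real (Suc n) powr ((\<alpha> - 1) / 2)"
    proof -
      have "1 / 2 + (\<alpha> - 1) / 2 = \<alpha> / 2" by (simp add: field_simps)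
      then show ?thesis
        using powr_add[of "real (Suc n)" "1 / 2" "(\<alpha> - 1) / 2"] powr_half_sqrt[of "real (Suc n)"]
        by (simp only: of_nat_0_le_iff simp_thms)
    qed
    ultimately have "real (Suc n) powr (\<alpha> / 2) \<le> (sqrt 2 * sqrt (real n)) * real (Suc n) powr ((\<alpha> - 1) / 2)"
      by (simp only:) (rule mult_right_mono, simp_all)
    also have "\<dots> = (sqrt 2 * real (Suc n) powr ((\<alpha> - 1) / 2)) * sqrt (real n)"
      by (simp only: mult_ac)
    finally show ?thesis using that by (subst pos_divide_le_eq) auto
  qed
  then show "\<forall>\<^sub>F n in sequentially. real (Suc n) powr (\<alpha> / 2) / sqrt (real n) \<le> sqrt 2 * real (Suc n) powr ((\<alpha> - 1) / 2)"
    by (rule eventually_mono[OF eventually_ge_at_top[of 1]])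
qed auto

context stochastic_approximation
begin

lemma rest_bound_nonneg: "0 \<le> rest_bound n0 e n \<omega>"
  unfolding rest_bound_def using step_nonneg step_antimono onorm_pos_le[OF H_linear] C_nonneg incr_nonneg
  by (auto intro!: add_nonneg_nonneg sum_nonneg mult_nonneg_nonneg divide_nonneg_nonneg simp: Y_def)

lemma rest_bound_limit: "(\<lambda>n. expectation (rest_bound n0 e n) / sqrt (real n)) \<longlonglongrightarrow> 0"
proof -
  obtain K where K: "K \<ge> 0" "\<And>k. V n0 e k \<le> K * real (Suc k) powr (- \<alpha>)" using V_rate by blast
  define q where "q = onorm H"
  have q: "0 \<le> q" unfolding q_def by (rule onorm_pos_le[OF H_linear])
  define P where "P = (\<lambda>p n. \<Sum>i<n. real (Suc i) powr (- p))"
  have Plim: "(\<lambda>n. P p n / sqrt (real n)) \<longlonglongrightarrow> 0" if "1/2 < p" "p < 1" for p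
    using sum_powr_over_sqrt[OF that] by (simp add: P_def sum.atLeast1_atMost_eq)
  have P0: "0 \<le> P p n" for p n by (auto simp: P_def intro!: sum_nonneg)
  define a where "a = (\<lambda>n. real (Suc n) powr (\<alpha> / 2))"
  have sV: "sqrt (V n0 e k) \<le> sqrt K * real (Suc k) powr (- \<alpha> / 2)" for k
  proof -
    have "sqrt (V n0 e k) \<le> sqrt (K * real (Suc k) powr (- \<alpha>))" by (intro real_sqrt_le_mono K)
    also have "\<dots> = sqrt K * real (Suc k) powr (- \<alpha> / 2)"
      by (simp add: real_sqrt_mult powr_half_sqrt[symmetric] powr_powr)
    finally show ?thesis .
  qed
  have rstep: "1 / step (Suc k) = real (Suc k) powr \<alpha> / \<eta>0" for k
    by (simp add: step_def powr_minus field_simps)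
  have t2: "sqrt (V n0 e n) / step (Suc n) \<le> sqrt K / \<eta>0 * a n" for n
  proof -
    have "sqrt (V n0 e n) * (1 / step (Suc n)) \<le> (sqrt K * real (Suc n) powr (- \<alpha> / 2)) * (1 / step (Suc n))"
      using step_nonneg by (intro mult_right_mono sV) auto
    also have "\<dots> = sqrt K / \<eta>0 * (real (Suc n) powr (- \<alpha> / 2) * real (Suc n) powr \<alpha>)"
      by (simp only: rstep) (simp add: field_simps)
    also have "\<dots> = sqrt K / \<eta>0 * a n"
      unfolding powr_add[symmetric] a_def by simp
    finally show ?thesis by simp
  qed
  have t3: "(\<Sum>i<n. (1 / step (Suc (Suc i)) - 1 / step (Suc i)) * sqrt (V n0 e (Suc i))) \<le> 2 * (sqrt K / \<eta>0) * a n" for n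
  proof -
    have "(\<Sum>i<n. (1 / step (Suc (Suc i)) - 1 / step (Suc i)) * sqrt (V n0 e (Suc i))) \<le>
      (\<Sum>i<n. (1 / step (Suc (Suc i)) - 1 / step (Suc i)) * (sqrt K * real (Suc (Suc i)) powr (- \<alpha> / 2)))"
      using step_antimono by (intro sum_mono mult_left_mono sV) auto
    also have "\<dots> = sqrt K / \<eta>0 * (\<Sum>i<n. (real (Suc (Suc i)) powr \<alpha> - real (Suc i) powr \<alpha>) * real (Suc (Suc i)) powr (- \<alpha> / 2))"
      unfolding rstep sum_distrib_left by (intro sum.cong refl) (simp add: diff_divide_distrib[symmetric])
    also have "\<dots> \<le> sqrt K / \<eta>0 * (2 * real (Suc n) powr (\<alpha> / 2))"
      using K \<eta>0_pos \<alpha> by (intro mult_left_mono sum_sqrt_increment) auto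
    finally show ?thesis by (simp add: a_def mult.assoc mult.left_commute)
  qed
  have t4: "(\<Sum>i<n. C * incr (Suc i) + C * V n0 e i) \<le> C * h0 * P \<gamma> n + C * K * P \<alpha> n" for n
  proof -
    have "(\<Sum>i<n. C * incr (Suc i) + C * V n0 e i) \<le> (\<Sum>i<n. C * (h0 * real (Suc i) powr (- \<gamma>)) + C * (K * real (Suc i) powr (- \<alpha>)))"
      using C_nonneg K by (intro sum_mono add_mono mult_left_mono) (auto simp: incr_def)
    also have "\<dots> = C * h0 * P \<gamma> n + C * K * P \<alpha> n"
      by (simp add: P_def sum.distrib sum_distrib_left mult.assoc)
    finally show ?thesis .
  qed
  have t5: "sqrt (\<Sum>i<n. C * (V n0 e i + (incr (Suc i))\<^sup>2)) \<le> sqrt (C * (K + h0\<^sup>2) * P \<alpha> n)" for n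
  proof (rule real_sqrt_le_mono)
    have "(\<Sum>i<n. C * (V n0 e i + (incr (Suc i))\<^sup>2)) \<le> (\<Sum>i<n. C * (K * real (Suc i) powr (- \<alpha>) + h0\<^sup>2 * real (Suc i) powr (- \<alpha>)))"
      using C_nonneg K(2) incr_square_le by (intro sum_mono add_mono mult_left_mono) (auto simp del: of_nat_Suc)
    also have "\<dots> = C * (K + h0\<^sup>2) * P \<alpha> n"
      by (simp add: P_def sum_distrib_left algebra_simps)
    finally show "(\<Sum>i<n. C * (V n0 e i + (incr (Suc i))\<^sup>2)) \<le> C * (K + h0\<^sup>2) * P \<alpha> n" .
  qed
  have t6: "q * sqrt (V n0 e n) \<le> q * sqrt K" for n
  proof (rule mult_left_mono[OF _ q])
    have "sqrt K * real (Suc n) powr (- \<alpha> / 2) \<le> sqrt K * real (Suc n) powr 0"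
      using K \<alpha> by (intro mult_left_mono powr_mono) auto
    then have "sqrt K * real (Suc n) powr (- \<alpha> / 2) \<le> sqrt K" by simp
    then show "sqrt (V n0 e n) \<le> sqrt K" using sV[of n] by linarith
  qed
  define c where "c = norm x0 / step 1 + q * sqrt K + q * norm x0"
  \<comment> \<open>One multiple of \<open>a n\<close> comes from the boundary term and two from the
    interior term of the summation by parts, hence the factor 3.\<close>
  define U where "U = (\<lambda>n. c / sqrt (real n) + 3 * (sqrt K / \<eta>0) * (a n / sqrt (real n))
      + C * h0 * (P \<gamma> n / sqrt (real n)) + C * K * (P \<alpha> n / sqrt (real n))
      + sqrt (C * (K + h0\<^sup>2) * ((P \<alpha> n / sqrt (real n)) * (1 / sqrt (real n)))))"
  have le: "expectation (rest_bound n0 e n) / sqrt (real n) \<le> U n" for n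
  proof -
    have "expectation (rest_bound n0 e n) \<le> c + 3 * (sqrt K / \<eta>0) * a n + C * h0 * P \<gamma> n + C * K * P \<alpha> n + sqrt (C * (K + h0\<^sup>2) * P \<alpha> n)"
      using rest_bound_expectation(2)[of n0 e n] t2[of n] t3[of n] t4[of n] t5[of n] t6[of n]
      unfolding q_def[symmetric] c_def by linarith
    then have "expectation (rest_bound n0 e n) / sqrt (real n) \<le> (c + 3 * (sqrt K / \<eta>0) * a n + C * h0 * P \<gamma> n + C * K * P \<alpha> n + sqrt (C * (K + h0\<^sup>2) * P \<alpha> n)) / sqrt (real n)"
      by (intro divide_right_mono) auto
    also have "\<dots> = U n"
      by (simp add: U_def add_divide_distrib real_sqrt_mult real_sqrt_divide)
    finally show ?thesis .
  qed
  have inv: "(\<lambda>n. 1 / sqrt (real n)) \<longlonglongrightarrow> 0"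
    by (intro real_tendsto_divide_at_top[OF tendsto_const] filterlim_compose[OF sqrt_at_top filterlim_real_sequentially])
  have "(\<lambda>n. c / sqrt (real n)) \<longlonglongrightarrow> 0"
    using tendsto_mult_left[OF inv, of c] by simp
  moreover have "(\<lambda>n. a n / sqrt (real n)) \<longlonglongrightarrow> 0"
    unfolding a_def using \<alpha> by (intro shifted_power_over_sqrt) auto
  ultimately have "U \<longlonglongrightarrow> 0 + 3 * (sqrt K / \<eta>0) * 0 + C * h0 * 0 + C * K * 0 + sqrt (C * (K + h0\<^sup>2) * (0 * 0))"
    unfolding U_def using \<alpha> \<gamma> by (intro tendsto_add tendsto_mult_left tendsto_real_sqrt tendsto_mult inv Plim) auto
  then have U: "U \<longlonglongrightarrow> 0" by simp
  show ?thesis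
    by (rule tendsto_sandwich[of "\<lambda>_. 0" _ _ U])
       (use le U rest_bound_nonneg in \<open>auto intro!: always_eventually divide_nonneg_nonneg Bochner_Integration.integral_nonneg\<close>)
qed

text \<open>Convergence in probability, metrised by \<open>min 1\<close>. Off the good event the
  integrand is at most 1; on it the integrand is at most the majorant, whose expectation is small
  compared with \<open>sqrt n\<close>.\<close>

theorem rest_negligible:
  "(\<lambda>n. expectation (\<lambda>\<omega>. min 1 (norm (rest n \<omega>) / sqrt (real n)))) \<longlonglongrightarrow> 0"
proof (rule LIMSEQ_I)
  fix d :: real assume d: "0 < d"
  obtain n0 e where bad: "\<And>k. prob (space M - good n0 e k) \<le> d / 2"
    using good_exists[of "d / 2"] d by auto
  have "eventually (\<lambda>n. expectation (rest_bound n0 e n) / sqrt (real n) < d / 2) sequentially"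
    using d by (intro order_tendstoD(2)[OF rest_bound_limit]) simp
  then obtain n1 where n1: "\<And>n. n \<ge> n1 \<Longrightarrow> expectation (rest_bound n0 e n) / sqrt (real n) < d / 2"
    by (auto simp: eventually_sequentially)
  have "expectation (\<lambda>\<omega>. min 1 (norm (rest n \<omega>) / sqrt (real n))) < d" if n: "n \<ge> n1" for n
  proof -
    have im: "integrable M (\<lambda>\<omega>. min 1 (norm (rest n \<omega>) / sqrt (real n)))"
      by (rule integrable_const_bound[of _ 1]) auto
    have iI: "integrable M (indicator (space M - good n0 e n) :: 'a \<Rightarrow> real)"
      by (rule integrable_const_bound[of _ 1]) auto
    have "expectation (\<lambda>\<omega>. min 1 (norm (rest n \<omega>) / sqrt (real n))) \<le>
       expectation (\<lambda>\<omega>. indicator (space M - good n0 e n) \<omega> + rest_bound n0 e n \<omega> / sqrt (real n))"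
    proof (rule integral_mono[OF im])
      show "integrable M (\<lambda>\<omega>. indicator (space M - good n0 e n) \<omega> + rest_bound n0 e n \<omega> / sqrt (real n))"
        using iI rest_bound_expectation(1) by simp
      fix \<omega> assume \<omega>: "\<omega> \<in> space M"
      show "min 1 (norm (rest n \<omega>) / sqrt (real n)) \<le> indicator (space M - good n0 e n) \<omega> + rest_bound n0 e n \<omega> / sqrt (real n)"
      proof (cases "\<omega> \<in> good n0 e n")
        case True
        then show ?thesis using divide_right_mono[OF rest_le[OF True], of "sqrt (real n)"] by simp
      next
        case False
        then show ?thesis using \<omega> rest_bound_nonneg[of n0 e n \<omega>] by (simp add: min_le_iff_disj)
      qed
    qed
    also have "\<dots> = prob (space M - good n0 e n) + expectation (rest_bound n0 e n) / sqrt (real n)"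
      using iI rest_bound_expectation(1)[of n0 e n] by (simp add: Int_absorb2)
    also have "\<dots> < d" using bad[of n] n1[OF n] by linarith
    finally show ?thesis .
  qed
  moreover have "0 \<le> expectation (\<lambda>\<omega>. min 1 (norm (rest n \<omega>) / sqrt (real n)))" for n
    by (intro Bochner_Integration.integral_nonneg) auto
  ultimately show "\<exists>no. \<forall>n\<ge>no. norm (expectation (\<lambda>\<omega>. min 1 (norm (rest n \<omega>) / sqrt (real n))) - 0) < d"
    by auto
qed

end

text \<open>The exponential is Lipschitz and bounded: \<open>c\<close> serves when
  \<open>y \<le> 1\<close> and 2 when \<open>y > 1\<close>. The bound is thus in terms of the
  \<open>min 1\<close> distance of \<open>rest_negligible\<close>.\<close>

lemma iexp_diff_le: "cmod (iexp a - iexp b) \<le> (2 + c) * min 1 y"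
  if "\<bar>a - b\<bar> \<le> c * y" "0 \<le> c" "0 \<le> y"
proof -
  have "iexp a - iexp b = iexp b * (iexp (a - b) - 1)"
    by (simp add: right_diff_distrib exp_add[symmetric])
  then have e: "cmod (iexp a - iexp b) = cmod (iexp (a - b) - 1)" by (simp add: norm_mult)
  have "cmod (iexp (a - b) - 1) \<le> \<bar>a - b\<bar>"
    using iexp_approx1[of "a - b" 0] by simp
  moreover have "cmod (iexp (a - b) - 1) \<le> 2"
    using norm_triangle_ineq4[of "iexp (a - b)" 1] by simp
  ultimately show ?thesis
    using that e by (cases "y \<le> 1") (auto simp: distrib_right min_def)
qed

context stochastic_approximation
begin

section \<open>Limit law and tightness of the scaled average\<close>

lemma G0_W_square:
  assumes "i \<ge> 1"
  shows "integrable M (\<lambda>\<omega>. (norm (G0 (W i \<omega>)))\<^sup>2)"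
    and "expectation (\<lambda>\<omega>. (norm (G0 (W i \<omega>)))\<^sup>2) = (\<integral>w. (norm (G0 w))\<^sup>2 \<partial>N)"
proof -
  note [measurable] = G0_measurable
  have i: "integrable (distr M N (W i)) (\<lambda>w. (norm (G0 w))\<^sup>2)"
    using assms G0_square by (simp add: W_distr)
  then show "integrable M (\<lambda>\<omega>. (norm (G0 (W i \<omega>)))\<^sup>2)"
    using assms by (subst (asm) integrable_distr_eq) (auto intro: W_measurable)
  show "expectation (\<lambda>\<omega>. (norm (G0 (W i \<omega>)))\<^sup>2) = (\<integral>w. (norm (G0 w))\<^sup>2 \<partial>N)"
    using assms by (subst W_distr[OF assms, symmetric], subst integral_distr) (auto intro: W_measurable)
qed

lemma G0_W_measurable [measurable]: "i \<ge> 1 \<Longrightarrow> (\<lambda>\<omega>. G0 (W i \<omega>)) \<in> borel_measurable M"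
  by (rule measurable_compose[OF W_measurable G0_measurable])

lemma G0_sum_square:
  shows "integrable M (\<lambda>\<omega>. (norm (\<Sum>i<n. G0 (W (Suc i) \<omega>)))\<^sup>2)"
    and "expectation (\<lambda>\<omega>. (norm (\<Sum>i<n. G0 (W (Suc i) \<omega>)))\<^sup>2) = real n * (\<integral>w. (norm (G0 w))\<^sup>2 \<partial>N)"
proof (induction n)
  case (Suc n)
  note [measurable] = G0_measurable
  let ?S = "\<lambda>\<omega>. \<Sum>i<n. G0 (W (Suc i) \<omega>)"
  have Sh[measurable]: "?S \<in> borel_measurable (hist n)"
  proof (intro borel_measurable_sum)
    fix i assume "i \<in> {..<n}"
    then have [measurable]: "W (Suc i) \<in> measurable (hist n) N" by (intro W_hist) auto
    show "(\<lambda>\<omega>. G0 (W (Suc i) \<omega>)) \<in> borel_measurable (hist n)" by measurable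
  qed
  have Sm: "?S \<in> borel_measurable M" by (rule measurable_from_subalg[OF hist_subalgebra Sh])
  have iI: "integrable M (\<lambda>\<omega>. ?S \<omega> \<bullet> G0 (W (Suc n) \<omega>))"
    by (intro integrable_inner_square Suc.IH G0_W_square Sm) auto
  have iG0: "integrable N G0"
    by (rule integrable_norm_squareD[OF N.finite_measure_axioms _ G0_square]) simp
  have f: "(\<lambda>(\<omega>, w). ?S \<omega> \<bullet> G0 w) \<in> borel_measurable (hist n \<Otimes>\<^sub>M N)" by measurable
  have zero: "expectation (\<lambda>\<omega>. ?S \<omega> \<bullet> G0 (W (Suc n) \<omega>)) = 0"
    using integral_next(2)[OF f] iI iG0 G0_mean by simp
  have e: "(norm (\<Sum>i<Suc n. G0 (W (Suc i) \<omega>)))\<^sup>2 = (norm (?S \<omega>))\<^sup>2 + 2 * (?S \<omega> \<bullet> G0 (W (Suc n) \<omega>)) + (norm (G0 (W (Suc n) \<omega>)))\<^sup>2" for \<omega>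
    by (simp add: power2_norm_eq_inner inner_add_left inner_add_right inner_commute)
  {
    case 1 show ?case unfolding e using Suc.IH(1) iI G0_W_square(1)[of "Suc n"] by simp
  next
    case 2 show ?case
      unfolding e using Suc.IH iI G0_W_square[of "Suc n"] zero by (simp add: distrib_right)
  }
qed simp_all

definition scaled_average :: "nat \<Rightarrow> 'a \<Rightarrow> 'e" where
  "scaled_average n \<omega> = sqrt (real n) *\<^sub>R ((1 / real n) *\<^sub>R (\<Sum>i=1..n. D i \<omega>))"

lemma scaled_average_measurable [measurable]: "scaled_average n \<in> borel_measurable M"
  unfolding scaled_average_def[abs_def] by measurable

lemma scaled_average_eq:
  assumes J: "bounded_linear J" and JH: "\<And>x. J (H x) = x"
  shows "scaled_average n \<omega> = J ((1 / sqrt (real n)) *\<^sub>R rest n \<omega>) - J ((1 / sqrt (real n)) *\<^sub>R (\<Sum>i<n. G0 (W (Suc i) \<omega>)))"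
proof -
  interpret J: bounded_linear J by (rule J)
  \<comment> \<open>For \<open>n = 0\<close> both sides are zero, by the convention for division by
    zero.\<close>
  have s: "sqrt (real n) * (1 / real n) = 1 / sqrt (real n)"
    by (cases "n = 0") (simp_all add: divide_simps)
  have g: "(\<Sum>i=1..n. G0 (W i \<omega>)) = (\<Sum>i<n. G0 (W (Suc i) \<omega>))"
    by (simp add: sum.atLeast1_atMost_eq)
  have "scaled_average n \<omega> = (1 / sqrt (real n)) *\<^sub>R (\<Sum>i=1..n. D i \<omega>)"
    unfolding scaled_average_def by (simp only: scaleR_scaleR s)
  also have "(\<Sum>i=1..n. D i \<omega>) = J (H (\<Sum>i=1..n. D i \<omega>))" by (simp only: JH)
  also have "\<dots> = J (rest n \<omega>) - J (\<Sum>i<n. G0 (W (Suc i) \<omega>))"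
    unfolding averaging_identity g by (rule J.diff)
  finally show ?thesis by (simp add: J.scaleR scaleR_diff_right)
qed

text \<open>\<open>J\<close> undoes \<open>H\<close> in the averaging identity, after which the
  phase differs from that of a normalised i.i.d. sum only by a linear image of
  \<open>rest\<close>.\<close>

theorem scaled_average_char:
  assumes J: "bounded_linear J" and JH: "\<And>x. J (H x) = x"
  shows "(\<lambda>n. expectation (\<lambda>\<omega>. iexp (t \<bullet> scaled_average n \<omega>)))
     \<longlonglongrightarrow> of_real (exp (- (\<integral>w. (t \<bullet> J (G0 w))\<^sup>2 \<partial>N) / 2))"
proof -
  interpret J: bounded_linear J by (rule J)
  note [measurable] = G0_measurable
  have Jm[measurable]: "J \<in> borel_measurable borel"
    by (intro borel_measurable_continuous_onI linear_continuous_on J)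
  \<comment> \<open>The sign is that of the \<open>G0\<close> sum in
    \<open>averaging_identity\<close>; the shift by one moves the index set from
    \<open>{1..}\<close> to all natural numbers.\<close>
  define X where "X = (\<lambda>i \<omega>. - (t \<bullet> J (G0 (W (Suc i) \<omega>))))"
  have indep: "indep_vars (\<lambda>_. borel) X UNIV"
  proof -
    have "indep_vars (\<lambda>i. PiM {Suc i} (\<lambda>_. N)) (\<lambda>i \<omega>. \<lambda>j\<in>{Suc i}. W j \<omega>) UNIV"
      by (rule indep_vars_restrict[OF W_indep]) (auto simp: disjoint_family_on_def)
    then have "indep_vars (\<lambda>_. borel) (\<lambda>i \<omega>. (\<lambda>u. - (t \<bullet> J (G0 (u (Suc i))))) (\<lambda>j\<in>{Suc i}. W j \<omega>)) UNIV"
      by (rule indep_vars_compose2) measurable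
    then show ?thesis by (simp add: X_def)
  qed
  have bound: "(t \<bullet> J x)\<^sup>2 \<le> (norm t * onorm J)\<^sup>2 * (norm x)\<^sup>2" for x
  proof -
    have "\<bar>t \<bullet> J x\<bar> \<le> norm t * norm (J x)" by (rule Cauchy_Schwarz_ineq2)
    also have "\<dots> \<le> norm t * (onorm J * norm x)" by (intro mult_left_mono onorm J) simp
    finally have "\<bar>t \<bullet> J x\<bar> \<le> norm t * onorm J * norm x" by (simp add: mult.assoc)
    then have "\<bar>t \<bullet> J x\<bar>\<^sup>2 \<le> (norm t * onorm J * norm x)\<^sup>2" by (intro power_mono) auto
    then show ?thesis by (simp add: power_mult_distrib)
  qed
  have sqN: "integrable N (\<lambda>w. (t \<bullet> J (G0 w))\<^sup>2)"
    by (rule Bochner_Integration.integrable_bound[OF integrable_mult_right[OF G0_square, of "(norm t * onorm J)\<^sup>2"]])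
       (use bound in \<open>auto\<close>)
  have distrX: "distr M borel (X n) = distr N borel (\<lambda>w. - (t \<bullet> J (G0 w)))" for n
  proof -
    have "distr N borel (\<lambda>w. - (t \<bullet> J (G0 w))) = distr (distr M N (W (Suc n))) borel (\<lambda>w. - (t \<bullet> J (G0 w)))"
      by (simp add: W_distr)
    also have "\<dots> = distr M borel (X n)"
      by (subst distr_distr) (auto simp: X_def comp_def intro!: W_measurable)
    finally show ?thesis by simp
  qed
  have Wm: "W (Suc n) \<in> measurable M N" for n by (rule W_measurable) simp
  have trans: "expectation (\<lambda>\<omega>. k (W (Suc n) \<omega>)) = (\<integral>w. k w \<partial>N)" if "k \<in> borel_measurable N" for k :: "'x \<Rightarrow> real" and n
    using integral_distr[OF Wm, of k n] that W_distr[of "Suc n"] by simp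
  have iG0: "integrable N G0"
    by (rule integrable_norm_squareD[OF N.finite_measure_axioms _ G0_square]) simp
  have "(\<lambda>n. expectation (\<lambda>\<omega>. iexp ((\<Sum>i<n. X i \<omega>) / sqrt (real n))))
      \<longlonglongrightarrow> of_real (exp (- (\<integral>w. (t \<bullet> J (G0 w))\<^sup>2 \<partial>N) / 2))"
  proof (rule iid_char_limit[OF indep distrX])
    fix n
    show "integrable M (\<lambda>\<omega>. (X n \<omega>)\<^sup>2)"
      using sqN integrable_distr_eq[OF Wm, of "\<lambda>w. (t \<bullet> J (G0 w))\<^sup>2" n] W_distr[of "Suc n"]
      by (simp add: X_def)
    show "expectation (\<lambda>\<omega>. (X n \<omega>)\<^sup>2) = (\<integral>w. (t \<bullet> J (G0 w))\<^sup>2 \<partial>N)"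
      using trans[of "\<lambda>w. (t \<bullet> J (G0 w))\<^sup>2" n] by (simp add: X_def)
    have "(\<integral>w. t \<bullet> J (G0 w) \<partial>N) = t \<bullet> J (\<integral>w. G0 w \<partial>N)"
      using integral_bounded_linear[OF J iG0] integrable_bounded_linear[OF J iG0] by simp
    then show "expectation (X n) = 0"
      using trans[of "\<lambda>w. - (t \<bullet> J (G0 w))" n] by (simp add: X_def G0_mean J.zero)
  qed
  moreover have "(\<lambda>n. expectation (\<lambda>\<omega>. iexp (t \<bullet> scaled_average n \<omega>)) - expectation (\<lambda>\<omega>. iexp ((\<Sum>i<n. X i \<omega>) / sqrt (real n)))) \<longlonglongrightarrow> 0"
  proof (rule Lim_null_comparison)
    let ?c = "norm t * onorm J"
    show "(\<lambda>n. (2 + ?c) * expectation (\<lambda>\<omega>. min 1 (norm (rest n \<omega>) / sqrt (real n)))) \<longlonglongrightarrow> 0"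
      using tendsto_mult_left[OF rest_negligible, of "2 + ?c"] by simp
    have "norm (expectation (\<lambda>\<omega>. iexp (t \<bullet> scaled_average n \<omega>)) - expectation (\<lambda>\<omega>. iexp ((\<Sum>i<n. X i \<omega>) / sqrt (real n))))
       \<le> (2 + ?c) * expectation (\<lambda>\<omega>. min 1 (norm (rest n \<omega>) / sqrt (real n)))" for n
    proof -
      have [measurable]: "X i \<in> borel_measurable M" for i unfolding X_def by measurable
      have i1: "integrable M (\<lambda>\<omega>. iexp (t \<bullet> scaled_average n \<omega>))"
        "integrable M (\<lambda>\<omega>. iexp ((\<Sum>i<n. X i \<omega>) / sqrt (real n)))"
        by (rule integrable_iexp, measurable)+
      have im: "integrable M (\<lambda>\<omega>. min 1 (norm (rest n \<omega>) / sqrt (real n)))"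
        by (rule integrable_const_bound[of _ 1]) auto
      have "norm (expectation (\<lambda>\<omega>. iexp (t \<bullet> scaled_average n \<omega>)) - expectation (\<lambda>\<omega>. iexp ((\<Sum>i<n. X i \<omega>) / sqrt (real n))))
        = norm (expectation (\<lambda>\<omega>. iexp (t \<bullet> scaled_average n \<omega>) - iexp ((\<Sum>i<n. X i \<omega>) / sqrt (real n))))"
        using i1 by simp
      also have "\<dots> \<le> expectation (\<lambda>\<omega>. norm (iexp (t \<bullet> scaled_average n \<omega>) - iexp ((\<Sum>i<n. X i \<omega>) / sqrt (real n))))"
        by (rule integral_norm_bound)
      also have "\<dots> \<le> expectation (\<lambda>\<omega>. (2 + ?c) * min 1 (norm (rest n \<omega>) / sqrt (real n)))"
      proof (rule integral_mono)
        show "integrable M (\<lambda>\<omega>. norm (iexp (t \<bullet> scaled_average n \<omega>) - iexp ((\<Sum>i<n. X i \<omega>) / sqrt (real n))))"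
          using i1 by simp
        show "integrable M (\<lambda>\<omega>. (2 + ?c) * min 1 (norm (rest n \<omega>) / sqrt (real n)))" using im by simp
        fix \<omega>
        have "(\<Sum>i<n. X i \<omega>) / sqrt (real n) = - (t \<bullet> J ((1 / sqrt (real n)) *\<^sub>R (\<Sum>i<n. G0 (W (Suc i) \<omega>))))"
          by (simp add: X_def J.scaleR J.sum inner_sum_right sum_negf)
        then have "t \<bullet> scaled_average n \<omega> - (\<Sum>i<n. X i \<omega>) / sqrt (real n) = t \<bullet> J ((1 / sqrt (real n)) *\<^sub>R rest n \<omega>)"
          unfolding scaled_average_eq[OF J JH] by (simp add: inner_diff_right)
        also have "\<bar>\<dots>\<bar> \<le> norm t * norm (J ((1 / sqrt (real n)) *\<^sub>R rest n \<omega>))" by (rule Cauchy_Schwarz_ineq2)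
        also have "\<dots> \<le> norm t * (onorm J * norm ((1 / sqrt (real n)) *\<^sub>R rest n \<omega>))"
          by (intro mult_left_mono onorm J) simp
        also have "\<dots> = ?c * (norm (rest n \<omega>) / sqrt (real n))" by simp
        finally show "norm (iexp (t \<bullet> scaled_average n \<omega>) - iexp ((\<Sum>i<n. X i \<omega>) / sqrt (real n))) \<le> (2 + ?c) * min 1 (norm (rest n \<omega>) / sqrt (real n))"
          using onorm_pos_le[OF J] by (intro iexp_diff_le) auto
      qed
      finally show ?thesis using im by simp
    qed
    then show "\<forall>\<^sub>F n in sequentially. norm (expectation (\<lambda>\<omega>. iexp (t \<bullet> scaled_average n \<omega>)) - expectation (\<lambda>\<omega>. iexp ((\<Sum>i<n. X i \<omega>) / sqrt (real n))))
       \<le> (2 + ?c) * expectation (\<lambda>\<omega>. min 1 (norm (rest n \<omega>) / sqrt (real n)))"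
      by (rule always_eventually[OF allI])
  qed
  ultimately show ?thesis
    by (rule Lim_transform)
qed

text \<open>Chebyshev's inequality for the normalised i.i.d. sum, whose second moment is bounded in
  \<open>n\<close>, combined with the negligibility of \<open>rest\<close>.\<close>

theorem scaled_average_tight:
  assumes J: "bounded_linear J" and JH: "\<And>x. J (H x) = x" and e: "e > 0"
  shows "\<exists>K. eventually (\<lambda>n. prob {\<omega> \<in> space M. norm (scaled_average n \<omega>) > K} \<le> e) sequentially"
proof -
  interpret J: bounded_linear J by (rule J)
  define s where "s = (\<integral>w. (norm (G0 w))\<^sup>2 \<partial>N)"
  define q where "q = onorm J"
  have q: "0 \<le> q" unfolding q_def by (rule onorm_pos_le[OF J])
  have s: "0 \<le> s" by (simp add: s_def)
  \<comment> \<open>Large enough for \<open>s / k \<le> e / 2\<close>, and at least 1 so that a norm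
    of at least \<open>k\<close> has square at least \<open>k\<close>.\<close>
  define k where "k = 1 + 2 * s / e"
  have k: "k \<ge> 1" using s e by (simp add: k_def)
  have "eventually (\<lambda>n. expectation (\<lambda>\<omega>. min 1 (norm (rest n \<omega>) / sqrt (real n))) < e / 2) sequentially"
    using e by (intro order_tendstoD(2)[OF rest_negligible]) simp
  then have "eventually (\<lambda>n. prob {\<omega> \<in> space M. norm (scaled_average n \<omega>) > q * (k + 1)} \<le> e) sequentially"
  proof eventually_elim
    case (elim n)
    let ?S = "\<lambda>\<omega>. (1 / sqrt (real n)) *\<^sub>R (\<Sum>i<n. G0 (W (Suc i) \<omega>))"
    have sq: "(norm (?S \<omega>))\<^sup>2 = (1 / real n) * (norm (\<Sum>i<n. G0 (W (Suc i) \<omega>)))\<^sup>2" for \<omega>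
      by (simp add: power_divide)
    have iS: "integrable M (\<lambda>\<omega>. (norm (?S \<omega>))\<^sup>2)"
      unfolding sq by (intro integrable_mult_right G0_sum_square)
    have ES: "expectation (\<lambda>\<omega>. (norm (?S \<omega>))\<^sup>2) \<le> s"
      unfolding sq using G0_sum_square[of n] s by (simp add: s_def)
    have im: "integrable M (\<lambda>\<omega>. min 1 (norm (rest n \<omega>) / sqrt (real n)))"
      by (rule integrable_const_bound[of _ 1]) auto
    let ?A = "{\<omega> \<in> space M. norm (scaled_average n \<omega>) > q * (k + 1)}"
    have "prob ?A = expectation (indicator ?A)" by simp
    also have "\<dots> \<le> expectation (\<lambda>\<omega>. (norm (?S \<omega>))\<^sup>2 / k + min 1 (norm (rest n \<omega>) / sqrt (real n)))"
    proof (rule integral_mono)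
      show "integrable M (indicator ?A :: 'a \<Rightarrow> real)"
        by (rule integrable_const_bound[of _ 1]) auto
      show "integrable M (\<lambda>\<omega>. (norm (?S \<omega>))\<^sup>2 / k + min 1 (norm (rest n \<omega>) / sqrt (real n)))"
        using iS im by simp
      fix \<omega>
      show "indicator ?A \<omega> \<le> (norm (?S \<omega>))\<^sup>2 / k + min 1 (norm (rest n \<omega>) / sqrt (real n))"
      proof (cases "\<omega> \<in> ?A")
        case True
        have "norm (scaled_average n \<omega>) \<le> norm (J ((1 / sqrt (real n)) *\<^sub>R rest n \<omega>)) + norm (J (?S \<omega>))"
          unfolding scaled_average_eq[OF J JH] by (rule norm_triangle_ineq4)
        also have "\<dots> \<le> q * norm ((1 / sqrt (real n)) *\<^sub>R rest n \<omega>) + q * norm (?S \<omega>)"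
          unfolding q_def by (intro add_mono onorm J)
        finally have "q * (k + 1) < q * (norm (rest n \<omega>) / sqrt (real n) + norm (?S \<omega>))"
          using True by (simp add: distrib_left)
        then have "k + 1 < norm (rest n \<omega>) / sqrt (real n) + norm (?S \<omega>)"
          using q mult_less_cancel_left by fastforce
        then consider "norm (rest n \<omega>) / sqrt (real n) \<ge> 1" | "norm (?S \<omega>) \<ge> k" by linarith
        then have "1 \<le> (norm (?S \<omega>))\<^sup>2 / k + min 1 (norm (rest n \<omega>) / sqrt (real n))"
        proof cases
          case 1
          then show ?thesis using k by simp
        next
          case 2
          have "1 \<le> y\<^sup>2 / k" if "y \<ge> k" for y :: real
          proof -
            have "k * 1 \<le> y * y" using that k by (intro mult_mono) auto
            then show ?thesis using k by (simp add: power2_eq_square)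
          qed
          from this[OF 2] have "1 \<le> (norm (?S \<omega>))\<^sup>2 / k" .
          moreover have "0 \<le> min 1 (norm (rest n \<omega>) / sqrt (real n))" by simp
          ultimately show ?thesis by linarith
        qed
        then show ?thesis using True by simp
      next
        case False
        then show ?thesis using k by simp
      qed
    qed
    also have "\<dots> = expectation (\<lambda>\<omega>. (norm (?S \<omega>))\<^sup>2) / k + expectation (\<lambda>\<omega>. min 1 (norm (rest n \<omega>) / sqrt (real n)))"
      using iS im by simp
    also have "\<dots> \<le> s / k + e / 2"
      using ES elim k by (intro add_mono divide_right_mono) auto
    also have "s / k \<le> e / 2"
    proof -
      have "s \<le> e / 2 * k" using e by (simp add: k_def field_simps)
      then show ?thesis using k by (simp add: divide_le_eq)
    qed
    finally show ?case by simp
  qed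
  then show ?thesis by blast
qed

end

section \<open>Gradients, Hessians and measurability\<close>

text \<open>The Riesz vector of the derivative is written down in coordinates; uniqueness of
  derivatives identifies it with the \<open>THE\<close> in \<open>grad\<close>.\<close>

lemma grad_has_derivative:
  fixes g :: "'a::euclidean_space \<Rightarrow> real"
  assumes "g differentiable (at x)"
  shows "(g has_derivative (\<lambda>h. h \<bullet> grad g x)) (at x)"
proof -
  obtain g' where g': "(g has_derivative g') (at x)"
    using assms by (auto simp: differentiable_def)
  interpret g': bounded_linear g' using g' by (rule has_derivative_bounded_linear)
  define d where "d = (\<Sum>b\<in>Basis. g' b *\<^sub>R b)"
  have "g' h = h \<bullet> d" for h
  proof -
    have "g' h = g' (\<Sum>b\<in>Basis. (h \<bullet> b) *\<^sub>R b)" by (simp add: euclidean_representation)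
    also have "\<dots> = h \<bullet> d"
      by (simp add: g'.sum g'.scaleR d_def inner_sum_right mult.commute)
    finally show ?thesis .
  qed
  then have "g' = (\<lambda>h. h \<bullet> d)" by (rule ext)
  then have gd: "GDERIV g x :> d" using g' by (simp add: gderiv_def)
  have "grad g x = d"
    unfolding grad_def
  proof (rule the_equality)
    show "GDERIV g x :> d" by (rule gd)
    fix d' assume "GDERIV g x :> d'"
    then have "(\<lambda>h. h \<bullet> d') = (\<lambda>h. h \<bullet> d)"
      using gd unfolding gderiv_def by (rule has_derivative_unique)
    then have "(d' - d) \<bullet> d' = (d' - d) \<bullet> d" by meson
    then have "(d' - d) \<bullet> (d' - d) = 0" by (simp add: inner_diff_right)
    then show "d' = d" by simp
  qed
  then show ?thesis using gd by (simp add: gderiv_def)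
qed

lemma grad_line_derivative:
  fixes g :: "'a::euclidean_space \<Rightarrow> real"
  assumes "g differentiable (at (x + t *\<^sub>R u))"
  shows "((\<lambda>t. g (x + t *\<^sub>R u)) has_field_derivative (u \<bullet> grad g (x + t *\<^sub>R u))) (at t)"
proof -
  have l: "((\<lambda>t. x + t *\<^sub>R u) has_derivative (\<lambda>s. s *\<^sub>R u)) (at t)"
    by (auto intro!: derivative_eq_intros)
  have "((\<lambda>t. g (x + t *\<^sub>R u)) has_derivative (\<lambda>s. (s *\<^sub>R u) \<bullet> grad g (x + t *\<^sub>R u))) (at t)"
    using has_derivative_compose[OF l grad_has_derivative[OF assms]] by simp
  then show ?thesis
    unfolding has_field_derivative_def
    by (rule has_derivative_eq_rhs) (simp add: fun_eq_iff)
qed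

lemma hessian_has_derivative:
  fixes g :: "real^'n \<Rightarrow> real"
  assumes "twice_differentiable g"
  shows "(grad g has_derivative (\<lambda>h. hessian g x *v h)) (at x)"
  using assms jacobian_works[of "grad g" "at x"]
  unfolding twice_differentiable_def hessian_def by blast

lemma hessian_line_derivative:
  fixes g :: "real^'n \<Rightarrow> real"
  assumes "twice_differentiable g"
  shows "((\<lambda>t. grad g (x + t *\<^sub>R u)) has_vector_derivative (hessian g (x + t *\<^sub>R u) *v u)) (at t)"
proof -
  have l: "((\<lambda>t. x + t *\<^sub>R u) has_derivative (\<lambda>s. s *\<^sub>R u)) (at t)"
    by (auto intro!: derivative_eq_intros)
  have "((\<lambda>t. grad g (x + t *\<^sub>R u)) has_derivative (\<lambda>s. hessian g (x + t *\<^sub>R u) *v (s *\<^sub>R u))) (at t)"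
    using has_derivative_compose[OF l hessian_has_derivative[OF assms]] by simp
  then show ?thesis
    unfolding has_vector_derivative_def
    by (rule has_derivative_eq_rhs) (simp add: fun_eq_iff matrix_vector_mult_scaleR)
qed

lemma convex_gradient_inequality:
  fixes g :: "'a::euclidean_space \<Rightarrow> real"
  assumes conv: "convex_on UNIV g" and diff: "g differentiable (at x)"
  shows "u \<bullet> grad g x \<le> g (x + u) - g x"
proof -
  define k where "k = (\<lambda>t. g (x + t *\<^sub>R u))"
  have k': "(k has_field_derivative (u \<bullet> grad g x)) (at 0)"
    unfolding k_def using grad_line_derivative[of g x 0 u] diff by simp
  have "convex_on UNIV k"
    unfolding convex_on_def
  proof (intro conjI ballI allI impI)
    fix s t a b :: real assume ab: "0 \<le> a" "0 \<le> b" "a + b = 1"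
    have "x + (a *\<^sub>R s + b *\<^sub>R t) *\<^sub>R u = a *\<^sub>R (x + s *\<^sub>R u) + b *\<^sub>R (x + t *\<^sub>R u)"
    proof -
      have "x = (a + b) *\<^sub>R x" using ab by simp
      then have "x + (a *\<^sub>R s + b *\<^sub>R t) *\<^sub>R u = (a + b) *\<^sub>R x + (a *\<^sub>R s + b *\<^sub>R t) *\<^sub>R u" by simp
      also have "\<dots> = a *\<^sub>R (x + s *\<^sub>R u) + b *\<^sub>R (x + t *\<^sub>R u)" by (simp only: real_scaleR_def algebra_simps scaleR_scaleR)
      finally show ?thesis .
    qed
    then show "k (a *\<^sub>R s + b *\<^sub>R t) \<le> a * k s + b * k t"
      using conv ab unfolding k_def convex_on_def by simp
  qed simp
  then have "k 1 - k 0 \<ge> (u \<bullet> grad g x) * (1 - 0)"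
    by (rule convex_on_imp_above_tangent[where A = UNIV])
       (use k' in \<open>auto intro: has_field_derivative_at_within\<close>)
  then show ?thesis by (simp add: k_def)
qed

text \<open>For a convex function the difference quotient along \<open>v\<close> is squeezed between the slopes at the
  two endpoints, so no measurable selection of an intermediate point is needed.\<close>

lemma convex_difference_quotient:
  fixes g :: "'a::euclidean_space \<Rightarrow> real"
  assumes conv: "convex_on UNIV g" and diff: "\<And>x. g differentiable (at x)" and h: "0 < h"
  shows "v \<bullet> grad g x \<le> (g (x + h *\<^sub>R v) - g x) / h"
    and "(g (x + h *\<^sub>R v) - g x) / h \<le> v \<bullet> grad g (x + h *\<^sub>R v)"
proof -
  have "(h *\<^sub>R v) \<bullet> grad g x \<le> g (x + h *\<^sub>R v) - g x"
    by (rule convex_gradient_inequality[OF conv diff])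
  then show "v \<bullet> grad g x \<le> (g (x + h *\<^sub>R v) - g x) / h" using h by (simp add: field_simps)
  have "(- (h *\<^sub>R v)) \<bullet> grad g (x + h *\<^sub>R v) \<le> g (x + h *\<^sub>R v + - (h *\<^sub>R v)) - g (x + h *\<^sub>R v)"
    by (rule convex_gradient_inequality[OF conv diff])
  then show "(g (x + h *\<^sub>R v) - g x) / h \<le> v \<bullet> grad g (x + h *\<^sub>R v)" using h by (simp add: field_simps)
qed

text \<open>Caratheodory functions are jointly measurable: round the first argument to a countable
  dense set and refine the rounding.\<close>

lemma measurable_continuous_section:
  fixes f :: "'a::euclidean_space \<Rightarrow> 'z \<Rightarrow> real"
  assumes meas: "\<And>x. f x \<in> borel_measurable Z"
    and cont: "\<And>z. z \<in> space Z \<Longrightarrow> continuous_on UNIV (\<lambda>x. f x z)"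
  shows "(\<lambda>p. f (fst p) (snd p)) \<in> borel_measurable (borel \<Otimes>\<^sub>M Z)"
proof -
  obtain E :: "'a set" where E: "countable E" "\<And>X. open X \<Longrightarrow> X \<noteq> {} \<Longrightarrow> \<exists>d\<in>E. d \<in> X"
    using countable_dense_setE by blast
  have Ene: "E \<noteq> {}" using E(2)[of UNIV] by auto
  define a where "a = from_nat_into E"
  have dense: "\<exists>k. dist (x::'a) (a k) < e" if e: "e > 0" for x e
  proof -
    have "\<exists>d\<in>E. d \<in> ball x e" using E(2)[of "ball x e"] e by auto
    then obtain d where "d \<in> E" "d \<in> ball x e" by blast
    moreover obtain k where "a k = d" using from_nat_into_surj[OF E(1) \<open>d \<in> E\<close>] by (auto simp: a_def)
    ultimately show ?thesis by (auto simp: dist_commute)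
  qed
  \<comment> \<open>Taking the least index within \<open>1 / real (Suc n)\<close> of
    \<open>x\<close> makes the rounding a measurable function with countably many values.\<close>
  define k where "k = (\<lambda>n x. LEAST k. dist (x::'a) (a k) < 1 / real (Suc n))"
  have k: "dist x (a (k n x)) < 1 / real (Suc n)" for n x
    unfolding k_def by (rule LeastI_ex) (rule dense, simp)
  have km: "k n \<in> measurable borel (count_space UNIV)" for n
    unfolding k_def by measurable
  have lim: "(\<lambda>n. a (k n x)) \<longlonglongrightarrow> x" for x
  proof (rule metric_LIMSEQ_I)
    fix r :: real assume "r > 0"
    then obtain n0 where n0: "inverse (real (Suc n0)) < r" using reals_Archimedean by blast
    have "dist (a (k n x)) x < r" if "n \<ge> n0" for n
    proof -
      have "dist (a (k n x)) x < 1 / real (Suc n)" using k[of x n] by (simp add: dist_commute)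
      also have "\<dots> \<le> 1 / real (Suc n0)" using that by (intro divide_left_mono) auto
      finally show ?thesis using n0 by (simp add: inverse_eq_divide)
    qed
    then show "\<exists>no. \<forall>n\<ge>no. dist (a (k n x)) x < r" by blast
  qed
  show ?thesis
  proof (rule borel_measurable_LIMSEQ_real)
    fix n
    have "(\<lambda>p. (\<lambda>i p. f (a i) (snd p)) (k n (fst p)) p) \<in> borel_measurable (borel \<Otimes>\<^sub>M Z)"
      by (rule measurable_compose_countable)
         (use meas km in measurable)
    then show "(\<lambda>p. f (a (k n (fst p))) (snd p)) \<in> borel_measurable (borel \<Otimes>\<^sub>M Z)" by simp
  next
    fix p :: "'a \<times> 'z" assume "p \<in> space (borel \<Otimes>\<^sub>M Z)"
    then have "isCont (\<lambda>x. f x (snd p)) (fst p)"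
      using cont[of "snd p"] by (auto simp: space_pair_measure continuous_on_eq_continuous_at)
    from isCont_tendsto_compose[OF this lim[of "fst p"]]
    show "(\<lambda>n. f (a (k n (fst p))) (snd p)) \<longlonglongrightarrow> f (fst p) (snd p)" .
  qed
qed

text \<open>Exhibits derivatives as limits of sequences, through which gradients and Hessian
  products inherit measurability.\<close>

lemma difference_quotient_tendsto:
  fixes k :: "real \<Rightarrow> 'b::real_normed_vector"
  assumes "(k has_vector_derivative k') (at t)"
  shows "(\<lambda>n. real (Suc n) *\<^sub>R (k (t + 1 / real (Suc n)) - k t)) \<longlonglongrightarrow> k'"
proof -
  have "((\<lambda>h. (1 / h) *\<^sub>R (k (t + h) - k t)) \<longlongrightarrow> k') (at 0)"
  proof -
    have "((\<lambda>y. (k y - k t - (y - t) *\<^sub>R k') /\<^sub>R norm (y - t)) \<longlongrightarrow> 0) (at t)"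
      using assms unfolding has_vector_derivative_def has_derivative_at' has_derivative_def
      by simp
    then have "((\<lambda>y. norm ((k y - k t - (y - t) *\<^sub>R k') /\<^sub>R norm (y - t))) \<longlongrightarrow> 0) (at t)"
      by (rule tendsto_norm_zero)
    then have "((\<lambda>y. norm ((1 / (y - t)) *\<^sub>R (k y - k t) - k')) \<longlongrightarrow> 0) (at t)"
    proof (rule Lim_transform_eventually)
      show "\<forall>\<^sub>F y in at t. norm ((k y - k t - (y - t) *\<^sub>R k') /\<^sub>R norm (y - t)) = norm ((1 / (y - t)) *\<^sub>R (k y - k t) - k')"
      proof (rule eventually_mono[OF eventually_neq_at_within[of t]])
        fix y assume y: "y \<noteq> t"
        have "(1 / (y - t)) *\<^sub>R (k y - k t) - k' = (1 / (y - t)) *\<^sub>R (k y - k t - (y - t) *\<^sub>R k')"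
          using y by (simp add: scaleR_diff_right)
        then show "norm ((k y - k t - (y - t) *\<^sub>R k') /\<^sub>R norm (y - t)) = norm ((1 / (y - t)) *\<^sub>R (k y - k t) - k')"
          by (simp add: divide_inverse)
      qed
    qed
    then have "((\<lambda>y. (1 / (y - t)) *\<^sub>R (k y - k t) - k') \<longlongrightarrow> 0) (at t)"
      by (rule tendsto_norm_zero_cancel)
    then have "((\<lambda>y. (1 / (y - t)) *\<^sub>R (k y - k t)) \<longlongrightarrow> k') (at t)"
      by (rule LIM_zero_cancel)
    then show ?thesis
      by (subst (asm) LIM_offset_zero_iff) (auto simp: add.commute)
  qed
  then have "(\<lambda>n. (1 / (1 / real (Suc n))) *\<^sub>R (k (t + 1 / real (Suc n)) - k t)) \<longlonglongrightarrow> k'"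
  proof (rule filterlim_compose)
    show "filterlim (\<lambda>n. 1 / real (Suc n)) (at 0) sequentially"
      by (rule filterlim_atI[OF LIMSEQ_Suc[OF lim_1_over_n]]) simp
  qed
  then show ?thesis by simp
qed

text \<open>The fundamental theorem and Jensen's inequality on the unit interval. With a nonnegative
  integral on the right no integrability has to be assumed: the infinite case is trivial, and the
  finite one makes \<open>k'\<close> integrable.\<close>

lemma norm_square_increment_le:
  fixes k k' :: "real \<Rightarrow> 'b::euclidean_space"
  assumes der: "\<And>t. (k has_vector_derivative k' t) (at t)"
    and meas[measurable]: "k' \<in> borel_measurable borel"
  shows "ennreal ((norm (k 1 - k 0))\<^sup>2) \<le> (\<integral>\<^sup>+t. ennreal ((norm (k' t))\<^sup>2) * indicator {0..1} t \<partial>lborel)"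
proof -
  let ?I = "restrict_space lborel {0..1::real}"
  interpret I: prob_space ?I
    by (rule prob_spaceI) (simp add: emeasure_restrict_space space_restrict_space)
  have nn: "(\<integral>\<^sup>+t. ennreal ((norm (k' t))\<^sup>2) * indicator {0..1} t \<partial>lborel) = (\<integral>\<^sup>+t. ennreal ((norm (k' t))\<^sup>2) \<partial>?I)"
    by (subst nn_integral_restrict_space) auto
  have m: "k' \<in> borel_measurable ?I" by (rule measurable_restrict_space1) simp
  show ?thesis
  proof (cases "(\<integral>\<^sup>+t. ennreal ((norm (k' t))\<^sup>2) \<partial>?I) = \<infinity>")
    case True
    then show ?thesis by (simp add: nn)
  next
    case False
    have i2: "integrable ?I (\<lambda>t. (norm (k' t))\<^sup>2)"
      by (rule integrableI_nonneg) (use m False in \<open>auto simp: less_top\<close>)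
    have i1: "integrable ?I k'"
      by (rule integrable_norm_squareD[OF I.finite_measure_axioms m i2])
    have si: "set_integrable lborel {0..1} k'"
      using i1 by (subst (asm) integrable_restrict_space) (auto simp: set_integrable_def)
    \<comment> \<open>The derivative need not be continuous, so the fundamental theorem first yields
      a gauge integral; \<open>si\<close> identifies it with the Lebesgue integral.\<close>
    have "(k' has_integral (k 1 - k 0)) {0..1}"
      using der by (intro fundamental_theorem_of_calculus) (auto intro: has_vector_derivative_at_within)
    then have "k 1 - k 0 = integral {0..1} k'" by (simp add: integral_unique)
    also have "\<dots> = (LINT t:{0..1}|lborel. k' t)" by (rule set_borel_integral_eq_integral(2)[OF si, symmetric])
    also have "\<dots> = (\<integral>t. k' t \<partial>?I)"
      by (subst integral_restrict_space) (auto simp: set_lebesgue_integral_def)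
    finally have "(norm (k 1 - k 0))\<^sup>2 \<le> (\<integral>t. (norm (k' t))\<^sup>2 \<partial>?I)"
      using I.norm_expectation_square_le(2)[OF m i2] by simp
    then show ?thesis
      unfolding nn by (subst nn_integral_eq_integral[OF i2]) (auto intro: ennreal_leI)
  qed
qed

text \<open>Expand the nonnegative form at \<open>y - x\<close>; equal norms give the two diagonal
  terms the same bound.\<close>

lemma pos_semidef_bilinear_bound:
  fixes A :: "real^'n^'n"
  assumes psd: "pos_semidef A" and up: "\<And>x. x \<bullet> (A *v x) \<le> L * (norm x)\<^sup>2" and n: "norm y = norm x"
  shows "y \<bullet> (A *v x) \<le> L * (norm x)\<^sup>2"
proof -
  have sym: "x \<bullet> (A *v y) = y \<bullet> (A *v x)"
    using symmetric_inner[OF pos_semidef_symmetric[OF psd], of x y] by (simp add: inner_commute)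
  have "0 \<le> (y - x) \<bullet> (A *v (y - x))" by (rule pos_semidef_quadratic_form[OF psd])
  also have "\<dots> = y \<bullet> (A *v y) + x \<bullet> (A *v x) - 2 * (y \<bullet> (A *v x))"
    using sym by (simp add: matrix_vector_mult_diff_distrib inner_diff_left inner_diff_right)
  also have "\<dots> \<le> 2 * (L * (norm x)\<^sup>2) - 2 * (y \<bullet> (A *v x))"
    using up[of y] up[of x] by (simp add: n)
  finally show ?thesis by simp
qed

section \<open>Convex stochastic losses\<close>

lemma matrix_bounded_linear: "bounded_linear ((*v) (A::real^'n^'m))"
  by (rule matrix_vector_mul_bounded_linear)

lemma spectral_norm_bound: "norm (A *v x) \<le> spectral_norm A * norm x" for A :: "real^'n^'n"
  unfolding spectral_norm_def by (rule onorm[OF matrix_bounded_linear])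

locale smooth_loss = P: prob_space P for P :: "'z measure" +
  fixes f :: "real^'d \<Rightarrow> 'z \<Rightarrow> real" and F :: "real^'d \<Rightarrow> real" and \<theta>s :: "real^'d"
    and L \<delta>1 \<mu> \<delta> K Lh :: real
  assumes f_integrable: "\<And>\<theta>. integrable P (f \<theta>)"
    and f_convex: "\<And>z. z \<in> space P \<Longrightarrow> convex_on UNIV (\<lambda>\<theta>. f \<theta> z)"
    and f_twice_diff: "\<And>z. z \<in> space P \<Longrightarrow> twice_differentiable (\<lambda>\<theta>. f \<theta> z)"
    and F_eq: "F = (\<lambda>\<theta>. \<integral>z. f \<theta> z \<partial>P)"
    and argmin: "is_arg_min F (\<lambda>_. True) \<theta>s"
    and F_twice_diff: "twice_differentiable F"
    and F_hess_bounds: "\<And>\<theta>. loewner_le 0 (hessian F \<theta>) \<and> loewner_le (hessian F \<theta>) (mat L)"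
    and \<delta>1: "\<delta>1 > 0" and \<mu>: "\<mu> > 0"
    and F_local_strong: "\<And>\<theta>. \<theta> \<in> ball \<theta>s \<delta>1 \<Longrightarrow> loewner_le (mat \<mu>) (hessian F \<theta>)"
    and grad_unbiased: "\<And>\<theta>. has_bochner_integral P (\<lambda>z. grad (\<lambda>\<theta>. f \<theta> z) \<theta>) (grad F \<theta>)"
    and \<delta>: "0 < \<delta>" and K: "K > 0"
    and grad_moment: "\<And>\<theta>.
          (\<integral>\<^sup>+z. ennreal (norm (grad (\<lambda>\<theta>. f \<theta> z) \<theta> - grad F \<theta>) powr (2 + \<delta>)) \<partial>P)
            \<le> ennreal (K * (norm (\<theta> - \<theta>s) powr (2 + \<delta>) + 1))"
    and Lh: "Lh > 0"
    and hess_lipschitz: "\<And>\<theta> \<theta>'.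
          (\<integral>\<^sup>+z. ennreal ((spectral_norm (hessian (\<lambda>\<theta>. f \<theta> z) \<theta> - hessian (\<lambda>\<theta>. f \<theta> z) \<theta>'))\<^sup>2) \<partial>P)
            \<le> ennreal (Lh * (norm (\<theta> - \<theta>'))\<^sup>2)"
begin

definition gf :: "real^'d \<Rightarrow> 'z \<Rightarrow> real^'d" where "gf \<theta> z = grad (\<lambda>\<theta>. f \<theta> z) \<theta>"
definition hf :: "real^'d \<Rightarrow> 'z \<Rightarrow> real^'d^'d" where "hf \<theta> z = hessian (\<lambda>\<theta>. f \<theta> z) \<theta>"

abbreviation dF :: "real^'d \<Rightarrow> real^'d" where "dF \<equiv> grad F"
abbreviation H :: "real^'d^'d" where "H \<equiv> hessian F \<theta>s"

section \<open>Measurability of the sample derivatives\<close>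

lemma f_diff: "z \<in> space P \<Longrightarrow> (\<lambda>\<theta>. f \<theta> z) differentiable (at x)"
  using f_twice_diff by (simp add: twice_differentiable_def)

lemma F_diff: "F differentiable (at x)"
  using F_twice_diff by (simp add: twice_differentiable_def)

lemma f_joint [measurable]: "(\<lambda>p. f (fst p) (snd p)) \<in> borel_measurable (borel \<Otimes>\<^sub>M P)"
proof (rule measurable_continuous_section)
  show "f x \<in> borel_measurable P" for x using f_integrable[of x] by simp
  show "continuous_on UNIV (\<lambda>x. f x z)" if "z \<in> space P" for z
    using f_diff[OF that] by (simp add: continuous_at_imp_continuous_on differentiable_imp_continuous_within)
qed

lemma gf_joint [measurable]: "(\<lambda>p. gf (fst p) (snd p)) \<in> borel_measurable (borel \<Otimes>\<^sub>M P)"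
proof (subst borel_measurable_euclidean_space, intro ballI)
  fix b :: "real^'d" assume "b \<in> Basis"
  show "(\<lambda>p. gf (fst p) (snd p) \<bullet> b) \<in> borel_measurable (borel \<Otimes>\<^sub>M P)"
  proof (rule borel_measurable_LIMSEQ_real)
    fix n
    have "(\<lambda>p. (\<lambda>p. f (fst p) (snd p)) (fst p + (1 / real (Suc n)) *\<^sub>R b, snd p)) \<in> borel_measurable (borel \<Otimes>\<^sub>M P)"
      by (rule measurable_compose[OF _ f_joint]) measurable
    then show "(\<lambda>p. real (Suc n) * (f (fst p + (1 / real (Suc n)) *\<^sub>R b) (snd p) - f (fst p) (snd p))) \<in> borel_measurable (borel \<Otimes>\<^sub>M P)"
      using f_joint by simp
  next
    fix p :: "(real^'d) \<times> 'z" assume "p \<in> space (borel \<Otimes>\<^sub>M P)"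
    then have z: "snd p \<in> space P" by (auto simp: space_pair_measure)
    have "((\<lambda>t. f (fst p + t *\<^sub>R b) (snd p)) has_vector_derivative (b \<bullet> gf (fst p) (snd p))) (at 0)"
      using grad_line_derivative[of "\<lambda>\<theta>. f \<theta> (snd p)" "fst p" 0 b] f_diff[OF z]
      by (simp add: has_real_derivative_iff_has_vector_derivative gf_def)
    from difference_quotient_tendsto[OF this]
    show "(\<lambda>n. real (Suc n) * (f (fst p + (1 / real (Suc n)) *\<^sub>R b) (snd p) - f (fst p) (snd p))) \<longlonglongrightarrow> gf (fst p) (snd p) \<bullet> b"
      by (simp add: inner_commute)
  qed
qed

lemma gf_measurable [measurable]: "gf \<theta> \<in> borel_measurable P"
  using measurable_compose[OF _ gf_joint, of "\<lambda>z. (\<theta>, z)" P] by simp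

lemma f_measurable [measurable]: "f \<theta> \<in> borel_measurable P"
  using f_integrable[of \<theta>] by simp

lemma hf_line: "z \<in> space P \<Longrightarrow>
  ((\<lambda>t. gf (x + t *\<^sub>R u) z) has_vector_derivative (hf (x + t *\<^sub>R u) z *v u)) (at t)"
  unfolding gf_def hf_def by (rule hessian_line_derivative[OF f_twice_diff])

text \<open>Measurability is established for the product of the Hessian with a fixed vector along a
  line, as a limit of gradient quotients; this is the form in which it is integrated.\<close>

lemma hf_joint [measurable]: "(\<lambda>p. hf (x + fst p *\<^sub>R u) (snd p) *v u) \<in> borel_measurable (borel \<Otimes>\<^sub>M P)"
proof (rule borel_measurable_LIMSEQ_metric)
  fix n
  have 1: "(\<lambda>p. (\<lambda>p. gf (fst p) (snd p)) (x + (fst p + 1 / real (Suc n)) *\<^sub>R u, snd p)) \<in> borel_measurable (borel \<Otimes>\<^sub>M P)"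
    by (rule measurable_compose[OF _ gf_joint]) measurable
  have 2: "(\<lambda>p. (\<lambda>p. gf (fst p) (snd p)) (x + fst p *\<^sub>R u, snd p)) \<in> borel_measurable (borel \<Otimes>\<^sub>M P)"
    by (rule measurable_compose[OF _ gf_joint]) measurable
  show "(\<lambda>p. real (Suc n) *\<^sub>R (gf (x + (fst p + 1 / real (Suc n)) *\<^sub>R u) (snd p) - gf (x + fst p *\<^sub>R u) (snd p))) \<in> borel_measurable (borel \<Otimes>\<^sub>M P)"
    using 1 2 by simp
next
  fix p :: "real \<times> 'z" assume "p \<in> space (borel \<Otimes>\<^sub>M P)"
  then have z: "snd p \<in> space P" by (auto simp: space_pair_measure)
  from difference_quotient_tendsto[OF hf_line[OF z]]
  show "(\<lambda>n. real (Suc n) *\<^sub>R (gf (x + (fst p + 1 / real (Suc n)) *\<^sub>R u) (snd p) - gf (x + fst p *\<^sub>R u) (snd p))) \<longlonglongrightarrow> hf (x + fst p *\<^sub>R u) (snd p) *v u" .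
qed

lemma hf_vector_measurable [measurable]: "(\<lambda>z. hf x z *v u) \<in> borel_measurable P"
  using measurable_compose[OF _ hf_joint[of x u], of "\<lambda>z. (0, z)" P] by simp

text \<open>The first-order Taylor remainder of the sample gradient at the minimiser.\<close>

definition lin_err :: "real^'d \<Rightarrow> 'z \<Rightarrow> real^'d" where
  "lin_err x z = gf (\<theta>s + x) z - gf \<theta>s z - hf \<theta>s z *v x"

lemma lin_err_measurable [measurable]: "lin_err x \<in> borel_measurable P"
  unfolding lin_err_def[abs_def] by measurable

text \<open>Along the segment the derivative of the remainder is the increment of the sample Hessian
  applied to \<open>x\<close>. After exchanging the integrals, its mean square is bounded by the
  Lipschitz condition for each \<open>t\<close>.\<close>

lemma lin_err_nn_integral:
  "(\<integral>\<^sup>+z. ennreal ((norm (lin_err x z))\<^sup>2) \<partial>P) \<le> ennreal (Lh * (norm x)^4)"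
proof -
  interpret Q: pair_sigma_finite P "lborel :: real measure" ..
  let ?k' = "\<lambda>z t. hf (\<theta>s + t *\<^sub>R x) z *v x - hf \<theta>s z *v x"
  have jm: "(\<lambda>p. hf (\<theta>s + snd p *\<^sub>R x) (fst p) *v x) \<in> borel_measurable (P \<Otimes>\<^sub>M lborel)"
    using measurable_compose[OF measurable_Pair[OF measurable_snd measurable_fst] hf_joint[of \<theta>s x]] by simp
  have jm'[measurable]: "(\<lambda>(z, t). ennreal ((norm (?k' z t))\<^sup>2) * indicator {0..1} t) \<in> borel_measurable (P \<Otimes>\<^sub>M lborel)"
  proof -
    have "(\<lambda>p. hf \<theta>s (fst p) *v x) \<in> borel_measurable (P \<Otimes>\<^sub>M (lborel :: real measure))" by measurable
    with jm show ?thesis by (simp add: split_beta)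
  qed
  have "(\<integral>\<^sup>+z. ennreal ((norm (lin_err x z))\<^sup>2) \<partial>P) \<le> (\<integral>\<^sup>+z. (\<integral>\<^sup>+t. ennreal ((norm (?k' z t))\<^sup>2) * indicator {0..1} t \<partial>lborel) \<partial>P)"
  proof (rule nn_integral_mono)
    fix z assume z: "z \<in> space P"
    let ?k = "\<lambda>t. gf (\<theta>s + t *\<^sub>R x) z - t *\<^sub>R (hf \<theta>s z *v x)"
    have "(?k has_vector_derivative ?k' z t) (at t)" for t
      by (rule derivative_eq_intros hf_line[OF z] refl | simp)+
    moreover have "?k' z \<in> borel_measurable borel"
      using measurable_compose[OF _ jm, of "\<lambda>t. (z, t)" borel] z by simp
    ultimately have "ennreal ((norm (?k 1 - ?k 0))\<^sup>2) \<le> (\<integral>\<^sup>+t. ennreal ((norm (?k' z t))\<^sup>2) * indicator {0..1} t \<partial>lborel)"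
      by (rule norm_square_increment_le)
    then show "ennreal ((norm (lin_err x z))\<^sup>2) \<le> (\<integral>\<^sup>+t. ennreal ((norm (?k' z t))\<^sup>2) * indicator {0..1} t \<partial>lborel)"
      by (simp add: lin_err_def algebra_simps)
  qed
  also have "\<dots> = (\<integral>\<^sup>+t. (\<integral>\<^sup>+z. ennreal ((norm (?k' z t))\<^sup>2) * indicator {0..1} t \<partial>P) \<partial>lborel)"
    using Q.Fubini'[OF jm'] by simp
  also have "\<dots> \<le> (\<integral>\<^sup>+t. ennreal (Lh * (norm x)^4) * indicator {0..1::real} t \<partial>lborel)"
  proof (rule nn_integral_mono)
    fix t :: real
    show "(\<integral>\<^sup>+z. ennreal ((norm (?k' z t))\<^sup>2) * indicator {0..1} t \<partial>P) \<le> ennreal (Lh * (norm x)^4) * indicator {0..1::real} t"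
    proof (cases "t \<in> {0..1}")
      case True
      \<comment> \<open>The factor \<open>(norm x)\<^sup>2\<close> is pulled out while the integrand
        is known to be measurable; only then is the quotient replaced by the spectral norm, for
        which monotonicity suffices. For \<open>x = 0\<close> the quotient is 0 by the convention
        for division.\<close>
      let ?q = "\<lambda>z. (norm (?k' z t) / norm x)\<^sup>2"
      have eq: "(norm (?k' z t))\<^sup>2 = (norm x)\<^sup>2 * ?q z" for z
        by (cases "x = 0") (simp_all add: power_divide)
      have "(\<integral>\<^sup>+z. ennreal ((norm (?k' z t))\<^sup>2) \<partial>P) = (\<integral>\<^sup>+z. ennreal ((norm x)\<^sup>2) * ennreal (?q z) \<partial>P)"
        by (subst eq) (simp add: ennreal_mult)
      also have "\<dots> = ennreal ((norm x)\<^sup>2) * (\<integral>\<^sup>+z. ennreal (?q z) \<partial>P)"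
        by (rule nn_integral_cmult) measurable
      also have "\<dots> \<le> ennreal ((norm x)\<^sup>2) * (\<integral>\<^sup>+z. ennreal ((spectral_norm (hf (\<theta>s + t *\<^sub>R x) z - hf \<theta>s z))\<^sup>2) \<partial>P)"
      proof (intro mult_left_mono nn_integral_mono ennreal_leI power_mono)
        fix z
        have "norm (?k' z t) \<le> spectral_norm (hf (\<theta>s + t *\<^sub>R x) z - hf \<theta>s z) * norm x"
          using spectral_norm_bound[of "hf (\<theta>s + t *\<^sub>R x) z - hf \<theta>s z" x]
          by (simp add: matrix_vector_mult_diff_rdistrib)
        moreover have "0 \<le> spectral_norm (hf (\<theta>s + t *\<^sub>R x) z - hf \<theta>s z)"
          unfolding spectral_norm_def by (rule onorm_pos_le[OF matrix_bounded_linear])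
        ultimately show "norm (?k' z t) / norm x \<le> spectral_norm (hf (\<theta>s + t *\<^sub>R x) z - hf \<theta>s z)"
          by (cases "x = 0") (simp_all add: divide_le_eq)
      qed simp_all
      also have "\<dots> \<le> ennreal ((norm x)\<^sup>2) * ennreal (Lh * (norm (\<theta>s + t *\<^sub>R x - \<theta>s))\<^sup>2)"
        using hess_lipschitz[of "\<theta>s + t *\<^sub>R x" \<theta>s] by (intro mult_left_mono) (auto simp: hf_def)
      also have "\<dots> = ennreal ((norm x)\<^sup>2 * (Lh * (norm (t *\<^sub>R x))\<^sup>2))"
        using Lh by (subst ennreal_mult[symmetric]) auto
      also have "\<dots> \<le> ennreal (Lh * (norm x)^4)"
      proof (rule ennreal_leI)
        have "\<bar>t\<bar> * norm x \<le> 1 * norm x" using True by (intro mult_right_mono) auto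
        then have "(\<bar>t\<bar> * norm x)\<^sup>2 \<le> (norm x)\<^sup>2" by (intro power_mono) auto
        then have "(norm x)\<^sup>2 * (Lh * (norm (t *\<^sub>R x))\<^sup>2) \<le> (norm x)\<^sup>2 * (Lh * (norm x)\<^sup>2)"
          using Lh by (intro mult_left_mono) auto
        then show "(norm x)\<^sup>2 * (Lh * (norm (t *\<^sub>R x))\<^sup>2) \<le> Lh * (norm x)^4"
          by (simp add: power2_eq_square power4_eq_xxxx mult_ac)
      qed
      finally show ?thesis using True by simp
    qed simp
  qed
  also have "\<dots> = ennreal (Lh * (norm x)^4)"
    by (subst nn_integral_cmult) auto
  finally show ?thesis .
qed

end

text \<open>Interpolation with a free scale: up to \<open>s\<close> the square is at most
  \<open>s\<^sup>2\<close>, and above it the additional factor \<open>y powr \<delta>\<close> is at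
  least \<open>s powr \<delta>\<close>.\<close>

lemma square_le_powr:
  fixes y s \<delta> :: real
  assumes "0 \<le> y" "0 < s" "0 < \<delta>"
  shows "y\<^sup>2 \<le> s\<^sup>2 + s powr (- \<delta>) * y powr (2 + \<delta>)"
proof (cases "y \<le> s")
  case True
  then have "y\<^sup>2 \<le> s\<^sup>2" using assms by (intro power_mono)
  moreover have "0 \<le> s powr (- \<delta>) * y powr (2 + \<delta>)" by simp
  ultimately show ?thesis by linarith
next
  case False
  then have y: "s < y" "0 < y" using assms by auto
  have "y\<^sup>2 * 1 \<le> y\<^sup>2 * (s powr (- \<delta>) * y powr \<delta>)"
  proof (rule mult_left_mono)
    have "s powr \<delta> \<le> y powr \<delta>" using y assms by (intro powr_mono2) auto
    then show "1 \<le> s powr (- \<delta>) * y powr \<delta>"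
      using assms by (simp add: powr_minus field_simps)
  qed simp
  also have "\<dots> = s powr (- \<delta>) * y powr (2 + \<delta>)"
    using y by (simp add: powr_add)
  finally show ?thesis using zero_le_power2[of s] by linarith
qed

context smooth_loss
begin

section \<open>Second moments of the sample gradient\<close>

lemma gf_integral: "integrable P (gf \<theta>)" "(\<integral>z. gf \<theta> z \<partial>P) = dF \<theta>"
  using grad_unbiased[of \<theta>] by (auto simp: has_bochner_integral_iff gf_def[abs_def])

lemma gf_deviation:
  shows "integrable P (\<lambda>z. (norm (gf \<theta> z - dF \<theta>))\<^sup>2)"
    and "(\<integral>z. (norm (gf \<theta> z - dF \<theta>))\<^sup>2 \<partial>P) \<le> (1 + 2 * K) * (1 + norm (\<theta> - \<theta>s))\<^sup>2"
proof -
  let ?n = "norm (\<theta> - \<theta>s)"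
  \<comment> \<open>With this scale both terms of \<open>square_le_powr\<close> grow like
    \<open>s\<^sup>2\<close>, so the higher moment bound gives a variance of quadratic
    growth.\<close>
  define s where "s = 1 + ?n"
  have s: "s \<ge> 1" "s > 0" by (auto simp: s_def add_pos_nonneg)
  let ?y = "\<lambda>z. norm (gf \<theta> z - dF \<theta>)"
  have "(\<integral>\<^sup>+z. ennreal ((?y z)\<^sup>2) \<partial>P) \<le> (\<integral>\<^sup>+z. ennreal (s\<^sup>2) + ennreal (s powr (- \<delta>)) * ennreal (?y z powr (2 + \<delta>)) \<partial>P)"
  proof (rule nn_integral_mono)
    fix z
    have "(?y z)\<^sup>2 \<le> s\<^sup>2 + s powr (- \<delta>) * ?y z powr (2 + \<delta>)"
      using s \<delta> by (intro square_le_powr) auto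
    then show "ennreal ((?y z)\<^sup>2) \<le> ennreal (s\<^sup>2) + ennreal (s powr (- \<delta>)) * ennreal (?y z powr (2 + \<delta>))"
      by (simp add: ennreal_mult[symmetric] ennreal_plus[symmetric] ennreal_leI del: ennreal_plus)
  qed
  also have "\<dots> = ennreal (s\<^sup>2) + ennreal (s powr (- \<delta>)) * (\<integral>\<^sup>+z. ennreal (?y z powr (2 + \<delta>)) \<partial>P)"
    by (simp add: nn_integral_add nn_integral_cmult P.emeasure_space_1)
  also have "\<dots> \<le> ennreal (s\<^sup>2) + ennreal (s powr (- \<delta>)) * ennreal (K * (?n powr (2 + \<delta>) + 1))"
    using grad_moment[of \<theta>] by (intro add_left_mono mult_left_mono) (auto simp: gf_def)
  also have "\<dots> = ennreal (s\<^sup>2 + s powr (- \<delta>) * (K * (?n powr (2 + \<delta>) + 1)))"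
    using K by (simp add: ennreal_mult[symmetric] ennreal_plus[symmetric] del: ennreal_plus)
  also have "\<dots> \<le> ennreal ((1 + 2 * K) * s\<^sup>2)"
  proof (rule ennreal_leI)
    have "?n powr (2 + \<delta>) \<le> s powr (2 + \<delta>)" using \<delta> by (intro powr_mono2) (auto simp: s_def)
    moreover have "1 \<le> s powr (2 + \<delta>)" using s \<delta> by (intro ge_one_powr_ge_zero) auto
    ultimately have "s powr (- \<delta>) * (K * (?n powr (2 + \<delta>) + 1)) \<le> s powr (- \<delta>) * (K * (2 * s powr (2 + \<delta>)))"
      using K by (intro mult_left_mono) auto
    also have "\<dots> = 2 * K * (s powr (- \<delta>) * s powr (2 + \<delta>))" by simp
    also have "s powr (- \<delta>) * s powr (2 + \<delta>) = s\<^sup>2"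
      unfolding powr_add[symmetric] using s by simp
    finally show "s\<^sup>2 + s powr (- \<delta>) * (K * (?n powr (2 + \<delta>) + 1)) \<le> (1 + 2 * K) * s\<^sup>2"
      by (simp add: algebra_simps)
  qed
  finally have b: "(\<integral>\<^sup>+z. ennreal ((?y z)\<^sup>2) \<partial>P) \<le> ennreal ((1 + 2 * K) * s\<^sup>2)" .
  show int: "integrable P (\<lambda>z. (?y z)\<^sup>2)"
    by (rule integrableI_nonneg) (use b in \<open>auto intro: le_less_trans\<close>)
  show "(\<integral>z. (?y z)\<^sup>2 \<partial>P) \<le> (1 + 2 * K) * (1 + norm (\<theta> - \<theta>s))\<^sup>2"
    using b K by (subst (asm) nn_integral_eq_integral[OF int]) (auto simp: ennreal_le_iff s_def)
qed

lemma gf_square: "integrable P (\<lambda>z. (norm (gf \<theta> z))\<^sup>2)"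
  using integrable_norm_square_add[OF _ _ gf_deviation(1)[of \<theta>], of "\<lambda>_. dF \<theta>"] by simp

section \<open>Geometry of the risk\<close>

lemma dF_minimum: "dF \<theta>s = 0"
proof -
  have min: "F \<theta>s \<le> F y" for y
    using argmin by (auto simp: is_arg_min_linorder)
  have "(\<lambda>h. h \<bullet> dF \<theta>s) = (\<lambda>h. 0)"
    by (rule differential_zero_maxmin[OF _ open_UNIV grad_has_derivative[OF F_diff]]) (use min in auto)
  then have "dF \<theta>s \<bullet> dF \<theta>s = 0" by meson
  then show ?thesis by simp
qed

lemma hess_psd: "pos_semidef (hessian F \<theta>)"
  using F_hess_bounds[of \<theta>] by (simp add: loewner_le_def)

lemma mat_vector_mult: "mat c *v x = c *\<^sub>R x" for x :: "real^'d"
  by (simp add: vec_eq_iff mat_def matrix_vector_mult_def if_distrib[of "\<lambda>a. a * _"] cong: if_cong)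

lemma hess_nonneg: "0 \<le> u \<bullet> (hessian F \<theta> *v u)"
  by (rule pos_semidef_quadratic_form[OF hess_psd])

lemma hess_upper: "u \<bullet> (hessian F \<theta> *v u) \<le> L * (norm u)\<^sup>2"
  using pos_semidef_quadratic_form[of "mat L - hessian F \<theta>" u] F_hess_bounds[of \<theta>]
  by (simp add: loewner_le_def matrix_vector_mult_diff_rdistrib mat_vector_mult inner_diff_right power2_norm_eq_inner)

lemma hess_lower: "\<theta> \<in> ball \<theta>s \<delta>1 \<Longrightarrow> \<mu> * (norm u)\<^sup>2 \<le> u \<bullet> (hessian F \<theta> *v u)"
  using pos_semidef_quadratic_form[of "hessian F \<theta> - mat \<mu>" u] F_local_strong[of \<theta>]
  by (simp add: loewner_le_def matrix_vector_mult_diff_rdistrib mat_vector_mult inner_diff_right power2_norm_eq_inner)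

lemma L_nonneg: "0 \<le> L"
proof -
  have "0 \<le> L * (norm (axis undefined 1 :: real^'d))\<^sup>2"
    using order_trans[OF hess_nonneg hess_upper] .
  then show ?thesis by simp
qed

text \<open>The gradient is paired with a fixed \<open>y\<close> because the mean value theorem is
  scalar.\<close>

lemma dF_mvt:
  assumes "a < b"
  shows "\<exists>t. a < t \<and> t < b \<and> y \<bullet> dF (x + b *\<^sub>R u) - y \<bullet> dF (x + a *\<^sub>R u) = (b - a) * (y \<bullet> (hessian F (x + t *\<^sub>R u) *v u))"
proof -
  have "((\<lambda>t. y \<bullet> dF (x + t *\<^sub>R u)) has_real_derivative (y \<bullet> (hessian F (x + t *\<^sub>R u) *v u))) (at t)" for t
    using hessian_line_derivative[OF F_twice_diff, of x u t]
    by (simp add: has_real_derivative_iff_has_vector_derivative bounded_linear.has_vector_derivative[OF bounded_linear_inner_right])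
  then show ?thesis using MVT2[OF assms, of "\<lambda>t. y \<bullet> dF (x + t *\<^sub>R u)" "\<lambda>t. y \<bullet> (hessian F (x + t *\<^sub>R u) *v u)"]
    by (auto simp: mult.commute)
qed

lemma dF_nonneg: "0 \<le> x \<bullet> dF (\<theta>s + x)"
  using dF_mvt[of 0 1 x \<theta>s x] hess_nonneg by (auto simp: dF_minimum)

lemma dF_local: "norm x \<le> \<delta>1 / 2 \<Longrightarrow> \<mu> * (norm x)\<^sup>2 \<le> x \<bullet> dF (\<theta>s + x)"
proof -
  assume x: "norm x \<le> \<delta>1 / 2"
  obtain t where t: "0 < t" "t < 1" "x \<bullet> dF (\<theta>s + x) = x \<bullet> (hessian F (\<theta>s + t *\<^sub>R x) *v x)"
    using dF_mvt[of 0 1 x \<theta>s x] by (auto simp: dF_minimum)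
  have "norm (t *\<^sub>R x) \<le> 1 * norm x" using t by (simp add: mult_left_le_one_le)
  then have "\<theta>s + t *\<^sub>R x \<in> ball \<theta>s \<delta>1" using x \<delta>1 by (simp add: dist_norm)
  from hess_lower[OF this, of x] t show ?thesis by simp
qed

text \<open>Along a ray, \<open>x \<bullet> dF (\<theta>s + t *\<^sub>R x)\<close> is nondecreasing
  in \<open>t\<close>, so the bound on the sphere of radius \<open>e\<close> propagates
  outwards.\<close>

lemma dF_away:
  assumes e: "0 < e" "e \<le> \<delta>1 / 2" "e \<le> norm x"
  shows "\<mu> * e\<^sup>2 \<le> x \<bullet> dF (\<theta>s + x)"
proof (cases "e = norm x")
  case True
  then show ?thesis using dF_local[of x] e by simp
next
  case False
  define a where "a = e / norm x"
  have a: "0 < a" "a < 1" using e False by (auto simp: a_def divide_simps)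
  have "norm x > 0" using e by linarith
  then have n: "norm (a *\<^sub>R x) = e" using e by (simp add: a_def)
  obtain t where t: "x \<bullet> dF (\<theta>s + 1 *\<^sub>R x) - x \<bullet> dF (\<theta>s + a *\<^sub>R x) = (1 - a) * (x \<bullet> (hessian F (\<theta>s + t *\<^sub>R x) *v x))"
    using dF_mvt[OF a(2), of x \<theta>s x] by blast
  have "0 \<le> (1 - a) * (x \<bullet> (hessian F (\<theta>s + t *\<^sub>R x) *v x))" using a hess_nonneg by simp
  with t have 1: "x \<bullet> dF (\<theta>s + a *\<^sub>R x) \<le> x \<bullet> dF (\<theta>s + x)" by simp
  have "\<mu> * e\<^sup>2 \<le> a * (x \<bullet> dF (\<theta>s + a *\<^sub>R x))"
    using dF_local[of "a *\<^sub>R x"] n e by simp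
  also have "\<dots> \<le> 1 * (x \<bullet> dF (\<theta>s + a *\<^sub>R x))"
  proof (rule mult_right_mono)
    have "0 \<le> a * (x \<bullet> dF (\<theta>s + a *\<^sub>R x))" using dF_nonneg[of "a *\<^sub>R x"] by simp
    then show "0 \<le> x \<bullet> dF (\<theta>s + a *\<^sub>R x)" using a by (simp add: zero_le_mult_iff)
  qed (use a in simp)
  finally show ?thesis using 1 by simp
qed

lemma dF_growth: "norm (dF (\<theta>s + x)) \<le> L * norm x"
proof (cases "dF (\<theta>s + x) = 0 \<or> x = 0")
  case True
  then show ?thesis using L_nonneg dF_minimum by auto
next
  case False
  let ?g = "dF (\<theta>s + x)"
  \<comment> \<open>The gradient rescaled to the length of \<open>x\<close>, as
    \<open>pos_semidef_bilinear_bound\<close> requires.\<close>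
  define y where "y = (norm x / norm ?g) *\<^sub>R ?g"
  have ny: "norm y = norm x" using False by (simp add: y_def)
  obtain t where t: "y \<bullet> ?g = y \<bullet> (hessian F (\<theta>s + t *\<^sub>R x) *v x)"
    using dF_mvt[of 0 1 y \<theta>s x] by (auto simp: dF_minimum)
  have "y \<bullet> ?g = norm x * norm ?g"
    using False by (simp add: y_def power2_norm_eq_inner[symmetric] power2_eq_square)
  moreover have "y \<bullet> ?g \<le> L * (norm x)\<^sup>2"
    unfolding t by (rule pos_semidef_bilinear_bound[OF hess_psd hess_upper ny])
  ultimately have "norm x * norm ?g \<le> norm x * (L * norm x)" by (simp add: power2_eq_square mult_ac)
  then show ?thesis using False by simp
qed

text \<open>Two mean values: the quotient is a directional derivative at an intermediate point, and
  its distance from the one at \<open>x\<close> is a Hessian form times a factor below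
  \<open>h\<close>.\<close>

lemma F_quotient_bound:
  assumes "0 < h"
  shows "\<bar>(F (x + h *\<^sub>R v) - F x) / h - v \<bullet> dF x\<bar> \<le> L * h * (norm v)\<^sup>2"
proof -
  have "\<exists>t. 0 < t \<and> t < h \<and> F (x + h *\<^sub>R v) - F (x + 0 *\<^sub>R v) = (h - 0) * (v \<bullet> dF (x + t *\<^sub>R v))"
    using assms by (intro MVT2 grad_line_derivative F_diff)
  then obtain t where t: "0 < t" "t < h" "F (x + h *\<^sub>R v) - F x = h * (v \<bullet> dF (x + t *\<^sub>R v))" by auto
  obtain s where s: "v \<bullet> dF (x + t *\<^sub>R v) - v \<bullet> dF x = t * (v \<bullet> (hessian F (x + s *\<^sub>R v) *v v))"
    using dF_mvt[OF t(1), of v x v] by auto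
  have "(F (x + h *\<^sub>R v) - F x) / h - v \<bullet> dF x = t * (v \<bullet> (hessian F (x + s *\<^sub>R v) *v v))"
    using t(3) s assms by simp
  also have "\<bar>\<dots>\<bar> \<le> h * (L * (norm v)\<^sup>2)"
    using t hess_nonneg[of v] hess_upper[of v] by (auto simp: abs_mult intro!: mult_mono)
  finally show ?thesis by (simp add: mult_ac)
qed

section \<open>Linearisation of the gradient at the minimiser\<close>

lemma lin_err_square:
  shows "integrable P (\<lambda>z. (norm (lin_err x z))\<^sup>2)"
    and "(\<integral>z. (norm (lin_err x z))\<^sup>2 \<partial>P) \<le> Lh * (norm x)^4"
    and "integrable P (lin_err x)" and "norm (\<integral>z. lin_err x z \<partial>P) \<le> sqrt Lh * (norm x)\<^sup>2"
proof -
  show int: "integrable P (\<lambda>z. (norm (lin_err x z))\<^sup>2)"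
    by (rule integrableI_nonneg) (use lin_err_nn_integral[of x] in \<open>auto intro: le_less_trans\<close>)
  show le: "(\<integral>z. (norm (lin_err x z))\<^sup>2 \<partial>P) \<le> Lh * (norm x)^4"
    using lin_err_nn_integral[of x] Lh by (subst (asm) nn_integral_eq_integral[OF int]) (auto simp: ennreal_le_iff)
  show "integrable P (lin_err x)"
    by (rule integrable_norm_squareD[OF P.finite_measure_axioms _ int]) simp
  have "(norm (\<integral>z. lin_err x z \<partial>P))\<^sup>2 \<le> Lh * (norm x)^4"
    using P.norm_expectation_square_le(2)[OF lin_err_measurable int] le by simp
  then have "norm (\<integral>z. lin_err x z \<partial>P) \<le> sqrt (Lh * (norm x)^4)" by (rule real_le_rsqrt)
  also have "\<dots> = sqrt Lh * (norm x)\<^sup>2"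
  proof -
    have "(norm x)^4 = ((norm x)\<^sup>2)\<^sup>2" by simp
    then have "sqrt ((norm x)^4) = (norm x)\<^sup>2" by (simp only: real_sqrt_abs) simp
    then show ?thesis by (simp add: real_sqrt_mult)
  qed
  finally show "norm (\<integral>z. lin_err x z \<partial>P) \<le> sqrt Lh * (norm x)\<^sup>2" .
qed

lemma hf_split: "hf \<theta>s z *v x = (gf (\<theta>s + x) z - gf \<theta>s z) - lin_err x z"
  by (simp add: lin_err_def)

text \<open>The product is a gradient increment minus the Taylor remainder, both square
  integrable.\<close>

lemma hf_vector_square: "integrable P (\<lambda>z. (norm (hf \<theta>s z *v x))\<^sup>2)"
proof -
  have "integrable P (\<lambda>z. (norm (gf (\<theta>s + x) z + - gf \<theta>s z))\<^sup>2)"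
    by (rule integrable_norm_square_add) (use gf_square in auto)
  then have "integrable P (\<lambda>z. (norm ((gf (\<theta>s + x) z - gf \<theta>s z) + - lin_err x z))\<^sup>2)"
    by (intro integrable_norm_square_add) (use lin_err_square in auto)
  then show ?thesis by (simp add: hf_split)
qed

text \<open>Both sides are linear in \<open>x\<close> and agree up to \<open>O(\<parallel>x\<parallel>\<^sup>2)\<close>, so no interchange of
  differentiation and expectation has to be justified separately.\<close>

lemma expected_hessian: "(\<integral>z. hf \<theta>s z *v x \<partial>P) = H *v x"
proof -
  let ?T = "\<lambda>x. \<integral>z. hf \<theta>s z *v x \<partial>P"
  have e: "dF (\<theta>s + t *\<^sub>R x) = t *\<^sub>R ?T x + (\<integral>z. lin_err (t *\<^sub>R x) z \<partial>P)" for t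
  proof -
    have "?T (t *\<^sub>R x) = dF (\<theta>s + t *\<^sub>R x) - dF \<theta>s - (\<integral>z. lin_err (t *\<^sub>R x) z \<partial>P)"
      unfolding hf_split using gf_integral lin_err_square(3) by simp
    then show ?thesis by (simp add: dF_minimum matrix_vector_mult_scaleR)
  qed
  have d: "((\<lambda>t. dF (\<theta>s + t *\<^sub>R x)) has_vector_derivative (H *v x)) (at 0)"
    using hessian_line_derivative[OF F_twice_diff, of \<theta>s x 0] by simp
  have "(\<lambda>n. real (Suc n) *\<^sub>R (dF (\<theta>s + (0 + 1 / real (Suc n)) *\<^sub>R x) - dF (\<theta>s + 0 *\<^sub>R x))) \<longlonglongrightarrow> H *v x"
    by (rule difference_quotient_tendsto[OF d])
  moreover have "real (Suc n) *\<^sub>R (dF (\<theta>s + (0 + 1 / real (Suc n)) *\<^sub>R x) - dF (\<theta>s + 0 *\<^sub>R x)) =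
      ?T x + real (Suc n) *\<^sub>R (\<integral>z. lin_err ((1 / real (Suc n)) *\<^sub>R x) z \<partial>P)" for n
    by (simp add: e dF_minimum scaleR_add_right del: of_nat_Suc)
  ultimately have l1: "(\<lambda>n. ?T x + real (Suc n) *\<^sub>R (\<integral>z. lin_err ((1 / real (Suc n)) *\<^sub>R x) z \<partial>P)) \<longlonglongrightarrow> H *v x"
    by simp
  have "(\<lambda>n. real (Suc n) *\<^sub>R (\<integral>z. lin_err ((1 / real (Suc n)) *\<^sub>R x) z \<partial>P)) \<longlonglongrightarrow> 0"
  proof (rule Lim_null_comparison)
    have "norm (real (Suc n) *\<^sub>R (\<integral>z. lin_err ((1 / real (Suc n)) *\<^sub>R x) z \<partial>P)) \<le> (sqrt Lh * (norm x)\<^sup>2) * (1 / real (Suc n))" for n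
    proof -
      have "norm (real (Suc n) *\<^sub>R (\<integral>z. lin_err ((1 / real (Suc n)) *\<^sub>R x) z \<partial>P)) = real (Suc n) * norm (\<integral>z. lin_err ((1 / real (Suc n)) *\<^sub>R x) z \<partial>P)"
        by simp
      also have "\<dots> \<le> real (Suc n) * (sqrt Lh * (norm ((1 / real (Suc n)) *\<^sub>R x))\<^sup>2)"
        by (intro mult_left_mono lin_err_square(4)) simp
      also have "\<dots> = (sqrt Lh * (norm x)\<^sup>2) * (1 / real (Suc n))"
        by (simp add: power2_eq_square field_simps del: of_nat_Suc)
      finally show ?thesis .
    qed
    then show "\<forall>\<^sub>F n in sequentially. norm (real (Suc n) *\<^sub>R (\<integral>z. lin_err ((1 / real (Suc n)) *\<^sub>R x) z \<partial>P)) \<le> (sqrt Lh * (norm x)\<^sup>2) * (1 / real (Suc n))"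
      by (rule always_eventually[OF allI])
    show "(\<lambda>n. (sqrt Lh * (norm x)\<^sup>2) * (1 / real (Suc n))) \<longlonglongrightarrow> 0"
      using tendsto_mult_left[OF LIMSEQ_Suc[OF lim_1_over_n], of "sqrt Lh * (norm x)\<^sup>2"] by simp
  qed
  from tendsto_add[OF tendsto_const[of "?T x"] this]
  have "(\<lambda>n. ?T x + real (Suc n) *\<^sub>R (\<integral>z. lin_err ((1 / real (Suc n)) *\<^sub>R x) z \<partial>P)) \<longlonglongrightarrow> ?T x" by simp
  from LIMSEQ_unique[OF this l1] show ?thesis .
qed

lemma dF_linearization: "norm (dF (\<theta>s + x) - H *v x) \<le> sqrt Lh * (norm x)\<^sup>2"
proof -
  have "dF (\<theta>s + x) - H *v x = (\<integral>z. lin_err x z \<partial>P)"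
    unfolding expected_hessian[symmetric] hf_split using gf_integral lin_err_square(3) by (simp add: dF_minimum)
  then show ?thesis using lin_err_square(4)[of x] by simp
qed

text \<open>Mean-square Lipschitz constant at the minimiser, the larger of two regimes. For
  \<open>norm x \<le> 1\<close> the linear term is bounded through the Hessian on basis vectors, and
  \<open>(norm x)^4 \<le> (norm x)\<^sup>2\<close> handles the remainder. For
  \<open>norm x > 1\<close> the quadratic growth of the variance is used, with
  \<open>(1 + norm x)\<^sup>2 \<le> 4 * (norm x)\<^sup>2\<close>.\<close>

definition gf_lip :: real where
  "gf_lip = max (2 * (\<integral>z. (\<Sum>b\<in>Basis. norm (hf \<theta>s z *v b))\<^sup>2 \<partial>P) + 2 * Lh)
                (4 * (4 * (1 + 2 * K)) + 4 * (1 + 2 * K) + 4 * L\<^sup>2)"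

lemma gf_lip_nonneg: "0 \<le> gf_lip"
  using K by (simp add: gf_lip_def le_max_iff_disj)

lemma gf_increment:
  shows "integrable P (\<lambda>z. (norm (gf (\<theta>s + x) z - gf \<theta>s z))\<^sup>2)"
    and "(\<integral>z. (norm (gf (\<theta>s + x) z - gf \<theta>s z))\<^sup>2 \<partial>P) \<le> gf_lip * (norm x)\<^sup>2"
proof -
  show int: "integrable P (\<lambda>z. (norm (gf (\<theta>s + x) z - gf \<theta>s z))\<^sup>2)"
    using integrable_norm_square_add[of "gf (\<theta>s + x)" P "\<lambda>z. - gf \<theta>s z"] gf_square by simp
  show "(\<integral>z. (norm (gf (\<theta>s + x) z - gf \<theta>s z))\<^sup>2 \<partial>P) \<le> gf_lip * (norm x)\<^sup>2"
  proof (cases "norm x \<le> 1")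
    case True
    \<comment> \<open>Stands in for the operator norm of the sample Hessian: its square
      integrability follows vector by vector from \<open>hf_vector_square\<close>.\<close>
    let ?s = "\<lambda>z. \<Sum>b\<in>Basis. norm (hf \<theta>s z *v b)"
    have isq: "integrable P (\<lambda>z. (?s z)\<^sup>2)"
    proof -
      have "integrable P (\<lambda>z. (norm (\<Sum>b\<in>B. norm (hf \<theta>s z *v b)))\<^sup>2)" if "finite B" for B :: "(real^'d) set"
        using that
      proof induction
        case (insert b B)
        have "integrable P (\<lambda>z. (norm (norm (hf \<theta>s z *v b) + (\<Sum>b\<in>B. norm (hf \<theta>s z *v b))))\<^sup>2)"
          by (rule integrable_norm_square_add) (use insert.IH hf_vector_square in auto)
        then show ?case using insert.hyps by simp
      qed simp
      from this[OF finite_Basis] show ?thesis by simp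
    qed
    have hb: "norm (hf \<theta>s z *v x) \<le> norm x * ?s z" for z
    proof -
      have "hf \<theta>s z *v x = hf \<theta>s z *v (\<Sum>b\<in>Basis. (x \<bullet> b) *\<^sub>R b)" by (simp add: euclidean_representation)
      also have "\<dots> = (\<Sum>b\<in>Basis. (x \<bullet> b) *\<^sub>R (hf \<theta>s z *v b))"
        by (simp add: linear_sum[OF matrix_vector_mul_linear] matrix_vector_mult_scaleR)
      also have "norm \<dots> \<le> (\<Sum>b\<in>Basis. norm x * norm (hf \<theta>s z *v b))"
        by (intro sum_norm_le) (auto intro!: mult_right_mono Basis_le_norm)
      finally show ?thesis by (simp add: sum_distrib_left)
    qed
    have "(\<integral>z. (norm (gf (\<theta>s + x) z - gf \<theta>s z))\<^sup>2 \<partial>P) \<le> (\<integral>z. 2 * ((norm x)\<^sup>2 * (?s z)\<^sup>2) + 2 * (norm (lin_err x z))\<^sup>2 \<partial>P)"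
    proof (rule integral_mono[OF int])
      show "integrable P (\<lambda>z. 2 * ((norm x)\<^sup>2 * (?s z)\<^sup>2) + 2 * (norm (lin_err x z))\<^sup>2)"
        using isq lin_err_square(1) by simp
      fix z
      have "(norm (gf (\<theta>s + x) z - gf \<theta>s z))\<^sup>2 \<le> 2 * (norm (hf \<theta>s z *v x))\<^sup>2 + 2 * (norm (lin_err x z))\<^sup>2"
        using norm_add_square_le[of "hf \<theta>s z *v x" "lin_err x z"] by (simp add: lin_err_def)
      also have "(norm (hf \<theta>s z *v x))\<^sup>2 \<le> (norm x * ?s z)\<^sup>2" by (intro power_mono hb) simp
      finally show "(norm (gf (\<theta>s + x) z - gf \<theta>s z))\<^sup>2 \<le> 2 * ((norm x)\<^sup>2 * (?s z)\<^sup>2) + 2 * (norm (lin_err x z))\<^sup>2"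
        by (simp add: power_mult_distrib)
    qed
    also have "\<dots> = 2 * ((norm x)\<^sup>2 * (\<integral>z. (?s z)\<^sup>2 \<partial>P)) + 2 * (\<integral>z. (norm (lin_err x z))\<^sup>2 \<partial>P)"
      using isq lin_err_square(1)[of x] by simp
    also have "\<dots> \<le> 2 * ((norm x)\<^sup>2 * (\<integral>z. (?s z)\<^sup>2 \<partial>P)) + 2 * (Lh * (norm x)\<^sup>2)"
    proof -
      have "Lh * (norm x)^4 \<le> Lh * (norm x)\<^sup>2"
        using Lh True by (intro mult_left_mono power_decreasing) auto
      then show ?thesis using lin_err_square(2)[of x] by linarith
    qed
    also have "\<dots> = (2 * (\<integral>z. (?s z)\<^sup>2 \<partial>P) + 2 * Lh) * (norm x)\<^sup>2" by (simp add: algebra_simps)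
    also have "\<dots> \<le> gf_lip * (norm x)\<^sup>2"
      by (intro mult_right_mono) (auto simp: gf_lip_def)
    finally show ?thesis .
  next
    case False
    let ?a = "\<lambda>z. gf (\<theta>s + x) z - dF (\<theta>s + x)" and ?b = "\<lambda>z. gf \<theta>s z - dF \<theta>s"
    have "(\<integral>z. (norm (gf (\<theta>s + x) z - gf \<theta>s z))\<^sup>2 \<partial>P) \<le> (\<integral>z. 4 * (norm (?a z))\<^sup>2 + 4 * (norm (?b z))\<^sup>2 + 4 * (norm (dF (\<theta>s + x)))\<^sup>2 \<partial>P)"
    proof (rule integral_mono[OF int])
      show "integrable P (\<lambda>z. 4 * (norm (?a z))\<^sup>2 + 4 * (norm (?b z))\<^sup>2 + 4 * (norm (dF (\<theta>s + x)))\<^sup>2)"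
        using gf_deviation(1) by simp
      fix z
      have "(norm (gf (\<theta>s + x) z - gf \<theta>s z))\<^sup>2 \<le> 2 * (norm (?a z + - ?b z))\<^sup>2 + 2 * (norm (dF (\<theta>s + x)))\<^sup>2"
        using norm_add_square_le[of "?a z + - ?b z" "dF (\<theta>s + x)"] by (simp add: dF_minimum)
      moreover have "(norm (?a z + - ?b z))\<^sup>2 \<le> 2 * (norm (?a z))\<^sup>2 + 2 * (norm (?b z))\<^sup>2"
        using norm_add_square_le[of "?a z" "- ?b z"] by (simp only: norm_minus_cancel)
      moreover have "0 \<le> (norm (dF (\<theta>s + x)))\<^sup>2" by simp
      ultimately show "(norm (gf (\<theta>s + x) z - gf \<theta>s z))\<^sup>2 \<le> 4 * (norm (?a z))\<^sup>2 + 4 * (norm (?b z))\<^sup>2 + 4 * (norm (dF (\<theta>s + x)))\<^sup>2"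
        by linarith
    qed
    also have "\<dots> = 4 * (\<integral>z. (norm (?a z))\<^sup>2 \<partial>P) + 4 * (\<integral>z. (norm (?b z))\<^sup>2 \<partial>P) + 4 * (norm (dF (\<theta>s + x)))\<^sup>2"
      using gf_deviation(1) by (simp add: P.prob_space)
    also have "\<dots> \<le> 4 * ((1 + 2 * K) * (1 + norm x)\<^sup>2) + 4 * (1 + 2 * K) + 4 * (L\<^sup>2 * (norm x)\<^sup>2)"
    proof -
      have "(norm (dF (\<theta>s + x)))\<^sup>2 \<le> (L * norm x)\<^sup>2" by (intro power_mono dF_growth) simp
      then show ?thesis
        using gf_deviation(2)[of "\<theta>s + x"] gf_deviation(2)[of \<theta>s] by (simp add: power_mult_distrib)
    qed
    also have "\<dots> \<le> (4 * (4 * (1 + 2 * K)) + 4 * (1 + 2 * K) + 4 * L\<^sup>2) * (norm x)\<^sup>2"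
    proof -
      have "(1 + norm x)\<^sup>2 \<le> (2 * norm x)\<^sup>2" using False by (intro power_mono) auto
      then have "(1 + 2 * K) * (1 + norm x)\<^sup>2 \<le> (1 + 2 * K) * (4 * (norm x)\<^sup>2)"
        using K by (intro mult_left_mono) (auto simp: power_mult_distrib)
      moreover have "1\<^sup>2 \<le> (norm x)\<^sup>2" using False by (intro power_mono) auto
      then have "(1 + 2 * K) * 1 \<le> (1 + 2 * K) * (norm x)\<^sup>2" using K by (intro mult_left_mono) auto
      moreover have "4 * (k * a) + 4 * k + 4 * (l * y) \<le> (4 * (4 * k) + 4 * k + 4 * l) * y"
        if "k * a \<le> k * (4 * y)" "k * 1 \<le> k * y" for k a l y :: real
        using that by (simp add: algebra_simps)
      ultimately show ?thesis by blast
    qed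
    also have "\<dots> \<le> gf_lip * (norm x)\<^sup>2"
      by (intro mult_right_mono) (auto simp: gf_lip_def)
    finally show ?thesis .
  qed
qed

end

section \<open>Random directions\<close>

locale direction_law = prob_space Pv for Pv :: "(real^'d) measure" +
  fixes \<delta> :: real
  assumes sets_Pv: "sets Pv = sets borel"
    and isotropic: "has_bochner_integral Pv (\<lambda>x. outer x x) (mat 1)"
    and moment: "integrable Pv (\<lambda>x. norm x powr (6 + 3 * \<delta>))" and \<delta>_pos: "0 < \<delta>"
begin

lemmas sets_Pv_cong [measurable_cong] = sets_Pv

lemma norm_power_integrable: "k \<le> 6 \<Longrightarrow> integrable Pv (\<lambda>x. norm x ^ k)"
proof (rule Bochner_Integration.integrable_bound[of _ "\<lambda>x. 1 + norm x powr (6 + 3 * \<delta>)"])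
  assume k: "k \<le> 6"
  show "integrable Pv (\<lambda>x. 1 + norm x powr (6 + 3 * \<delta>))" using moment by simp
  have "norm x ^ k \<le> 1 + norm x powr (6 + 3 * \<delta>)" for x :: "real^'d"
  proof (cases "norm x \<le> 1")
    case True
    then have "norm x ^ k \<le> 1" by (simp add: power_le_one)
    then show ?thesis by (simp add: add_increasing2)
  next
    case False
    then have "norm x > 0" by linarith
    then have "norm x ^ k = norm x powr real k" by (rule powr_realpow[symmetric])
    also have "\<dots> \<le> norm x powr (6 + 3 * \<delta>)" using False k \<delta>_pos by (intro powr_mono) auto
    finally show ?thesis by simp
  qed
  then show "AE x in Pv. norm (norm x ^ k) \<le> norm (1 + norm x powr (6 + 3 * \<delta>))"
    by (auto intro!: AE_I2 order_trans[OF _ abs_ge_self])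
qed measurable

lemma isotropic_vector:
  shows "integrable Pv (\<lambda>x. (x \<bullet> y) *\<^sub>R x)" "(\<integral>x. (x \<bullet> y) *\<^sub>R x \<partial>Pv) = y"
proof -
  have bl: "bounded_linear (\<lambda>A :: real^'d^'d. A *v y)"
    unfolding linear_conv_bounded_linear[symmetric]
    by (auto intro!: linearI simp: matrix_vector_mult_add_rdistrib scaleR_matrix_vector_assoc)
  have "has_bochner_integral Pv (\<lambda>x. outer x x *v y) (mat 1 *v y)"
    by (rule has_bochner_integral_bounded_linear[OF bl isotropic])
  then have "has_bochner_integral Pv (\<lambda>x. (x \<bullet> y) *\<^sub>R x) y"
    by (simp add: outer_vector_mult)
  then show "integrable Pv (\<lambda>x. (x \<bullet> y) *\<^sub>R x)" "(\<integral>x. (x \<bullet> y) *\<^sub>R x \<partial>Pv) = y"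
    by (auto simp: has_bochner_integral_iff)
qed

lemma isotropic_form:
  shows "integrable Pv (\<lambda>x. (x \<bullet> y) * (t \<bullet> x))" "(\<integral>x. (x \<bullet> y) * (t \<bullet> x) \<partial>Pv) = t \<bullet> y"
proof -
  have e: "(x \<bullet> y) * (t \<bullet> x) = t \<bullet> ((x \<bullet> y) *\<^sub>R x)" for x by simp
  show "integrable Pv (\<lambda>x. (x \<bullet> y) * (t \<bullet> x))" "(\<integral>x. (x \<bullet> y) * (t \<bullet> x) \<partial>Pv) = t \<bullet> y"
    unfolding e using isotropic_vector[of y] by (auto simp del: inner_scaleR_right)
qed

end

section \<open>Outer products and quadratic forms\<close>

lemma norm_outer: "norm (outer a b) = norm a * norm b" for a b :: "real^'d"
proof -
  have "outer a b $ i = (a $ i) *\<^sub>R b" for i by (simp add: outer_def vec_eq_iff)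
  then have "norm (outer a b) = L2_set (\<lambda>i. norm (a $ i) * norm b) UNIV"
    unfolding norm_vec_def[of "outer a b"] by (simp only: norm_scaleR real_norm_def)
  also have "\<dots> = norm a * norm b"
    unfolding norm_vec_def[of a] by (simp add: L2_set_left_distrib)
  finally show ?thesis .
qed

lemma outer_sandwich: "outer x x ** S ** outer x x = (x \<bullet> (S *v x)) *\<^sub>R outer x x" for x :: "real^'d"
proof (rule matrix_eq[THEN iffD2], intro allI)
  fix y
  show "(outer x x ** S ** outer x x) *v y = ((x \<bullet> (S *v x)) *\<^sub>R outer x x) *v y"
    by (simp add: matrix_vector_mul_assoc[symmetric] outer_vector_mult scaleR_matrix_vector_assoc[symmetric]
        matrix_vector_mult_scaleR mult.commute)
qed

lemma outer_measurable: "(\<lambda>x. outer x x) \<in> borel_measurable borel"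
proof -
  have "continuous_on UNIV (\<lambda>x :: real^'d. \<chi> i j. x $ i * x $ j)"
    by (intro continuous_on_vec_lambda continuous_intros)
  then show ?thesis unfolding outer_def by (rule borel_measurable_continuous_onI)
qed

lemma outer_form: "t \<bullet> (outer x x *v t) = (x \<bullet> t)\<^sup>2" for x t :: "real^'d"
  by (simp add: outer_vector_mult power2_eq_square inner_commute)

lemma quadratic_form_bounded_linear: "bounded_linear (\<lambda>A :: real^'d^'d. t \<bullet> (A *v t))"
  unfolding linear_conv_bounded_linear[symmetric]
  by (auto intro!: linearI simp: matrix_vector_mult_add_rdistrib scaleR_matrix_vector_assoc[symmetric] inner_add_right)

section \<open>Estimates for a single direction\<close>

locale kw_sampling = smooth_loss P f F \<theta>s L \<delta>1 \<mu> \<delta> K Lh + V: direction_law Pv \<delta>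
  for P :: "'z measure" and f :: "real^'d \<Rightarrow> 'z \<Rightarrow> real" and F \<theta>s L \<delta>1 \<mu> \<delta> K Lh and Pv :: "(real^'d) measure" +
  fixes m :: nat
  assumes m: "m \<ge> 1"
begin

lemmas sets_Pv_cong [measurable_cong] = V.sets_Pv

sublocale PV: pair_prob_space P Pv ..

abbreviation mom :: "nat \<Rightarrow> real" where "mom k \<equiv> (\<integral>x. norm x ^ k \<partial>Pv)"

text \<open>The limit of \<open>kw_gradient\<close> at the minimiser as the increment tends to
  0.\<close>

definition dir0 :: "'z \<Rightarrow> real^'d \<Rightarrow> real^'d" where
  "dir0 z v = (v \<bullet> gf \<theta>s z) *\<^sub>R v"

lemma dir0_measurable [measurable]: "(\<lambda>p. dir0 (fst p) (snd p)) \<in> borel_measurable (P \<Otimes>\<^sub>M Pv)"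
  unfolding dir0_def by measurable

lemma shift_measurable [measurable]:
  "(\<lambda>p. f (\<theta> + h *\<^sub>R snd p) (fst p)) \<in> borel_measurable (P \<Otimes>\<^sub>M Pv)"
  using measurable_compose[OF _ f_joint, of "\<lambda>p. (\<theta> + h *\<^sub>R snd p, fst p)" "P \<Otimes>\<^sub>M Pv"] by simp

lemma kw_measurable_pair [measurable]: "(\<lambda>p. kw_gradient f h (snd p) \<theta> (fst p)) \<in> borel_measurable (P \<Otimes>\<^sub>M Pv)"
  unfolding kw_gradient_def using shift_measurable[of \<theta> h] by measurable

text \<open>The difference quotient lies between the slopes at the two ends of the increment, so its
  distance from \<open>v \<bullet> gf \<theta>s z\<close> is at most the larger of two gradient
  increments; the sum of their squares bounds the square of the larger.\<close>

lemma kw_error_pointwise: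
  assumes z: "z \<in> space P" and h: "0 < h"
  shows "(norm (kw_gradient f h v (\<theta>s + x) z - dir0 z v))\<^sup>2 \<le>
    norm v ^ 4 * ((norm (gf (\<theta>s + x) z - gf \<theta>s z))\<^sup>2 + (norm (gf (\<theta>s + (x + h *\<^sub>R v)) z - gf \<theta>s z))\<^sup>2)"
proof -
  let ?q = "(f (\<theta>s + x + h *\<^sub>R v) z - f (\<theta>s + x) z) / h"
  let ?c = "v \<bullet> gf \<theta>s z"
  let ?a = "v \<bullet> (gf (\<theta>s + x) z - gf \<theta>s z)" and ?b = "v \<bullet> (gf (\<theta>s + (x + h *\<^sub>R v)) z - gf \<theta>s z)"
  have "?a \<le> ?q - ?c" "?q - ?c \<le> ?b"
    using convex_difference_quotient(1)[OF f_convex[OF z] f_diff[OF z] h, of v "\<theta>s + x"]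
      convex_difference_quotient(2)[OF f_convex[OF z] f_diff[OF z] h, of "\<theta>s + x" v]
    by (simp_all add: gf_def inner_diff_right add.assoc)
  then have "\<bar>?q - ?c\<bar> \<le> \<bar>?a\<bar> \<or> \<bar>?q - ?c\<bar> \<le> \<bar>?b\<bar>" by linarith
  then have "\<bar>?q - ?c\<bar>\<^sup>2 \<le> \<bar>?a\<bar>\<^sup>2 \<or> \<bar>?q - ?c\<bar>\<^sup>2 \<le> \<bar>?b\<bar>\<^sup>2" by (meson abs_ge_zero power_mono)
  moreover have "0 \<le> ?a\<^sup>2" "0 \<le> ?b\<^sup>2" by simp_all
  ultimately have "(?q - ?c)\<^sup>2 \<le> ?a\<^sup>2 + ?b\<^sup>2" by (auto simp only: power2_abs)
  also have "\<dots> \<le> (norm v * norm (gf (\<theta>s + x) z - gf \<theta>s z))\<^sup>2 + (norm v * norm (gf (\<theta>s + (x + h *\<^sub>R v)) z - gf \<theta>s z))\<^sup>2"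
    by (intro add_mono; subst power2_abs[symmetric]; intro power_mono Cauchy_Schwarz_ineq2 abs_ge_zero)
  finally have 1: "(?q - ?c)\<^sup>2 \<le> (norm v)\<^sup>2 * ((norm (gf (\<theta>s + x) z - gf \<theta>s z))\<^sup>2 + (norm (gf (\<theta>s + (x + h *\<^sub>R v)) z - gf \<theta>s z))\<^sup>2)"
    by (simp add: power_mult_distrib distrib_left)
  have "kw_gradient f h v (\<theta>s + x) z - dir0 z v = (?q - ?c) *\<^sub>R v"
    by (simp add: kw_gradient_def dir0_def scaleR_diff_left)
  then have "(norm (kw_gradient f h v (\<theta>s + x) z - dir0 z v))\<^sup>2 = (?q - ?c)\<^sup>2 * (norm v)\<^sup>2"
    by (simp add: power_mult_distrib)
  also have "\<dots> \<le> ((norm v)\<^sup>2 * ((norm (gf (\<theta>s + x) z - gf \<theta>s z))\<^sup>2 + (norm (gf (\<theta>s + (x + h *\<^sub>R v)) z - gf \<theta>s z))\<^sup>2)) * (norm v)\<^sup>2"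
    by (intro mult_right_mono 1) simp
  also have "\<dots> = norm v ^ 4 * ((norm (gf (\<theta>s + x) z - gf \<theta>s z))\<^sup>2 + (norm (gf (\<theta>s + (x + h *\<^sub>R v)) z - gf \<theta>s z))\<^sup>2)"
    by (simp add: power4_eq_xxxx power2_eq_square mult_ac)
  finally show ?thesis .
qed

text \<open>From \<open>(norm x)\<^sup>2 + (norm (x + h *\<^sub>R v))\<^sup>2 \<le> 3 * (norm
  x)\<^sup>2 + 2 * h\<^sup>2 * (norm v)\<^sup>2\<close>, multiplied by the fourth power of
  \<open>norm v\<close>.\<close>

definition kw_const :: real where
  "kw_const = gf_lip * (3 * mom 4 + 2 * mom 6)"

lemma kw_const_nonneg: "0 \<le> kw_const"
  using gf_lip_nonneg by (auto simp: kw_const_def intro!: mult_nonneg_nonneg add_nonneg_nonneg)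

text \<open>The data are integrated first: for fixed \<open>v\<close> both gradient increments are
  taken at deterministic points, where \<open>gf_increment\<close> applies.\<close>

lemma kw_error_nn_integral:
  assumes h: "0 < h"
  shows "(\<integral>\<^sup>+p. ennreal ((norm (kw_gradient f h (snd p) (\<theta>s + x) (fst p) - dir0 (fst p) (snd p)))\<^sup>2) \<partial>(P \<Otimes>\<^sub>M Pv))
    \<le> ennreal (kw_const * ((norm x)\<^sup>2 + h\<^sup>2))"
proof -
  let ?D = "\<lambda>z v. ennreal ((norm (kw_gradient f h v (\<theta>s + x) z - dir0 z v))\<^sup>2)"
  have "(\<integral>\<^sup>+p. ?D (fst p) (snd p) \<partial>(P \<Otimes>\<^sub>M Pv)) = (\<integral>\<^sup>+v. (\<integral>\<^sup>+z. ?D z v \<partial>P) \<partial>Pv)"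
    by (subst PV.nn_integral_snd[symmetric]) (auto simp: split_beta)
  also have "\<dots> \<le> (\<integral>\<^sup>+v. ennreal (gf_lip * (3 * (norm x)\<^sup>2 * norm v ^ 4 + 2 * h\<^sup>2 * norm v ^ 6)) \<partial>Pv)"
  proof (rule nn_integral_mono)
    fix v
    let ?e = "\<lambda>z. norm v ^ 4 * ((norm (gf (\<theta>s + x) z - gf \<theta>s z))\<^sup>2 + (norm (gf (\<theta>s + (x + h *\<^sub>R v)) z - gf \<theta>s z))\<^sup>2)"
    have ie: "integrable P ?e" using gf_increment(1) by simp
    have "(\<integral>\<^sup>+z. ?D z v \<partial>P) \<le> (\<integral>\<^sup>+z. ennreal (?e z) \<partial>P)"
      by (intro nn_integral_mono ennreal_leI kw_error_pointwise h)
    also have "\<dots> = ennreal (\<integral>z. ?e z \<partial>P)"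
      by (rule nn_integral_eq_integral[OF ie]) simp
    also have "\<dots> \<le> ennreal (gf_lip * (3 * (norm x)\<^sup>2 * norm v ^ 4 + 2 * h\<^sup>2 * norm v ^ 6))"
    proof (rule ennreal_leI)
      have "(\<integral>z. ?e z \<partial>P) \<le> norm v ^ 4 * (gf_lip * (norm x)\<^sup>2 + gf_lip * (norm (x + h *\<^sub>R v))\<^sup>2)"
        using gf_increment[of x] gf_increment[of "x + h *\<^sub>R v"] by (simp add: mult_left_mono add_mono)
      also have "\<dots> \<le> norm v ^ 4 * (gf_lip * (norm x)\<^sup>2 + gf_lip * (2 * (norm x)\<^sup>2 + 2 * (norm (h *\<^sub>R v))\<^sup>2))"
        using gf_lip_nonneg norm_add_square_le[of x "h *\<^sub>R v"] by (intro mult_left_mono add_left_mono) auto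
      also have "\<dots> = gf_lip * (3 * (norm x)\<^sup>2 * norm v ^ 4 + 2 * h\<^sup>2 * norm v ^ 6)"
        by (simp add: power_mult_distrib algebra_simps power_add[symmetric])
      finally show "(\<integral>z. ?e z \<partial>P) \<le> gf_lip * (3 * (norm x)\<^sup>2 * norm v ^ 4 + 2 * h\<^sup>2 * norm v ^ 6)" .
    qed
    finally show "(\<integral>\<^sup>+z. ?D z v \<partial>P) \<le> ennreal (gf_lip * (3 * (norm x)\<^sup>2 * norm v ^ 4 + 2 * h\<^sup>2 * norm v ^ 6))" .
  qed
  also have "\<dots> = ennreal (gf_lip * (3 * (norm x)\<^sup>2 * mom 4 + 2 * h\<^sup>2 * mom 6))"
    using V.norm_power_integrable[of 4] V.norm_power_integrable[of 6] gf_lip_nonneg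
    by (subst nn_integral_eq_integral) auto
  also have "\<dots> \<le> ennreal (kw_const * ((norm x)\<^sup>2 + h\<^sup>2))"
  proof (rule ennreal_leI)
    have m0: "0 \<le> mom 4" "0 \<le> mom 6" by simp_all
    then have "0 \<le> 2 * (norm x)\<^sup>2 * mom 6 + 3 * h\<^sup>2 * mom 4" by simp
    then have "3 * (norm x)\<^sup>2 * mom 4 + 2 * h\<^sup>2 * mom 6 \<le> (3 * mom 4 + 2 * mom 6) * ((norm x)\<^sup>2 + h\<^sup>2)"
      by (simp add: algebra_simps)
    then show "gf_lip * (3 * (norm x)\<^sup>2 * mom 4 + 2 * h\<^sup>2 * mom 6) \<le> kw_const * ((norm x)\<^sup>2 + h\<^sup>2)"
      unfolding kw_const_def mult.assoc[of gf_lip] using gf_lip_nonneg by (rule mult_left_mono)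
  qed
  finally show ?thesis .
qed

lemma product_integrable:
  fixes a :: "'z \<Rightarrow> real" and b :: "real^'d \<Rightarrow> real"
  assumes a: "integrable P a" and b: "integrable Pv b"
  shows "integrable (P \<Otimes>\<^sub>M Pv) (\<lambda>p. a (fst p) * b (snd p))"
proof (rule PV.Fubini_integrable)
  have [measurable]: "a \<in> borel_measurable P" "b \<in> borel_measurable Pv" using a b by auto
  show "(\<lambda>p. a (fst p) * b (snd p)) \<in> borel_measurable (P \<Otimes>\<^sub>M Pv)" by measurable
  show "integrable P (\<lambda>z. \<integral>v. norm (a (fst (z, v)) * b (snd (z, v))) \<partial>Pv)"
    using a by (simp add: abs_mult)
  show "AE z in P. integrable Pv (\<lambda>v. a (fst (z, v)) * b (snd (z, v)))"
    using b by simp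
qed

lemma dir0_square: "integrable (P \<Otimes>\<^sub>M Pv) (\<lambda>p. (norm (dir0 (fst p) (snd p)))\<^sup>2)"
proof (rule Bochner_Integration.integrable_bound[of _ "\<lambda>p. (norm (gf \<theta>s (fst p)))\<^sup>2 * norm (snd p) ^ 4"])
  show "integrable (P \<Otimes>\<^sub>M Pv) (\<lambda>p. (norm (gf \<theta>s (fst p)))\<^sup>2 * norm (snd p) ^ 4)"
    by (rule product_integrable[OF gf_square V.norm_power_integrable]) simp
  have "(norm (dir0 z v))\<^sup>2 \<le> (norm (gf \<theta>s z))\<^sup>2 * norm v ^ 4" for z v
  proof -
    have "norm (dir0 z v) \<le> (norm v * norm (gf \<theta>s z)) * norm v"
      unfolding dir0_def norm_scaleR by (intro mult_right_mono Cauchy_Schwarz_ineq2) simp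
    then have "(norm (dir0 z v))\<^sup>2 \<le> ((norm v * norm (gf \<theta>s z)) * norm v)\<^sup>2" by (intro power_mono) auto
    then show ?thesis by (simp add: power4_eq_xxxx power2_eq_square mult_ac)
  qed
  then show "AE p in P \<Otimes>\<^sub>M Pv. norm ((norm (dir0 (fst p) (snd p)))\<^sup>2) \<le> norm ((norm (gf \<theta>s (fst p)))\<^sup>2 * norm (snd p) ^ 4)"
    by simp
qed measurable

lemma dir0_integrable: "integrable (P \<Otimes>\<^sub>M Pv) (\<lambda>p. dir0 (fst p) (snd p))"
  by (rule integrable_norm_squareD[OF PV.P.finite_measure_axioms _ dir0_square]) measurable

lemma dir0_mean: "(\<integral>p. dir0 (fst p) (snd p) \<partial>(P \<Otimes>\<^sub>M Pv)) = 0"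
proof -
  have "(\<integral>p. dir0 (fst p) (snd p) \<partial>(P \<Otimes>\<^sub>M Pv)) = (\<integral>z. (\<integral>v. dir0 z v \<partial>Pv) \<partial>P)"
    using PV.integral_fst'[OF dir0_integrable] by simp
  also have "\<dots> = (\<integral>z. gf \<theta>s z \<partial>P)"
    unfolding dir0_def by (simp add: V.isotropic_vector)
  finally show ?thesis by (simp add: gf_integral dF_minimum)
qed

lemma kw_integrable:
  assumes h: "0 < h"
  shows "integrable (P \<Otimes>\<^sub>M Pv) (\<lambda>p. kw_gradient f h (snd p) (\<theta>s + x) (fst p))"
proof -
  let ?D = "\<lambda>p. kw_gradient f h (snd p) (\<theta>s + x) (fst p) - dir0 (fst p) (snd p)"
  have "integrable (P \<Otimes>\<^sub>M Pv) (\<lambda>p. (norm (?D p))\<^sup>2)"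
  proof (rule integrableI_nonneg)
    show "(\<lambda>p. (norm (?D p))\<^sup>2) \<in> borel_measurable (P \<Otimes>\<^sub>M Pv)" by measurable
    show "(\<integral>\<^sup>+p. ennreal ((norm (?D p))\<^sup>2) \<partial>(P \<Otimes>\<^sub>M Pv)) < \<infinity>"
      using le_less_trans[OF kw_error_nn_integral[OF h, of x] ennreal_less_top] by simp
  qed simp
  then have "integrable (P \<Otimes>\<^sub>M Pv) ?D"
    by (rule integrable_norm_squareD[OF PV.P.finite_measure_axioms, rotated]) measurable
  from Bochner_Integration.integrable_add[OF this dir0_integrable] show ?thesis by simp
qed

text \<open>Integrating the data first turns the difference quotient of \<open>f\<close> into that
  of \<open>F\<close>, and isotropy turns the directional derivative of \<open>F\<close> into its
  gradient. What is left is the second-order error, which carries three factors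
  \<open>norm v\<close>.\<close>

lemma kw_bias:
  assumes h: "0 < h"
  shows "norm ((\<integral>p. kw_gradient f h (snd p) (\<theta>s + x) (fst p) \<partial>(P \<Otimes>\<^sub>M Pv)) - dF (\<theta>s + x)) \<le> L * mom 3 * h"
proof -
  let ?\<theta> = "\<theta>s + x"
  let ?q = "\<lambda>v. (F (?\<theta> + h *\<^sub>R v) - F ?\<theta>) / h"
  have i: "integrable (P \<Otimes>\<^sub>M Pv) (\<lambda>(z, v). kw_gradient f h v ?\<theta> z)"
    using kw_integrable[OF h, of x] by (simp add: split_beta')
  have inner: "(\<integral>z. kw_gradient f h v ?\<theta> z \<partial>P) = ?q v *\<^sub>R v" for v
    unfolding kw_gradient_def using f_integrable by (simp add: F_eq)
  have iq: "integrable Pv (\<lambda>v. ?q v *\<^sub>R v)"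
    using PV.integrable_snd[OF i] by (simp add: inner)
  have eq: "(\<integral>p. kw_gradient f h (snd p) ?\<theta> (fst p) \<partial>(P \<Otimes>\<^sub>M Pv)) = (\<integral>v. ?q v *\<^sub>R v \<partial>Pv)"
    using PV.integral_snd[OF i] by (simp add: inner split_beta')
  have iqd: "integrable Pv (\<lambda>v. (?q v - v \<bullet> dF ?\<theta>) *\<^sub>R v)"
    using Bochner_Integration.integrable_diff[OF iq V.isotropic_vector(1)[of "dF ?\<theta>"]]
    by (simp only: scaleR_diff_left)
  have "(\<integral>v. ?q v *\<^sub>R v \<partial>Pv) - dF ?\<theta> = (\<integral>v. (?q v - v \<bullet> dF ?\<theta>) *\<^sub>R v \<partial>Pv)"
    using iq V.isotropic_vector[of "dF ?\<theta>"] by (simp add: scaleR_diff_left)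
  then have "norm ((\<integral>v. ?q v *\<^sub>R v \<partial>Pv) - dF ?\<theta>) = norm (\<integral>v. (?q v - v \<bullet> dF ?\<theta>) *\<^sub>R v \<partial>Pv)"
    by (rule arg_cong)
  also have "\<dots> \<le> (\<integral>v. norm ((?q v - v \<bullet> dF ?\<theta>) *\<^sub>R v) \<partial>Pv)"
    by (rule integral_norm_bound)
  also have "\<dots> \<le> (\<integral>v. L * h * norm v ^ 3 \<partial>Pv)"
  proof (rule integral_mono)
    show "integrable Pv (\<lambda>v. norm ((?q v - v \<bullet> dF ?\<theta>) *\<^sub>R v))"
      by (rule integrable_norm[OF iqd])
    show "integrable Pv (\<lambda>v. L * h * norm v ^ 3)" by (rule integrable_mult_right[OF V.norm_power_integrable]) simp
    fix v
    have "norm ((?q v - v \<bullet> dF ?\<theta>) *\<^sub>R v) = \<bar>?q v - v \<bullet> dF ?\<theta>\<bar> * norm v" by (rule norm_scaleR)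
    also have "\<bar>?q v - v \<bullet> dF ?\<theta>\<bar> * norm v \<le> (L * h * (norm v)\<^sup>2) * norm v"
      by (intro mult_right_mono F_quotient_bound h) simp
    also have "(L * h * (norm v)\<^sup>2) * norm v = L * h * norm v ^ 3"
      by (simp add: power2_eq_square power3_eq_cube)
    finally show "norm ((?q v - v \<bullet> dF ?\<theta>) *\<^sub>R v) \<le> L * h * norm v ^ 3" .
  qed
  also have "\<dots> = L * mom 3 * h" by simp
  finally show ?thesis by (simp only: eq)
qed

section \<open>Averages over several directions sharing one data point\<close>

abbreviation dirs :: "(nat \<Rightarrow> real^'d) measure" where "dirs \<equiv> PiM {1..m} (\<lambda>_. Pv)"
abbreviation N :: "('z \<times> (nat \<Rightarrow> real^'d)) measure" where "N \<equiv> P \<Otimes>\<^sub>M dirs"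

definition G :: "real \<Rightarrow> real^'d \<Rightarrow> 'z \<times> (nat \<Rightarrow> real^'d) \<Rightarrow> real^'d" where
  "G h x w = (1 / real m) *\<^sub>R (\<Sum>j=1..m. kw_gradient f h (snd w j) (\<theta>s + x) (fst w))"

definition G0 :: "'z \<times> (nat \<Rightarrow> real^'d) \<Rightarrow> real^'d" where
  "G0 w = (1 / real m) *\<^sub>R (\<Sum>j=1..m. dir0 (fst w) (snd w j))"

sublocale dirs: product_prob_space "\<lambda>_::nat. Pv" "{1..m}"
  by unfold_locales

lemma dirs_prob: "prob_space dirs"
  by (rule prob_space_PiM) unfold_locales

sublocale N: pair_prob_space P dirs
  using dirs_prob unfolding pair_prob_space_def pair_sigma_finite_def
  by (auto intro: prob_space_imp_sigma_finite P.prob_space_axioms)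

lemma N_prob: "prob_space N"
  by (rule N.P.prob_space_axioms)

lemma sel_measurable [measurable]: "j \<in> {1..m} \<Longrightarrow> (\<lambda>w. (fst w, snd w j)) \<in> measurable N (P \<Otimes>\<^sub>M Pv)"
  by measurable

text \<open>The terms of the average share the data point and are dependent, but the data point with
  any one direction has the law \<open>P \<Otimes>\<^sub>M Pv\<close>; estimates for one direction
  are transferred through this marginal.\<close>

lemma sel_distr:
  assumes "j \<in> {1..m}"
  shows "distr N (P \<Otimes>\<^sub>M Pv) (\<lambda>w. (fst w, snd w j)) = P \<Otimes>\<^sub>M Pv"
proof -
  have c: "distr dirs Pv (\<lambda>u. u j) = Pv"
    by (rule distr_PiM_component[OF _ assms]) unfold_locales
  have sf: "sigma_finite_measure (distr dirs Pv (\<lambda>u. u j))"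
    unfolding c by (rule V.sigma_finite_measure_axioms)
  have "distr P P (\<lambda>z. z) \<Otimes>\<^sub>M distr dirs Pv (\<lambda>u. u j) =
      distr N (P \<Otimes>\<^sub>M Pv) (\<lambda>(z, u). (z, u j))"
    by (rule pair_measure_distr[OF _ _ sf]) (use assms in measurable)
  then show ?thesis unfolding c split_beta' distr_id by (rule sym)
qed

lemma sel_nn_integral:
  assumes "j \<in> {1..m}" and [measurable]: "k \<in> borel_measurable (P \<Otimes>\<^sub>M Pv)"
  shows "(\<integral>\<^sup>+w. k (fst w, snd w j) \<partial>N) = (\<integral>\<^sup>+p. k p \<partial>(P \<Otimes>\<^sub>M Pv))"
  using nn_integral_distr[OF sel_measurable[OF assms(1)], of k] sel_distr[OF assms(1)] assms(2) by simp

lemma sel_integral: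
  fixes k :: "'z \<times> (real^'d) \<Rightarrow> 'b::{banach, second_countable_topology}"
  assumes j: "j \<in> {1..m}" and i: "integrable (P \<Otimes>\<^sub>M Pv) k"
  shows "integrable N (\<lambda>w. k (fst w, snd w j))"
    and "(\<integral>w. k (fst w, snd w j) \<partial>N) = (\<integral>p. k p \<partial>(P \<Otimes>\<^sub>M Pv))"
proof -
  have m: "k \<in> borel_measurable (P \<Otimes>\<^sub>M Pv)" using i by simp
  show "integrable N (\<lambda>w. k (fst w, snd w j))"
    using integrable_distr_eq[OF sel_measurable[OF j] m] sel_distr[OF j] i by simp
  show "(\<integral>w. k (fst w, snd w j) \<partial>N) = (\<integral>p. k p \<partial>(P \<Otimes>\<^sub>M Pv))"
    using integral_distr[OF sel_measurable[OF j] m] sel_distr[OF j] by simp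
qed

lemma mean_square_le:
  fixes a :: "nat \<Rightarrow> 'b::real_normed_vector"
  shows "(norm ((1 / real m) *\<^sub>R (\<Sum>j=1..m. a j)))\<^sup>2 \<le> (1 / real m) * (\<Sum>j=1..m. (norm (a j))\<^sup>2)"
proof -
  have "norm (\<Sum>j=1..m. a j) \<le> (\<Sum>j=1..m. norm (a j))" by (rule norm_sum)
  then have "(norm (\<Sum>j=1..m. a j))\<^sup>2 \<le> (\<Sum>j=1..m. norm (a j))\<^sup>2" by (intro power_mono) auto
  also have "\<dots> \<le> (\<Sum>j=1..m. (norm (a j))\<^sup>2) * real (card {1..m})"
    by (rule sum_squared_le_sum_of_squares)
  finally have "(norm (\<Sum>j=1..m. a j))\<^sup>2 \<le> real m * (\<Sum>j=1..m. (norm (a j))\<^sup>2)" by (simp add: mult.commute)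
  then have "(1 / real m)\<^sup>2 * (norm (\<Sum>j=1..m. a j))\<^sup>2 \<le> (1 / real m)\<^sup>2 * (real m * (\<Sum>j=1..m. (norm (a j))\<^sup>2))"
    by (intro mult_left_mono) auto
  then show ?thesis using m by (simp add: power_mult_distrib power2_eq_square)
qed

lemma G0_measurable: "G0 \<in> borel_measurable N"
proof -
  have "(\<lambda>w. dir0 (fst w) (snd w j)) \<in> borel_measurable N" if "j \<in> {1..m}" for j
    using measurable_compose[OF sel_measurable[OF that] dir0_measurable] by simp
  then show ?thesis unfolding G0_def[abs_def] by (intro borel_measurable_scaleR borel_measurable_sum) auto
qed

lemma G_measurable: "(\<lambda>(x, w). G h x w) \<in> borel_measurable (borel \<Otimes>\<^sub>M N)"
proof -
  have "(\<lambda>q. kw_gradient f h (snd (snd q) j) (\<theta>s + fst q) (fst (snd q))) \<in> borel_measurable (borel \<Otimes>\<^sub>M N)"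
    if j: "j \<in> {1..m}" for j
  proof -
    have [measurable]: "(\<lambda>q. snd (snd q) j) \<in> borel_measurable ((borel :: (real^'d) measure) \<Otimes>\<^sub>M N)"
      using measurable_compose[OF measurable_compose[OF measurable_snd sel_measurable[OF j]] measurable_snd]
      by (simp add: measurable_cong_sets[OF refl V.sets_Pv])
    have 1: "(\<lambda>q. (\<lambda>p. f (fst p) (snd p)) (\<theta>s + fst q + h *\<^sub>R snd (snd q) j, fst (snd q))) \<in> borel_measurable (borel \<Otimes>\<^sub>M N)"
      by (rule measurable_compose[OF _ f_joint]) measurable
    have 2: "(\<lambda>q. (\<lambda>p. f (fst p) (snd p)) (\<theta>s + fst q, fst (snd q))) \<in> borel_measurable ((borel :: (real^'d) measure) \<Otimes>\<^sub>M N)"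
      by (rule measurable_compose[OF _ f_joint]) measurable
    show ?thesis
      unfolding kw_gradient_def
      by (rule borel_measurable_scaleR[OF borel_measurable_divide[OF borel_measurable_diff borel_measurable_const]])
         (use 1 2 in \<open>simp_all only: fst_conv snd_conv\<close>, measurable)
  qed
  then show ?thesis unfolding G_def split_beta'
    by (intro borel_measurable_scaleR borel_measurable_sum) auto
qed

lemma G_noise:
  assumes h: "0 < h"
  shows "(\<integral>\<^sup>+w. ennreal ((norm (G h x w - G0 w))\<^sup>2) \<partial>N) \<le> ennreal (kw_const * ((norm x)\<^sup>2 + h\<^sup>2))"
proof -
  let ?D = "\<lambda>p. kw_gradient f h (snd p) (\<theta>s + x) (fst p) - dir0 (fst p) (snd p)"
  let ?k = "\<lambda>p. ennreal ((norm (?D p))\<^sup>2)"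
  have km[measurable]: "?k \<in> borel_measurable (P \<Otimes>\<^sub>M Pv)" by measurable
  have kmj: "(\<lambda>w. ?k (fst w, snd w j)) \<in> borel_measurable N" if "j \<in> {1..m}" for j
    by (rule measurable_compose[OF sel_measurable[OF that] km])
  have "(\<integral>\<^sup>+w. ennreal ((norm (G h x w - G0 w))\<^sup>2) \<partial>N) \<le> (\<integral>\<^sup>+w. ennreal (1 / real m) * (\<Sum>j=1..m. ?k (fst w, snd w j)) \<partial>N)"
  proof (rule nn_integral_mono)
    fix w
    have e: "G h x w - G0 w = (1 / real m) *\<^sub>R (\<Sum>j=1..m. ?D (fst w, snd w j))"
      by (simp add: G_def G0_def sum_subtractf scaleR_diff_right)
    have "(norm (G h x w - G0 w))\<^sup>2 \<le> (1 / real m) * (\<Sum>j=1..m. (norm (?D (fst w, snd w j)))\<^sup>2)"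
      unfolding e by (rule mean_square_le)
    then show "ennreal ((norm (G h x w - G0 w))\<^sup>2) \<le> ennreal (1 / real m) * (\<Sum>j=1..m. ?k (fst w, snd w j))"
      by (subst sum_ennreal) (auto simp: ennreal_mult[symmetric] sum_nonneg intro!: ennreal_leI)
  qed
  also have "\<dots> = ennreal (1 / real m) * (\<Sum>j=1..m. (\<integral>\<^sup>+w. ?k (fst w, snd w j) \<partial>N))"
    using kmj by (subst nn_integral_cmult, intro borel_measurable_sum, simp, subst nn_integral_sum) simp_all
  also have "\<dots> = ennreal (1 / real m) * (\<Sum>j=1..m. (\<integral>\<^sup>+p. ?k p \<partial>(P \<Otimes>\<^sub>M Pv)))"
    by (intro arg_cong2[where f="(*)"] sum.cong refl sel_nn_integral km)
  also have "\<dots> \<le> ennreal (1 / real m) * (\<Sum>j=1..m. ennreal (kw_const * ((norm x)\<^sup>2 + h\<^sup>2)))"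
    by (intro mult_left_mono sum_mono kw_error_nn_integral h) simp
  also have "\<dots> = ennreal (kw_const * ((norm x)\<^sup>2 + h\<^sup>2))"
    using m kw_const_nonneg by (subst sum_ennreal) (auto simp: ennreal_mult[symmetric])
  finally show ?thesis .
qed

lemma G_bias:
  assumes h: "0 < h"
  shows "norm ((\<integral>w. G h x w \<partial>N) - dF (\<theta>s + x)) \<le> L * mom 3 * h"
proof -
  let ?k = "\<lambda>p. kw_gradient f h (snd p) (\<theta>s + x) (fst p)"
  have i: "integrable N (\<lambda>w. ?k (fst w, snd w j))" and e: "(\<integral>w. ?k (fst w, snd w j) \<partial>N) = (\<integral>p. ?k p \<partial>(P \<Otimes>\<^sub>M Pv))"
    if "j \<in> {1..m}" for j
    using sel_integral[OF that kw_integrable[OF h, of x]] by simp_all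
  have "(\<integral>w. G h x w \<partial>N) = (1 / real m) *\<^sub>R (\<Sum>j=1..m. (\<integral>w. ?k (fst w, snd w j) \<partial>N))"
    unfolding G_def using i by (simp add: Bochner_Integration.integral_sum)
  also have "\<dots> = (\<integral>p. ?k p \<partial>(P \<Otimes>\<^sub>M Pv))"
    using m by (simp only: e cong: sum.cong) (simp add: sum_constant_scaleR del: sum_constant)
  finally show ?thesis using kw_bias[OF h, of x] by simp
qed

lemma G0_mean: "(\<integral>w. G0 w \<partial>N) = 0"
proof -
  let ?k = "\<lambda>p. dir0 (fst p) (snd p)"
  have i: "integrable N (\<lambda>w. ?k (fst w, snd w j))" and e: "(\<integral>w. ?k (fst w, snd w j) \<partial>N) = 0"
    if "j \<in> {1..m}" for j
    using sel_integral[OF that dir0_integrable] dir0_mean by simp_all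
  have "(\<integral>w. G0 w \<partial>N) = (1 / real m) *\<^sub>R (\<Sum>j=1..m. (\<integral>w. ?k (fst w, snd w j) \<partial>N))"
    unfolding G0_def using i by (simp add: Bochner_Integration.integral_sum)
  then show ?thesis by (simp only: e cong: sum.cong) simp
qed

lemma G0_square: "integrable N (\<lambda>w. (norm (G0 w))\<^sup>2)"
proof (rule Bochner_Integration.integrable_bound[of _ "\<lambda>w. (1 / real m) * (\<Sum>j=1..m. (norm (dir0 (fst w) (snd w j)))\<^sup>2)"])
  have "integrable N (\<lambda>w. (norm (dir0 (fst w) (snd w j)))\<^sup>2)" if "j \<in> {1..m}" for j
    using sel_integral(1)[OF that dir0_square] by simp
  then show "integrable N (\<lambda>w. (1 / real m) * (\<Sum>j=1..m. (norm (dir0 (fst w) (snd w j)))\<^sup>2))"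
    by (intro integrable_mult_right Bochner_Integration.integrable_sum) auto
  show "(\<lambda>w. (norm (G0 w))\<^sup>2) \<in> borel_measurable N" using G0_measurable by measurable
  have "(norm (G0 w))\<^sup>2 \<le> (1 / real m) * (\<Sum>j=1..m. (norm (dir0 (fst w) (snd w j)))\<^sup>2)" for w
    unfolding G0_def by (rule mean_square_le)
  then show "AE w in N. norm ((norm (G0 w))\<^sup>2) \<le> norm ((1 / real m) * (\<Sum>j=1..m. (norm (dir0 (fst w) (snd w j)))\<^sup>2))"
    unfolding real_norm_def abs_power2 by (intro AE_I2 order_trans[OF _ abs_ge_self])
qed

text \<open>The diagonal contributes \<open>m\<close> second moments, and each ordered pair of
  distinct directions contributes the squared mean, by independence.\<close>

lemma dirs_second_moment:
  fixes a :: "real^'d \<Rightarrow> real"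
  assumes i1: "integrable Pv a" and i2: "integrable Pv (\<lambda>v. (a v)\<^sup>2)"
  shows "integrable dirs (\<lambda>u. (\<Sum>j=1..m. a (u j))\<^sup>2)"
    and "(\<integral>u. (\<Sum>j=1..m. a (u j))\<^sup>2 \<partial>dirs) = real m * (\<integral>v. (a v)\<^sup>2 \<partial>Pv) + real m * (real m - 1) * (\<integral>v. a v \<partial>Pv)\<^sup>2"
proof -
  have m1[measurable]: "a \<in> borel_measurable Pv" using i1 by simp
  have sq: "(\<Sum>j=1..m. a (u j))\<^sup>2 = (\<Sum>j=1..m. \<Sum>k=1..m. a (u j) * a (u k))" for u
    by (simp add: power2_eq_square sum_product)
  have jk: "integrable dirs (\<lambda>u. a (u j) * a (u k)) \<and>
      (\<integral>u. a (u j) * a (u k) \<partial>dirs) = (if j = k then (\<integral>v. (a v)\<^sup>2 \<partial>Pv) else (\<integral>v. a v \<partial>Pv)\<^sup>2)"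
    if j: "j \<in> {1..m}" and k: "k \<in> {1..m}" for j k
  proof (cases "j = k")
    case True
    have d: "distr dirs Pv (\<lambda>u. u k) = Pv"
      by (rule distr_PiM_component[OF _ k]) unfold_locales
    have sm: "(\<lambda>u. u k) \<in> measurable dirs Pv" using k by measurable
    have "integrable dirs (\<lambda>u. (a (u k))\<^sup>2)"
      using integrable_distr_eq[OF sm, of "\<lambda>v. (a v)\<^sup>2"] d i2 by simp
    moreover have "(\<integral>u. (a (u k))\<^sup>2 \<partial>dirs) = (\<integral>v. (a v)\<^sup>2 \<partial>Pv)"
      using integral_distr[OF sm, of "\<lambda>v. (a v)\<^sup>2"] d by simp
    ultimately show ?thesis using True by (simp add: power2_eq_square)
  next
    case False
    \<comment> \<open>The product of two coordinates is padded with factors 1 to a product over all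
      coordinates, the form in which Fubini for product measures applies.\<close>
    let ?b = "\<lambda>i v. if i \<in> {j, k} then a v else 1"
    have ib: "integrable Pv (?b i)" for i using i1 by (cases "i \<in> {j, k}") auto
    have p: "(\<Prod>i\<in>{1..m}. ?b i (c i)) = (\<Prod>i\<in>{j, k}. a (c i))" for c
      using j k by (subst prod.inter_restrict[symmetric]) (auto simp: Int_absorb1 Int_absorb2 intro!: prod.cong)
    have pp: "(\<Prod>i\<in>{1..m}. ?b i (u i)) = a (u j) * a (u k)" for u
      unfolding p using False by simp
    have "integrable dirs (\<lambda>u. \<Prod>i\<in>{1..m}. ?b i (u i))"
      by (rule dirs.product_integrable_prod) (use ib in auto)
    moreover have "(\<integral>u. (\<Prod>i\<in>{1..m}. ?b i (u i)) \<partial>dirs) = (\<Prod>i\<in>{1..m}. (\<integral>v. ?b i v \<partial>Pv))"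
      by (rule dirs.product_integral_prod) (use ib in auto)
    moreover have "(\<Prod>i\<in>{1..m}. (\<integral>v. ?b i v \<partial>Pv)) = (\<Prod>i\<in>{1..m}. if i \<in> {j, k} then (\<integral>v. a v \<partial>Pv) else 1)"
      by (intro prod.cong refl) (auto simp: V.prob_space)
    moreover have "\<dots> = (\<Prod>i\<in>{j, k}. (\<integral>v. a v \<partial>Pv))"
      using j k by (subst prod.inter_restrict[symmetric]) (auto simp: Int_absorb1 Int_absorb2 intro!: prod.cong)
    moreover have "(\<Prod>i\<in>{j, k}. (\<integral>v. a v \<partial>Pv)) = (\<integral>v. a v \<partial>Pv)\<^sup>2"
      using False by (simp add: power2_eq_square)
    ultimately show ?thesis using False by (simp only: pp if_False simp_thms)
  qed
  show "integrable dirs (\<lambda>u. (\<Sum>j=1..m. a (u j))\<^sup>2)"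
    unfolding sq using jk by (intro Bochner_Integration.integrable_sum) auto
  have "(\<integral>u. (\<Sum>j=1..m. a (u j))\<^sup>2 \<partial>dirs) = (\<Sum>j=1..m. \<Sum>k=1..m. (\<integral>u. a (u j) * a (u k) \<partial>dirs))"
    unfolding sq using jk by (subst Bochner_Integration.integral_sum, intro Bochner_Integration.integrable_sum, auto intro!: sum.cong simp: Bochner_Integration.integral_sum)
  also have "\<dots> = (\<Sum>j=1..m. \<Sum>k=1..m. (\<integral>v. a v \<partial>Pv)\<^sup>2 + (if j = k then (\<integral>v. (a v)\<^sup>2 \<partial>Pv) - (\<integral>v. a v \<partial>Pv)\<^sup>2 else 0))"
    using jk by (intro sum.cong) auto
  also have "\<dots> = real m * (\<integral>v. (a v)\<^sup>2 \<partial>Pv) + real m * (real m - 1) * (\<integral>v. a v \<partial>Pv)\<^sup>2"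
    by (simp add: sum.distrib algebra_simps)
  finally show "(\<integral>u. (\<Sum>j=1..m. a (u j))\<^sup>2 \<partial>dirs) = real m * (\<integral>v. (a v)\<^sup>2 \<partial>Pv) + real m * (real m - 1) * (\<integral>v. a v \<partial>Pv)\<^sup>2" .
qed

section \<open>The limiting covariance\<close>

definition S :: "real^'d^'d" where "S = (\<integral>z. outer (gf \<theta>s z) (gf \<theta>s z) \<partial>P)"
definition Q :: "real^'d^'d" where "Q = (\<integral>x. outer x x ** S ** outer x x \<partial>Pv)"
definition Qm :: "real^'d^'d" where "Qm = (1 / real m) *\<^sub>R Q + ((real m - 1) / real m) *\<^sub>R S"

lemma S_integrable: "integrable P (\<lambda>z. outer (gf \<theta>s z) (gf \<theta>s z))"
proof (rule Bochner_Integration.integrable_bound[OF gf_square[of \<theta>s]])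
  show "(\<lambda>z. outer (gf \<theta>s z) (gf \<theta>s z)) \<in> borel_measurable P"
    by (rule measurable_compose[OF gf_measurable outer_measurable])
qed (simp add: norm_outer power2_eq_square)

lemma S_form: "v \<bullet> (S *v v) = (\<integral>z. (v \<bullet> gf \<theta>s z)\<^sup>2 \<partial>P)"
proof -
  have "v \<bullet> (S *v v) = (\<integral>z. v \<bullet> (outer (gf \<theta>s z) (gf \<theta>s z) *v v) \<partial>P)"
    unfolding S_def by (rule integral_bounded_linear[OF quadratic_form_bounded_linear S_integrable, symmetric])
  then show ?thesis by (simp add: outer_form inner_commute)
qed

lemma Q_integrable: "integrable Pv (\<lambda>x. outer x x ** S ** outer x x)"
proof (rule Bochner_Integration.integrable_bound[of _ "\<lambda>x. spectral_norm S * norm x ^ 4"])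
  show "integrable Pv (\<lambda>x. spectral_norm S * norm x ^ 4)"
    by (rule integrable_mult_right[OF V.norm_power_integrable]) simp
  have [measurable]: "(*v) S \<in> borel_measurable borel"
    by (intro borel_measurable_continuous_onI linear_continuous_on matrix_bounded_linear)
  note [measurable] = outer_measurable
  show "(\<lambda>x. outer x x ** S ** outer x x) \<in> borel_measurable Pv"
    unfolding outer_sandwich by measurable
  have "\<bar>x \<bullet> (S *v x)\<bar> * (norm x * norm x) \<le> spectral_norm S * norm x ^ 4" for x
  proof -
    have "\<bar>x \<bullet> (S *v x)\<bar> \<le> norm x * norm (S *v x)" by (rule Cauchy_Schwarz_ineq2)
    also have "\<dots> \<le> norm x * (spectral_norm S * norm x)" by (intro mult_left_mono spectral_norm_bound) simp
    finally have "\<bar>x \<bullet> (S *v x)\<bar> * (norm x * norm x) \<le> (norm x * (spectral_norm S * norm x)) * (norm x * norm x)"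
      by (intro mult_right_mono) auto
    then show ?thesis by (simp add: power4_eq_xxxx mult_ac)
  qed
  then show "AE x in Pv. norm (outer x x ** S ** outer x x) \<le> norm (spectral_norm S * norm x ^ 4)"
    unfolding outer_sandwich norm_scaleR norm_outer real_norm_def
    by (intro AE_I2 order_trans[OF _ abs_ge_self])
qed

lemma Q_form: "t \<bullet> (Q *v t) = (\<integral>x. (x \<bullet> (S *v x)) * (x \<bullet> t)\<^sup>2 \<partial>Pv)"
proof -
  have "t \<bullet> (Q *v t) = (\<integral>x. t \<bullet> ((outer x x ** S ** outer x x) *v t) \<partial>Pv)"
    unfolding Q_def by (rule integral_bounded_linear[OF quadratic_form_bounded_linear Q_integrable, symmetric])
  then show ?thesis by (simp add: outer_sandwich scaleR_matrix_vector_assoc[symmetric] outer_form)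
qed

text \<open>Given the data point, the directions are independent and \<open>dir0\<close> has mean
  \<open>gf \<theta>s z\<close> by isotropy. Equal pairs of directions therefore give the form of
  \<open>Q\<close>, distinct pairs that of \<open>S\<close>.\<close>

lemma G0_form: "(\<integral>w. (t \<bullet> G0 w)\<^sup>2 \<partial>N) = t \<bullet> (Qm *v t)"
proof -
  let ?a = "\<lambda>z v. (v \<bullet> gf \<theta>s z) * (t \<bullet> v)"
  have G0a: "t \<bullet> G0 (z, u) = (1 / real m) * (\<Sum>j=1..m. ?a z (u j))" for z u
    by (simp add: G0_def dir0_def inner_sum_right)
  have iN: "integrable N (\<lambda>w. (t \<bullet> G0 w)\<^sup>2)"
  proof (rule Bochner_Integration.integrable_bound[OF integrable_mult_right[OF G0_square, of "(norm t)\<^sup>2"]])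
    show "(\<lambda>w. (t \<bullet> G0 w)\<^sup>2) \<in> borel_measurable N" using G0_measurable by measurable
    have "(t \<bullet> y)\<^sup>2 \<le> (norm t)\<^sup>2 * (norm y)\<^sup>2" for y
      using Cauchy_Schwarz_ineq[of t y] by (simp add: power2_norm_eq_inner)
    then show "AE w in N. norm ((t \<bullet> G0 w)\<^sup>2) \<le> norm ((norm t)\<^sup>2 * (norm (G0 w))\<^sup>2)" by simp
  qed
  have ia2: "integrable (P \<Otimes>\<^sub>M Pv) (\<lambda>p. (?a (fst p) (snd p))\<^sup>2)"
  proof (rule Bochner_Integration.integrable_bound[OF integrable_mult_right[OF product_integrable[OF gf_square[of \<theta>s] V.norm_power_integrable[of 4]], of "(norm t)\<^sup>2"]])
    show "(\<lambda>p. (?a (fst p) (snd p))\<^sup>2) \<in> borel_measurable (P \<Otimes>\<^sub>M Pv)" by measurable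
    have "(?a z v)\<^sup>2 \<le> (norm t)\<^sup>2 * ((norm (gf \<theta>s z))\<^sup>2 * norm v ^ 4)" for z v
    proof -
      have "(?a z v)\<^sup>2 = (v \<bullet> gf \<theta>s z)\<^sup>2 * (t \<bullet> v)\<^sup>2" by (simp add: power_mult_distrib)
      also have "\<dots> \<le> ((norm v)\<^sup>2 * (norm (gf \<theta>s z))\<^sup>2) * ((norm t)\<^sup>2 * (norm v)\<^sup>2)"
        using Cauchy_Schwarz_ineq[of v "gf \<theta>s z"] Cauchy_Schwarz_ineq[of t v]
        by (intro mult_mono) (simp_all add: power2_norm_eq_inner)
      also have "\<dots> = (norm t)\<^sup>2 * ((norm (gf \<theta>s z))\<^sup>2 * norm v ^ 4)"
        by (simp add: power4_eq_xxxx power2_eq_square mult_ac)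
      finally show ?thesis .
    qed
    then show "AE p in P \<Otimes>\<^sub>M Pv. norm ((?a (fst p) (snd p))\<^sup>2) \<le> norm ((norm t)\<^sup>2 * ((norm (gf \<theta>s (fst p)))\<^sup>2 * norm (snd p) ^ 4))"
      unfolding real_norm_def abs_power2 by (intro AE_I2 order_trans[OF _ abs_ge_self])
  qed simp
  have ia2': "integrable (P \<Otimes>\<^sub>M Pv) (\<lambda>(z, v). (?a z v)\<^sup>2)" using ia2 by (simp add: split_beta')
  have ia2z: "integrable Pv (\<lambda>v. (?a z v)\<^sup>2)" for z
  proof (rule Bochner_Integration.integrable_bound[OF integrable_mult_right[OF V.norm_power_integrable[of 4], of "(norm t)\<^sup>2 * (norm (gf \<theta>s z))\<^sup>2"]])
    show "(\<lambda>v. (?a z v)\<^sup>2) \<in> borel_measurable Pv" by measurable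
    have "(?a z v)\<^sup>2 \<le> ((norm t)\<^sup>2 * (norm (gf \<theta>s z))\<^sup>2) * norm v ^ 4" for v
    proof -
      have "(?a z v)\<^sup>2 = (v \<bullet> gf \<theta>s z)\<^sup>2 * (t \<bullet> v)\<^sup>2" by (simp add: power_mult_distrib)
      also have "\<dots> \<le> ((norm v)\<^sup>2 * (norm (gf \<theta>s z))\<^sup>2) * ((norm t)\<^sup>2 * (norm v)\<^sup>2)"
        using Cauchy_Schwarz_ineq[of v "gf \<theta>s z"] Cauchy_Schwarz_ineq[of t v]
        by (intro mult_mono) (simp_all add: power2_norm_eq_inner)
      also have "\<dots> = ((norm t)\<^sup>2 * (norm (gf \<theta>s z))\<^sup>2) * norm v ^ 4"
        by (simp add: power4_eq_xxxx power2_eq_square mult_ac)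
      finally show ?thesis .
    qed
    then show "AE v in Pv. norm ((?a z v)\<^sup>2) \<le> norm (((norm t)\<^sup>2 * (norm (gf \<theta>s z))\<^sup>2) * norm v ^ 4)"
      unfolding real_norm_def abs_power2 by (intro AE_I2 order_trans[OF _ abs_ge_self])
  qed simp
  have inner: "(\<integral>u. (t \<bullet> G0 (z, u))\<^sup>2 \<partial>dirs) = (1 / real m) * (\<integral>v. (?a z v)\<^sup>2 \<partial>Pv) + ((real m - 1) / real m) * (t \<bullet> gf \<theta>s z)\<^sup>2" for z
  proof -
    have "(\<integral>u. (t \<bullet> G0 (z, u))\<^sup>2 \<partial>dirs) = (1 / real m)\<^sup>2 * (\<integral>u. (\<Sum>j=1..m. ?a z (u j))\<^sup>2 \<partial>dirs)"
      unfolding G0a power_mult_distrib by simp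
    also have "\<dots> = (1 / real m)\<^sup>2 * (real m * (\<integral>v. (?a z v)\<^sup>2 \<partial>Pv) + real m * (real m - 1) * (t \<bullet> gf \<theta>s z)\<^sup>2)"
      using dirs_second_moment(2)[OF V.isotropic_form(1) ia2z, of z] by (simp add: V.isotropic_form(2))
    also have "\<dots> = (1 / real m) * (\<integral>v. (?a z v)\<^sup>2 \<partial>Pv) + ((real m - 1) / real m) * (t \<bullet> gf \<theta>s z)\<^sup>2"
      using m by (simp add: power2_eq_square field_simps)
    finally show ?thesis .
  qed
  have itg: "integrable P (\<lambda>z. (t \<bullet> gf \<theta>s z)\<^sup>2)"
  proof (rule Bochner_Integration.integrable_bound[OF integrable_mult_right[OF gf_square[of \<theta>s], of "(norm t)\<^sup>2"]])
    show "AE z in P. norm ((t \<bullet> gf \<theta>s z)\<^sup>2) \<le> norm ((norm t)\<^sup>2 * (norm (gf \<theta>s z))\<^sup>2)"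
      using Cauchy_Schwarz_ineq[of t] by (simp add: power2_norm_eq_inner)
  qed measurable
  have "(\<integral>w. (t \<bullet> G0 w)\<^sup>2 \<partial>N) = (\<integral>z. (\<integral>u. (t \<bullet> G0 (z, u))\<^sup>2 \<partial>dirs) \<partial>P)"
    by (rule N.integral_fst'[OF iN, symmetric])
  also have "\<dots> = (1 / real m) * (\<integral>z. (\<integral>v. (?a z v)\<^sup>2 \<partial>Pv) \<partial>P) + ((real m - 1) / real m) * (\<integral>z. (t \<bullet> gf \<theta>s z)\<^sup>2 \<partial>P)"
    unfolding inner using PV.integrable_fst'[OF ia2] itg by simp
  \<comment> \<open>In the diagonal term the order is reversed: integrating the data first produces
    \<open>S\<close> inside the integral that defines \<open>Q\<close>.\<close>
  also have "(\<integral>z. (\<integral>v. (?a z v)\<^sup>2 \<partial>Pv) \<partial>P) = (\<integral>v. (\<integral>z. (?a z v)\<^sup>2 \<partial>P) \<partial>Pv)"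
    by (rule PV.Fubini_integral[OF ia2', symmetric])
  also have "\<dots> = t \<bullet> (Q *v t)"
    unfolding Q_form S_form by (intro Bochner_Integration.integral_cong) (simp_all add: power_mult_distrib inner_commute)
  also have "(\<integral>z. (t \<bullet> gf \<theta>s z)\<^sup>2 \<partial>P) = t \<bullet> (S *v t)" by (rule S_form[symmetric])
  finally show ?thesis
    by (simp add: Qm_def matrix_vector_mult_add_rdistrib scaleR_matrix_vector_assoc[symmetric] inner_add_right)
qed

lemma transpose_bounded_linear: "bounded_linear (transpose :: real^'d^'d \<Rightarrow> real^'d^'d)"
  unfolding linear_conv_bounded_linear[symmetric]
  by (rule linearI) (simp_all add: transpose_def vec_eq_iff)

lemma transpose_outer: "transpose (outer x x) = outer x x" for x :: "real^'d"
  by (simp add: transpose_def outer_def vec_eq_iff mult.commute)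

lemma S_symmetric: "transpose S = S"
  using integral_bounded_linear[OF transpose_bounded_linear S_integrable]
  by (simp add: S_def transpose_outer)

lemma Q_symmetric: "transpose Q = Q"
  using integral_bounded_linear[OF transpose_bounded_linear Q_integrable]
  by (simp add: Q_def matrix_transpose_mul transpose_outer S_symmetric matrix_mul_assoc)

text \<open>Nonnegativity comes from the representation of the form as a second moment of
  \<open>G0\<close>.\<close>

lemma Qm_psd: "pos_semidef Qm"
  unfolding pos_semidef_def
proof (intro conjI allI)
  show "transpose Qm = Qm"
    using Q_symmetric S_symmetric by (simp add: Qm_def transpose_def vec_eq_iff)
  show "0 \<le> x \<bullet> (Qm *v x)" for x
    unfolding G0_form[symmetric] by (rule Bochner_Integration.integral_nonneg) simp
qed

end

section \<open>Joint law of data and directions\<close>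

lemma Int_stable_vimage: "Int_stable {f -` A \<inter> S | A. A \<in> sets N}"
proof (rule Int_stableI)
  fix a b assume "a \<in> {f -` A \<inter> S | A. A \<in> sets N}" "b \<in> {f -` A \<inter> S | A. A \<in> sets N}"
  then obtain A B where "a = f -` A \<inter> S" "b = f -` B \<inter> S" "A \<in> sets N" "B \<in> sets N" by blast
  then have "a \<inter> b = f -` (A \<inter> B) \<inter> S" "A \<inter> B \<in> sets N" by auto
  then show "a \<inter> b \<in> {f -` A \<inter> S | A. A \<in> sets N}" by blast
qed

text \<open>Independence is given within the data, within the directions, and between the two
  families. The recursion needs one i.i.d. sequence of bundles, each consisting of a data point and
  its \<open>m\<close> directions.\<close>

context
  fixes M :: "'w measure" and P :: "'z measure" and R :: "'y measure"
    and X :: "nat \<Rightarrow> 'w \<Rightarrow> 'z" and Y :: "nat \<Rightarrow> nat \<Rightarrow> 'w \<Rightarrow> 'y" and m :: nat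
  assumes prob_M: "prob_space M"
    and m: "m \<ge> 1"
    and X_iid: "iid M P X {1..}"
    and Y_iid: "iid M R (\<lambda>(i, j). Y i j) ({1..} \<times> {1..m})"
    and XY: "indep_families M P X {1..} R (\<lambda>(i, j). Y i j) ({1..} \<times> {1..m})"
begin

interpretation prob_space M by (rule prob_M)

definition X_sets :: "'w set set" where
  "X_sets = sets (vimage_algebra (space M) (\<lambda>\<omega>. \<lambda>i\<in>{1..}. X i \<omega>) (Pi\<^sub>M {1..} (\<lambda>_. P)))"
definition Y_sets :: "'w set set" where
  "Y_sets = sets (vimage_algebra (space M) (\<lambda>\<omega>. \<lambda>p\<in>{1..} \<times> {1..m}. (\<lambda>(i, j). Y i j) p \<omega>) (Pi\<^sub>M ({1..} \<times> {1..m}) (\<lambda>_. R)))"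

lemma X_rv: "i \<ge> 1 \<Longrightarrow> X i \<in> measurable M P"
  using X_iid by (auto simp: iid_def indep_vars_def)

lemma Y_rv: "i \<ge> 1 \<Longrightarrow> j \<in> {1..m} \<Longrightarrow> Y i j \<in> measurable M R"
  using Y_iid unfolding iid_def indep_vars_def by fastforce

lemma X_vimage_sets:
  assumes i: "i \<ge> 1" and A: "A \<in> sets P"
  shows "X i -` A \<inter> space M \<in> X_sets"
proof -
  let ?f = "\<lambda>\<omega>. \<lambda>i\<in>{1..}. X i \<omega>"
  have f: "?f \<in> space M \<rightarrow> space (Pi\<^sub>M {1..} (\<lambda>_. P))"
    using measurable_space[OF X_rv] by (auto simp: space_PiM)
  have "X i -` A \<inter> space M = ?f -` ((\<lambda>u. u i) -` A \<inter> space (Pi\<^sub>M {1..} (\<lambda>_. P))) \<inter> space M"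
    using f i by auto
  moreover have "(\<lambda>u. u i) -` A \<inter> space (Pi\<^sub>M {1..} (\<lambda>_. P)) \<in> sets (Pi\<^sub>M {1..} (\<lambda>_. P))"
  proof (rule measurable_sets[OF _ A])
    show "(\<lambda>u. u i) \<in> measurable (Pi\<^sub>M {1..} (\<lambda>_. P)) P"
      by (rule measurable_component_singleton) (use i in simp)
  qed
  ultimately show ?thesis unfolding X_sets_def by (simp only: in_vimage_algebra)
qed

lemma Y_vimage_sets:
  assumes i: "i \<ge> 1" and j: "j \<in> {1..m}" and A: "A \<in> sets R"
  shows "Y i j -` A \<inter> space M \<in> Y_sets"
proof -
  let ?I = "{1..} \<times> {1..m}"
  let ?f = "\<lambda>\<omega>. \<lambda>p\<in>?I. (\<lambda>(i, j). Y i j) p \<omega>"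
  have f: "?f \<in> space M \<rightarrow> space (Pi\<^sub>M ?I (\<lambda>_. R))"
  proof
    fix \<omega> assume "\<omega> \<in> space M"
    then show "?f \<omega> \<in> space (Pi\<^sub>M ?I (\<lambda>_. R))"
      unfolding space_PiM using measurable_space[OF Y_rv] by (intro PiE_I) auto
  qed
  have ij: "(i, j) \<in> ?I" using i j by simp
  have "Y i j -` A \<inter> space M = ?f -` ((\<lambda>u. u (i, j)) -` A \<inter> space (Pi\<^sub>M ?I (\<lambda>_. R))) \<inter> space M"
    using f i j by auto
  moreover have "(\<lambda>u. u (i, j)) -` A \<inter> space (Pi\<^sub>M ?I (\<lambda>_. R)) \<in> sets (Pi\<^sub>M ?I (\<lambda>_. R))"
    by (rule measurable_sets[OF _ A]) (rule measurable_component_singleton[OF ij])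
  ultimately show ?thesis unfolding Y_sets_def by (simp only: in_vimage_algebra)
qed

lemma XY_product: "a \<in> X_sets \<Longrightarrow> b \<in> Y_sets \<Longrightarrow> prob (a \<inter> b) = prob a * prob b"
  using XY unfolding indep_families_def X_sets_def[symmetric] Y_sets_def[symmetric] by (rule indep_setD)

lemma sets_Int_finite:
  assumes "finite J" "\<And>j. j \<in> J \<Longrightarrow> A j \<in> sets N"
  shows "space N \<inter> (\<Inter>j\<in>J. A j) \<in> sets N"
  using assms by (induction J) (auto simp: Int_left_commute)

text \<open>One family of generating events per variable. Events, indexed by a sum type, put data
  and directions on the same footing although their values lie in different spaces.\<close>

primrec gen :: "nat + nat \<times> nat \<Rightarrow> 'w set set" where
  "gen (Inl i) = {X i -` A \<inter> space M | A. A \<in> sets P}"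
| "gen (Inr p) = {Y (fst p) (snd p) -` A \<inter> space M | A. A \<in> sets R}"

definition all_idx :: "(nat + nat \<times> nat) set" where
  "all_idx = Inl ` {1..} \<union> Inr ` ({1..} \<times> {1..m})"

text \<open>A finite intersection splits into a data event and a direction event. These are
  independent of each other, and each of them obeys the product rule within its own family.\<close>

lemma gen_indep: "indep_sets gen all_idx"
proof (rule indep_setsI)
  fix k assume "k \<in> all_idx"
  then show "gen k \<subseteq> events"
    using measurable_sets[OF X_rv] measurable_sets[OF Y_rv] by (auto simp: all_idx_def)
next
  fix A J assume J: "J \<noteq> {}" "J \<subseteq> all_idx" "finite J" and A: "\<forall>j\<in>J. A j \<in> gen j"
  define J1 where "J1 = Inl -` J"
  define J2 where "J2 = Inr -` J"
  have Jeq: "J = Inl ` J1 \<union> Inr ` J2"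
  proof
    show "J \<subseteq> Inl ` J1 \<union> Inr ` J2"
    proof
      fix x assume "x \<in> J" then show "x \<in> Inl ` J1 \<union> Inr ` J2" by (cases x) (auto simp: J1_def J2_def)
    qed
  qed (auto simp: J1_def J2_def)
  have fin: "finite J1" "finite J2"
    unfolding J1_def J2_def using J(3) by (auto intro!: finite_vimageI simp: inj_on_def)
  have J1: "J1 \<subseteq> {1..}" and J2: "J2 \<subseteq> {1..} \<times> {1..m}"
    using J(2) by (auto simp: J1_def J2_def all_idx_def)
  \<comment> \<open>Intersecting with \<open>space M\<close> covers the case in which one family
    contributes no event, an empty intersection being \<open>UNIV\<close>.\<close>
  let ?a = "space M \<inter> (\<Inter>i\<in>J1. A (Inl i))" and ?b = "space M \<inter> (\<Inter>p\<in>J2. A (Inr p))"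
  have A1: "A (Inl i) \<in> gen (Inl i)" if "i \<in> J1" for i using A that by (auto simp: J1_def)
  have A2: "A (Inr p) \<in> gen (Inr p)" if "p \<in> J2" for p using A that by (auto simp: J2_def)
  have a: "?a \<in> X_sets"
    unfolding X_sets_def
  proof (rule sets_Int_finite[OF fin(1), where N = "vimage_algebra (space M) _ _", unfolded space_vimage_algebra])
    fix i assume i: "i \<in> J1"
    then obtain B where "A (Inl i) = X i -` B \<inter> space M" "B \<in> sets P" using A1[OF i] by auto
    then show "A (Inl i) \<in> sets (vimage_algebra (space M) (\<lambda>\<omega>. \<lambda>i\<in>{1..}. X i \<omega>) (Pi\<^sub>M {1..} (\<lambda>_. P)))"
      using X_vimage_sets[of i B] i J1 by (auto simp: X_sets_def)
  qed
  have b: "?b \<in> Y_sets"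
    unfolding Y_sets_def
  proof (rule sets_Int_finite[OF fin(2), where N = "vimage_algebra (space M) _ _", unfolded space_vimage_algebra])
    fix p assume p: "p \<in> J2"
    then obtain B where "A (Inr p) = Y (fst p) (snd p) -` B \<inter> space M" "B \<in> sets R" using A2[OF p] by auto
    then show "A (Inr p) \<in> sets (vimage_algebra (space M) (\<lambda>\<omega>. \<lambda>p\<in>{1..} \<times> {1..m}. (\<lambda>(i, j). Y i j) p \<omega>) (Pi\<^sub>M ({1..} \<times> {1..m}) (\<lambda>_. R)))"
      using Y_vimage_sets[of "fst p" "snd p" B] p J2 by (auto simp: Y_sets_def)
  qed
  have Asp: "A j \<subseteq> space M" if "j \<in> J" for j
    using bspec[OF A that] by (cases j) auto
  have pa: "prob ?a = (\<Prod>i\<in>J1. prob (A (Inl i)))"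
  proof (cases "J1 = {}")
    case False
    have "?a = (\<Inter>i\<in>J1. A (Inl i))" using False Asp by (auto simp: J1_def)
    moreover have "prob (\<Inter>i\<in>J1. A (Inl i)) = (\<Prod>i\<in>J1. prob (A (Inl i)))"
      using X_iid A1 J1 fin False unfolding iid_def indep_vars_def2 by (intro indep_setsD) auto
    ultimately show ?thesis by simp
  qed (simp add: prob_space)
  have pb: "prob ?b = (\<Prod>p\<in>J2. prob (A (Inr p)))"
  proof (cases "J2 = {}")
    case False
    have "?b = (\<Inter>p\<in>J2. A (Inr p))" using False Asp by (auto simp: J2_def)
    moreover have "prob (\<Inter>p\<in>J2. A (Inr p)) = (\<Prod>p\<in>J2. prob (A (Inr p)))"
      using Y_iid A2 J2 fin False unfolding iid_def indep_vars_def2 by (intro indep_setsD) (auto simp: split_beta')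
    ultimately show ?thesis by simp
  qed (simp add: prob_space)
  have "(\<Inter>j\<in>J. A j) = ?a \<inter> ?b"
  proof -
    have "(\<Inter>j\<in>J. A j) \<subseteq> space M" using J(1) Asp by blast
    then show ?thesis unfolding Jeq by auto
  qed
  then have "prob (\<Inter>j\<in>J. A j) = prob ?a * prob ?b" using XY_product[OF a b] by simp
  also have "\<dots> = (\<Prod>j\<in>J. prob (A j))"
    unfolding Jeq pa pb using fin
    by (subst prod.union_disjoint) (auto simp: prod.reindex inj_on_def)
  finally show "prob (\<Inter>j\<in>J. A j) = (\<Prod>j\<in>J. prob (A j))" .
qed

section \<open>Bundles of a data point and its directions\<close>

definition pair_rv :: "nat \<Rightarrow> 'w \<Rightarrow> 'z \<times> (nat \<Rightarrow> 'y)" where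
  "pair_rv i \<omega> = (X i \<omega>, \<lambda>j\<in>{1..m}. Y i j \<omega>)"

abbreviation pair_law :: "('z \<times> (nat \<Rightarrow> 'y)) measure" where
  "pair_law \<equiv> P \<Otimes>\<^sub>M Pi\<^sub>M {1..m} (\<lambda>_. R)"

text \<open>The indices entering bundle \<open>i\<close>. For \<open>i \<ge> 1\<close> the blocks
  are disjoint and exhaust \<open>all_idx\<close>, so the bundles inherit independence by
  grouping.\<close>

definition block :: "nat \<Rightarrow> (nat + nat \<times> nat) set" where
  "block i = insert (Inl i) (Inr ` ({i} \<times> {1..m}))"

lemma gen_subset: "gen k \<subseteq> Pow (space M)"
  by (cases k) auto

lemma pair_rv_sigma:
  assumes i: "i \<ge> 1"
  shows "pair_rv i \<in> measurable (sigma (space M) (\<Union>k\<in>block i. gen k)) pair_law"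
proof -
  let ?S = "sigma (space M) (\<Union>k\<in>block i. gen k)"
  have sub: "(\<Union>k\<in>block i. gen k) \<subseteq> Pow (space M)" using gen_subset by blast
  have X: "X i \<in> measurable ?S P"
  proof (rule measurableI)
    fix A assume "A \<in> sets P"
    then have "X i -` A \<inter> space M \<in> (\<Union>k\<in>block i. gen k)" by (auto simp: block_def)
    then show "X i -` A \<inter> space ?S \<in> sets ?S" using sub by (simp add: space_measure_of)
  qed (use measurable_space[OF X_rv[OF i]] sub in \<open>simp add: space_measure_of\<close>)
  have Y: "Y i j \<in> measurable ?S R" if j: "j \<in> {1..m}" for j
  proof (rule measurableI)
    fix A assume A: "A \<in> sets R"
    have "Y i j -` A \<inter> space M \<in> gen (Inr (i, j))" using A by auto
    then have "Y i j -` A \<inter> space M \<in> (\<Union>k\<in>block i. gen k)" using j by (auto simp: block_def)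
    then show "Y i j -` A \<inter> space ?S \<in> sets ?S" using sub by (simp add: space_measure_of)
  qed (use measurable_space[OF Y_rv[OF i j]] sub in \<open>simp add: space_measure_of\<close>)
  show ?thesis
    unfolding pair_rv_def[abs_def] by (intro measurable_Pair X measurable_restrict Y)
qed

lemma pair_rv_indep: "indep_vars (\<lambda>_. pair_law) pair_rv {1..}"
  unfolding indep_vars_def2
proof (intro conjI ballI)
  fix i :: nat assume "i \<in> {1..}"
  then have i: "i \<ge> 1" by simp
  show "pair_rv i \<in> measurable M pair_law"
    unfolding pair_rv_def[abs_def] using i by (intro measurable_Pair X_rv measurable_restrict Y_rv) auto
next
  have idx: "(\<Union>i\<in>{1..}. block i) = all_idx" by (auto simp: block_def all_idx_def)
  have "indep_sets (\<lambda>i. sigma_sets (space M) (\<Union>k\<in>block i. gen k)) {1..}"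
  proof (rule indep_sets_collect_sigma)
    show "indep_sets gen (\<Union>i\<in>{1..}. block i)" unfolding idx by (rule gen_indep)
    show "Int_stable (gen k)" for k
      by (cases k) (simp_all add: Int_stable_vimage)
    show "disjoint_family_on block {1..}" by (auto simp: disjoint_family_on_def block_def)
  qed
  then show "indep_sets (\<lambda>i. {pair_rv i -` A \<inter> space M | A. A \<in> sets pair_law}) {1..}"
  proof (rule indep_sets_mono_sets)
    fix i :: nat assume "i \<in> {1..}"
    then have i: "i \<ge> 1" by simp
    have sub: "(\<Union>k\<in>block i. gen k) \<subseteq> Pow (space M)" using gen_subset by blast
    show "{pair_rv i -` A \<inter> space M | A. A \<in> sets pair_law} \<subseteq> sigma_sets (space M) (\<Union>k\<in>block i. gen k)"
      using measurable_sets[OF pair_rv_sigma[OF i]] sub by (auto simp: space_measure_of sets_measure_of)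
  qed
qed

lemma Y_block_distr:
  assumes i: "i \<ge> 1"
  shows "distr M (Pi\<^sub>M {1..m} (\<lambda>_. R)) (\<lambda>\<omega>. \<lambda>j\<in>{1..m}. Y i j \<omega>) = Pi\<^sub>M {1..m} (\<lambda>_. R)"
proof -
  have "indep_vars (\<lambda>_. R) (Y i) {1..m}"
    unfolding indep_vars_def2
  proof (intro conjI ballI Y_rv i indep_setsI)
    fix j assume "j \<in> {1..m}"
    then show "{Y i j -` A \<inter> space M | A. A \<in> sets R} \<subseteq> events" using measurable_sets[OF Y_rv[OF i]] by auto
  next
    fix A J assume J: "J \<noteq> {}" "J \<subseteq> {1..m}" "finite J" and A: "\<forall>j\<in>J. A j \<in> {Y i j -` A \<inter> space M | A. A \<in> sets R}"
    \<comment> \<open>The j-th direction of bundle \<open>i\<close> is the member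
      \<open>Inr (i, j)\<close> of the joint family, and its independence is read off there.\<close>
    have "prob (\<Inter>k\<in>(\<lambda>j. Inr (i, j) :: nat + nat \<times> nat) ` J. (\<lambda>k. A (snd (projr k))) k) = (\<Prod>k\<in>(\<lambda>j. Inr (i, j) :: nat + nat \<times> nat) ` J. prob ((\<lambda>k. A (snd (projr k))) k))"
      by (rule indep_setsD[OF gen_indep]) (use J A i in \<open>auto simp: all_idx_def\<close>)
    then show "prob (\<Inter>j\<in>J. A j) = (\<Prod>j\<in>J. prob (A j))"
      by (simp add: prod.reindex inj_on_def)
  qed
  then have "distr M (Pi\<^sub>M {1..m} (\<lambda>_. R)) (\<lambda>\<omega>. \<lambda>j\<in>{1..m}. Y i j \<omega>) = Pi\<^sub>M {1..m} (\<lambda>j. distr M R (Y i j))"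
    using m i by (subst (asm) indep_vars_iff_distr_eq_PiM') (auto intro: Y_rv)
  also have "\<dots> = Pi\<^sub>M {1..m} (\<lambda>_. R)"
    using Y_iid i by (intro PiM_cong) (auto simp: iid_def)
  finally show ?thesis .
qed

text \<open>Data events and direction events are independent, so the joint law agrees with the
  product law on rectangles.\<close>

lemma pair_rv_distr:
  assumes i: "i \<ge> 1"
  shows "distr M pair_law (pair_rv i) = pair_law"
proof -
  have dX: "distr M P (X i) = P" using X_iid i by (auto simp: iid_def)
  let ?Y = "\<lambda>\<omega>. \<lambda>j\<in>{1..m}. Y i j \<omega>"
  have Ym: "?Y \<in> measurable M (Pi\<^sub>M {1..m} (\<lambda>_. R))" by (intro measurable_restrict Y_rv i)
  have pm: "pair_rv i \<in> measurable M pair_law"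
    unfolding pair_rv_def[abs_def] using i by (intro measurable_Pair X_rv Ym)
  have YS: "?Y -` B \<inter> space M \<in> Y_sets" if B: "B \<in> sets (Pi\<^sub>M {1..m} (\<lambda>_. R))" for B
  proof -
    let ?V = "vimage_algebra (space M) (\<lambda>\<omega>. \<lambda>p\<in>{1..} \<times> {1..m}. (\<lambda>(i, j). Y i j) p \<omega>) (Pi\<^sub>M ({1..} \<times> {1..m}) (\<lambda>_. R))"
    have "?Y \<in> measurable ?V (Pi\<^sub>M {1..m} (\<lambda>_. R))"
    proof (rule measurable_restrict, rule measurableI)
      fix j A assume "j \<in> {1..m}" "A \<in> sets R"
      then show "Y i j -` A \<inter> space ?V \<in> sets ?V" using Y_vimage_sets[OF i] by (simp add: Y_sets_def)
    qed (use measurable_space[OF Y_rv[OF i]] in auto)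
    from measurable_sets[OF this B] show ?thesis by (simp add: Y_sets_def)
  qed
  have "distr M P (X i) \<Otimes>\<^sub>M distr M (Pi\<^sub>M {1..m} (\<lambda>_. R)) ?Y = distr M pair_law (pair_rv i)"
  proof (rule pair_measure_eqI)
    show "sigma_finite_measure (distr M P (X i))"
      by (intro prob_space_imp_sigma_finite prob_space_distr X_rv i)
    show "sigma_finite_measure (distr M (Pi\<^sub>M {1..m} (\<lambda>_. R)) ?Y)"
      by (intro prob_space_imp_sigma_finite prob_space_distr Ym)
    show "sets (distr M P (X i) \<Otimes>\<^sub>M distr M (Pi\<^sub>M {1..m} (\<lambda>_. R)) ?Y) = sets (distr M pair_law (pair_rv i))"
      by (simp cong: sets_pair_measure_cong)
    fix A B assume "A \<in> sets (distr M P (X i))" "B \<in> sets (distr M (Pi\<^sub>M {1..m} (\<lambda>_. R)) ?Y)"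
    then have A: "A \<in> sets P" and B: "B \<in> sets (Pi\<^sub>M {1..m} (\<lambda>_. R))" by simp_all
    have "emeasure (distr M pair_law (pair_rv i)) (A \<times> B) = emeasure M (pair_rv i -` (A \<times> B) \<inter> space M)"
      using A B by (intro emeasure_distr pm) auto
    also have "pair_rv i -` (A \<times> B) \<inter> space M = (X i -` A \<inter> space M) \<inter> (?Y -` B \<inter> space M)"
      by (auto simp: pair_rv_def)
    also have "emeasure M \<dots> = emeasure M (X i -` A \<inter> space M) * emeasure M (?Y -` B \<inter> space M)"
      using XY_product[OF X_vimage_sets[OF i A] YS[OF B]] by (simp add: emeasure_eq_measure ennreal_mult)
    finally show "emeasure (distr M P (X i)) A * emeasure (distr M (Pi\<^sub>M {1..m} (\<lambda>_. R)) ?Y) B = emeasure (distr M pair_law (pair_rv i)) (A \<times> B)"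
      by (simp only: emeasure_distr[OF X_rv[OF i] A] emeasure_distr[OF Ym B])
  qed
  then show ?thesis unfolding dX Y_block_distr[OF i] by (rule sym)
qed

lemmas combined_indep = pair_rv_indep[unfolded pair_rv_def[abs_def]]
lemmas combined_distr = pair_rv_distr[unfolded pair_rv_def[abs_def]]

end

section \<open>The central limit theorem\<close>

theorem theorem3p6:
  fixes M :: "'w measure" and P\<^sub>\<zeta> :: "'z measure" and P\<^sub>v :: "(real^'d) measure"
    and f :: "real^'d \<Rightarrow> 'z \<Rightarrow> real" and F :: "real^'d \<Rightarrow> real"
    and \<zeta> :: "nat \<Rightarrow> 'w \<Rightarrow> 'z" and v :: "nat \<Rightarrow> nat \<Rightarrow> 'w \<Rightarrow> real^'d"
    and \<theta>\<^sub>s \<theta>\<^sub>0 :: "real^'d" and m :: nat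
    and H S Q Q\<^sub>m :: "real^'d^'d"
    and L\<^sub>f L\<^sub>h L\<^sub>p \<mu> \<delta>\<^sub>1 \<delta> K \<alpha> \<gamma> \<eta>\<^sub>0 h\<^sub>0 :: real and \<eta> h :: "nat \<Rightarrow> real"
  assumes "prob_space M" and "prob_space P\<^sub>\<zeta>"
    and "prob_space P\<^sub>v" and "sets P\<^sub>v = sets borel"
    \<comment> \<open>loss, risk and minimiser\<close>
    and f_integrable: "\<And>\<theta>. integrable P\<^sub>\<zeta> (f \<theta>)"
    and f_convex: "\<And>z. z \<in> space P\<^sub>\<zeta> \<Longrightarrow> convex_on UNIV (\<lambda>\<theta>. f \<theta> z)"
    and f_twice_diff: "\<And>z. z \<in> space P\<^sub>\<zeta> \<Longrightarrow> twice_differentiable (\<lambda>\<theta>. f \<theta> z)"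
    and F_eq: "F = (\<lambda>\<theta>. \<integral>z. f \<theta> z \<partial>P\<^sub>\<zeta>)"
    and \<theta>\<^sub>s_argmin: "is_arg_min F (\<lambda>_. True) \<theta>\<^sub>s"
    \<comment> \<open>(1)\<close>
    and F_C2: "twice_cont_differentiable F"
    and F_convex: "convex_on UNIV F"
    and F_hess_bounds: "\<And>\<theta>. loewner_le 0 (hessian F \<theta>) \<and> loewner_le (hessian F \<theta>) (mat L\<^sub>f)"
    and "\<delta>\<^sub>1 > 0" and "\<mu> > 0"
    and F_local_strong: "\<And>\<theta>. \<theta> \<in> ball \<theta>\<^sub>s \<delta>\<^sub>1 \<Longrightarrow> loewner_le (mat \<mu>) (hessian F \<theta>)"
    \<comment> \<open>(2)\<close>
    and grad_unbiased: "\<And>\<theta>. has_bochner_integral P\<^sub>\<zeta> (\<lambda>z. grad (\<lambda>\<theta>. f \<theta> z) \<theta>) (grad F \<theta>)"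
    and "0 < \<delta>" and "\<delta> \<le> 2" and "K > 0"
    and grad_moment: "\<And>\<theta>.
          (\<integral>\<^sup>+z. ennreal (norm (grad (\<lambda>\<theta>. f \<theta> z) \<theta> - grad F \<theta>) powr (2 + \<delta>)) \<partial>P\<^sub>\<zeta>)
            \<le> ennreal (K * (norm (\<theta> - \<theta>\<^sub>s) powr (2 + \<delta>) + 1))"
    \<comment> \<open>(3)\<close>
    and H_eq: "H = hessian F \<theta>\<^sub>s"
    and "L\<^sub>h > 0" and "L\<^sub>p > 0"
    and hess_lipschitz: "\<And>\<theta> \<theta>'.
          (\<integral>\<^sup>+z. ennreal ((spectral_norm (hessian (\<lambda>\<theta>. f \<theta> z) \<theta> - hessian (\<lambda>\<theta>. f \<theta> z) \<theta>'))\<^sup>2) \<partial>P\<^sub>\<zeta>)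
            \<le> ennreal (L\<^sub>h * (norm (\<theta> - \<theta>'))\<^sup>2)"
    and hess_square:
          "(\<integral>\<^sup>+z. ennreal (spectral_norm (hessian (\<lambda>\<theta>. f \<theta> z) \<theta>\<^sub>s ** hessian (\<lambda>\<theta>. f \<theta> z) \<theta>\<^sub>s - H ** H)) \<partial>P\<^sub>\<zeta>)
            \<le> ennreal L\<^sub>p"
    \<comment> \<open>(4) and the sampling scheme\<close>
    and "m \<ge> 1"
    and data_iid: "iid M P\<^sub>\<zeta> \<zeta> {1..}"
    and directions_iid: "iid M P\<^sub>v (\<lambda>(i, j). v i j) ({1..} \<times> {1..m})"
    and directions_indep_data:
          "indep_families M P\<^sub>\<zeta> \<zeta> {1..} P\<^sub>v (\<lambda>(i, j). v i j) ({1..} \<times> {1..m})"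
    and v_isotropic: "has_bochner_integral P\<^sub>v (\<lambda>x. outer x x) (mat 1)"
    and v_moment: "integrable P\<^sub>v (\<lambda>x. norm x powr (6 + 3 * \<delta>))"
    \<comment> \<open>step sizes and increments\<close>
    and "\<eta>\<^sub>0 > 0" and "1/2 < \<alpha>" and "\<alpha> < 1"
    and \<eta>_eq: "\<And>n. n \<ge> 1 \<Longrightarrow> \<eta> n = \<eta>\<^sub>0 * real n powr (- \<alpha>)"
    and "h\<^sub>0 > 0" and "1/2 < \<gamma>" and "\<gamma> < 1"
    and h_eq: "\<And>n. n \<ge> 1 \<Longrightarrow> h n = h\<^sub>0 * real n powr (- \<gamma>)"
    \<comment> \<open>limiting covariance\<close>
    and S_eq: "S = (\<integral>z. outer (grad (\<lambda>\<theta>. f \<theta> z) \<theta>\<^sub>s) (grad (\<lambda>\<theta>. f \<theta> z) \<theta>\<^sub>s) \<partial>P\<^sub>\<zeta>)"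
    and Q_eq: "Q = (\<integral>x. outer x x ** S ** outer x x \<partial>P\<^sub>v)"
    and Qm_eq: "Q\<^sub>m = (1 / real m) *\<^sub>R Q + ((real m - 1) / real m) *\<^sub>R S"
  shows "converges_in_distribution M
           (\<lambda>n \<omega>. sqrt (real n) *\<^sub>R
              (kw_average f m \<eta> h \<theta>\<^sub>0 (\<lambda>i. \<zeta> i \<omega>) (\<lambda>i j. v i j \<omega>) n - \<theta>\<^sub>s))
           (mv_normal 0 (matrix_inv H ** Q\<^sub>m ** matrix_inv H))"
proof -
  have kw: "kw_sampling P\<^sub>\<zeta> f F \<theta>\<^sub>s L\<^sub>f \<delta>\<^sub>1 \<mu> \<delta> K L\<^sub>h P\<^sub>v m"
  proof (intro kw_sampling.intro smooth_loss.intro direction_law.intro smooth_loss_axioms.intro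
      direction_law_axioms.intro kw_sampling_axioms.intro)
    show "twice_differentiable F" using F_C2 by (simp add: twice_cont_differentiable_def)
  qed (fact assms)+
  interpret KW: kw_sampling P\<^sub>\<zeta> f F \<theta>\<^sub>s L\<^sub>f \<delta>\<^sub>1 \<mu> \<delta> K L\<^sub>h P\<^sub>v m by (rule kw)
  interpret M: prob_space M by fact
  let ?W = "\<lambda>i \<omega>. (\<zeta> i \<omega>, \<lambda>j\<in>{1..m}. v i j \<omega>)"
  \<comment> \<open>A common constant for the noise, bias and linearisation bounds of the abstract
    recursion.\<close>
  define c where "c = KW.kw_const + L\<^sub>f * KW.mom 3 + sqrt L\<^sub>h"
  have c: "KW.kw_const \<le> c" "L\<^sub>f * KW.mom 3 \<le> c" "sqrt L\<^sub>h \<le> c" "0 \<le> c"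
    using KW.kw_const_nonneg KW.L_nonneg KW.Lh by (auto simp: c_def)
  let ?hs = "\<lambda>i::nat. h\<^sub>0 * real i powr (- \<gamma>)"
  have hs: "0 < ?hs i" if "i \<ge> 1" for i using that \<open>h\<^sub>0 > 0\<close> by simp
  \<comment> \<open>The noise is the bundle of a data point with its directions. The radius
    \<open>\<delta>\<^sub>1 / 2\<close> keeps the closed ball inside the open ball of strong
    convexity.\<close>
  have sa: "stochastic_approximation M KW.N ?W (\<lambda>i. KW.G (?hs i)) KW.G0 (\<lambda>x. grad F (\<theta>\<^sub>s + x)) ((*v) H)
      c (\<delta>\<^sub>1 / 2) \<mu> \<alpha> \<gamma> \<eta>\<^sub>0 h\<^sub>0"
  proof (intro stochastic_approximation.intro stochastic_approximation_axioms.intro)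
    show "M.indep_vars (\<lambda>_. KW.N) ?W {1..}"
      by (rule combined_indep) fact+
    show "distr M KW.N (?W i) = KW.N" if "i \<ge> 1" for i
      by (rule combined_distr[OF _ _ _ _ _ that]) fact+
    show "(\<lambda>(x, w). KW.G (?hs i) x w) \<in> borel_measurable (borel \<Otimes>\<^sub>M KW.N)" for i
      by (rule KW.G_measurable)
    show "KW.G0 \<in> borel_measurable KW.N" by (rule KW.G0_measurable)
    show "integrable KW.N (\<lambda>w. (norm (KW.G0 w))\<^sup>2)" by (rule KW.G0_square)
    show "(\<integral>w. KW.G0 w \<partial>KW.N) = 0" by (rule KW.G0_mean)
    show "(\<integral>\<^sup>+w. ennreal ((norm (KW.G (?hs i) x w - KW.G0 w))\<^sup>2) \<partial>KW.N) \<le> ennreal (c * ((norm x)\<^sup>2 + (?hs i)\<^sup>2))"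
      if "i \<ge> 1" for i x
      by (rule order_trans[OF KW.G_noise[OF hs[OF that]]]) (intro ennreal_leI mult_right_mono c, simp)
    show "norm ((\<integral>w. KW.G (?hs i) x w \<partial>KW.N) - grad F (\<theta>\<^sub>s + x)) \<le> c * ?hs i" if "i \<ge> 1" for i x
      by (rule order_trans[OF KW.G_bias[OF hs[OF that]]]) (intro mult_right_mono c less_imp_le hs that)
    show "(\<lambda>x. grad F (\<theta>\<^sub>s + x)) \<in> borel_measurable borel"
    proof -
      have "continuous_on UNIV (grad F)"
        using KW.F_twice_diff
        by (auto simp: twice_differentiable_def intro!: continuous_at_imp_continuous_on differentiable_imp_continuous_within)
      then have [measurable]: "grad F \<in> borel_measurable borel" by (rule borel_measurable_continuous_onI)
      show ?thesis by measurable
    qed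
    show "norm (grad F (\<theta>\<^sub>s + x) - H *v x) \<le> c * (norm x)\<^sup>2" for x
      unfolding H_eq by (rule order_trans[OF KW.dF_linearization]) (intro mult_right_mono c, simp)
    show "bounded_linear ((*v) H)" by (rule matrix_bounded_linear)
    show "0 \<le> x \<bullet> grad F (\<theta>\<^sub>s + x)" for x by (rule KW.dF_nonneg)
    show "\<mu> * (norm x)\<^sup>2 \<le> x \<bullet> grad F (\<theta>\<^sub>s + x)" if "norm x \<le> \<delta>\<^sub>1 / 2" for x by (rule KW.dF_local[OF that])
    show "\<mu> * e\<^sup>2 \<le> x \<bullet> grad F (\<theta>\<^sub>s + x)" if "0 < e" "e \<le> \<delta>\<^sub>1 / 2" "e \<le> norm x" for e x
      by (rule KW.dF_away[OF that])
    show "0 < \<delta>\<^sub>1 / 2" using \<open>\<delta>\<^sub>1 > 0\<close> by simp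
  qed (fact | rule c)+
  interpret SA: stochastic_approximation M KW.N ?W "\<lambda>i. KW.G (?hs i)" KW.G0 "\<lambda>x. grad F (\<theta>\<^sub>s + x)" "(*v) H"
      "\<theta>\<^sub>0 - \<theta>\<^sub>s" c "\<delta>\<^sub>1 / 2" \<mu> \<alpha> \<gamma> \<eta>\<^sub>0 h\<^sub>0
    by (rule sa)
  let ?J = "matrix_inv H"
  have H_sym: "transpose H = H"
    unfolding H_eq by (rule pos_semidef_symmetric[OF KW.hess_psd])
  \<comment> \<open>Strong convexity at the minimiser itself makes the kernel of \<open>H\<close>
    trivial.\<close>
  have "\<exists>B. B ** H = mat 1"
    unfolding matrix_left_invertible_ker
  proof (intro allI impI)
    fix x assume "H *v x = 0"
    moreover have "\<mu> * (norm x)\<^sup>2 \<le> x \<bullet> (H *v x)"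
      unfolding H_eq by (rule KW.hess_lower) (use \<open>\<delta>\<^sub>1 > 0\<close> in simp)
    ultimately have "\<mu> * (norm x)\<^sup>2 \<le> 0" by simp
    then show "x = 0" using \<open>\<mu> > 0\<close> by (simp add: mult_le_0_iff)
  qed
  then have inv: "invertible H" by (simp add: invertible_left_inverse)
  have HJ: "H ** ?J = mat 1" and JH: "?J ** H = mat 1"
    using someI_ex[OF inv[unfolded invertible_def]] by (simp_all add: matrix_inv_def)
  have J_sym: "transpose ?J = ?J"
  proof -
    have "transpose ?J ** H = mat 1"
      using arg_cong[OF HJ, of transpose] by (simp add: matrix_transpose_mul H_sym)
    then have "transpose ?J ** (H ** ?J) = ?J" by (simp add: matrix_mul_assoc)
    then show ?thesis by (simp add: HJ)
  qed
  have Qm: "Q\<^sub>m = KW.Qm"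
    unfolding Qm_eq KW.Qm_def Q_eq KW.Q_def S_eq KW.S_def KW.gf_def ..
  let ?\<Sigma> = "?J ** Q\<^sub>m ** ?J"
  \<comment> \<open>\<open>?J\<close> is symmetric and can be moved onto \<open>t\<close>; the form
    of the claimed covariance is then the variance found in
    \<open>scaled_average_char\<close>.\<close>
  have form: "t \<bullet> (?\<Sigma> *v t) = (\<integral>w. (t \<bullet> (?J *v KW.G0 w))\<^sup>2 \<partial>KW.N)" for t
    by (simp only: matrix_vector_mul_assoc[symmetric] symmetric_inner[OF J_sym] Qm KW.G0_form)
  have \<Sigma>_psd: "pos_semidef ?\<Sigma>"
    unfolding pos_semidef_def
  proof (intro conjI allI)
    show "transpose ?\<Sigma> = ?\<Sigma>"
      using pos_semidef_symmetric[OF KW.Qm_psd] by (simp add: matrix_transpose_mul J_sym Qm matrix_mul_assoc)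
    show "0 \<le> x \<bullet> (?\<Sigma> *v x)" for x
      unfolding form by (rule Bochner_Integration.integral_nonneg) simp
  qed
  have J_linear: "bounded_linear ((*v) ?J)" by (rule matrix_bounded_linear)
  have J_left: "?J *v (H *v x) = x" for x by (simp add: matrix_vector_mul_assoc JH)
  let ?\<theta> = "\<lambda>i \<omega>. kw_iterate f m \<eta> h \<theta>\<^sub>0 (\<lambda>i. \<zeta> i \<omega>) (\<lambda>i j. v i j \<omega>) i"
  \<comment> \<open>\<open>h\<close> and \<eta> are specified only from index 1 on, and the
    recursion evaluates them only at \<open>Suc i\<close>.\<close>
  have D_eq: "SA.D i \<omega> = ?\<theta> i \<omega> - \<theta>\<^sub>s" for i \<omega>
  proof (induction i)
    case (Suc i)
    have "KW.G (?hs (Suc i)) (SA.D i \<omega>) (?W (Suc i) \<omega>) =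
        (1 / real m) *\<^sub>R (\<Sum>j=1..m. kw_gradient f (h (Suc i)) (v (Suc i) j \<omega>) (?\<theta> i \<omega>) (\<zeta> (Suc i) \<omega>))"
      unfolding KW.G_def Suc.IH by (simp add: h_eq)
    moreover have "SA.step (Suc i) = \<eta> (Suc i)" by (simp add: SA.step_def \<eta>_eq)
    ultimately show ?case
      unfolding SA.D.simps(2) Suc.IH by simp
  next
    case 0
    show ?case by (simp only: SA.D.simps(1) kw_iterate.simps(1))
  qed
  have avg: "sqrt (real n) *\<^sub>R (kw_average f m \<eta> h \<theta>\<^sub>0 (\<lambda>i. \<zeta> i \<omega>) (\<lambda>i j. v i j \<omega>) n - \<theta>\<^sub>s) = SA.scaled_average n \<omega>" for n \<omega>
  \<comment> \<open>At \<open>n = 0\<close> the centring does not match, but both sides vanish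
    through the factor \<open>sqrt 0\<close>.\<close>
  proof (cases "n = 0")
    case False
    have "kw_average f m \<eta> h \<theta>\<^sub>0 (\<lambda>i. \<zeta> i \<omega>) (\<lambda>i j. v i j \<omega>) n - \<theta>\<^sub>s = (1 / real n) *\<^sub>R (\<Sum>i=1..n. ?\<theta> i \<omega> - \<theta>\<^sub>s)"
      using False by (simp add: kw_average_def sum_subtractf scaleR_diff_right sum_constant_scaleR del: sum_constant)
    then show ?thesis by (simp only: SA.scaled_average_def D_eq)
  next
    case True
    then show ?thesis unfolding SA.scaled_average_def by simp
  qed
  show ?thesis
    unfolding avg
  proof (rule M.multivariate_levy)
    show "SA.scaled_average n \<in> borel_measurable M" for n by (rule SA.scaled_average_measurable)
    show "prob_space (mv_normal 0 ?\<Sigma>)" by (rule prob_space_mv_normal)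
    show "sets (mv_normal 0 ?\<Sigma>) = sets borel" by simp
    show "(\<lambda>n. M.expectation (\<lambda>x. iexp (t \<bullet> SA.scaled_average n x))) \<longlonglongrightarrow> (\<integral>x. iexp (t \<bullet> x) \<partial>mv_normal 0 ?\<Sigma>)" for t
      using SA.scaled_average_char[OF J_linear J_left, of t] unfolding mv_normal_char[OF \<Sigma>_psd] form .
    show "\<exists>K. \<forall>\<^sub>F n in sequentially. M.prob {x \<in> space M. K < norm (SA.scaled_average n x)} \<le> e" if "0 < e" for e
      by (rule SA.scaled_average_tight[OF J_linear J_left that])
  qed
qed

end
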